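(* Let $f=(f_1,\dots,f_k)$ be a finite sequence of polynomials in $\mathbb{R}[x_1,\dots,x_d]$, let $L$ be a linear functional on $\mathbb{C}[x_1,\dots,x_d]$ such that $L(T_f)\ge0$, and let $\pi_L$ be the associated GNS representation on the pre-Hilbert space $\mathcal{D}_L$. If $p\in\mathbb{C}[x_1,\dots,x_d]$ is bounded on the set $K_f$, then the operator $\pi_L(p)$ is bounded on $\mathcal{D}_L$ and $\|\pi_L(p)\|\le\|p\|_K$, where $\|p\|_K=\sup\{|p(\lambda)|;\lambda\in K_f\}$.
   Context: Write $\mathbb{R}[x]=\mathbb{R}[x_1,\dots,x_d]$ and $\mathbb{C}[x]=\mathbb{C}[x_1,\dots,x_d]$; $\mathbb{C}[x]$ is a $*$-algebra with involution $p\mapsto\bar p$ (complex conjugation of coefficients). $K_f=\{x\in\mathbb{R}^d:f_1(x)\ge0,\dots,f_k(x)\ge0\}$, and $T_f$ is the set of all finite sums of elements $f_1^{\varepsilon_1}\cdots f_k^{\varepsilon_k}q^2$ with $q\in\mathbb{R}[x]$, $\varepsilon_i\in\{0,1\}$. $L(T_f)\ge0$ means $L(t)\ge0$ for all $t\in T_f$; then $L(p\bar p)\ge 0$ for all $p\in\mathbb{C}[x]$. GNS construction: $\mathcal{N}=\{p\in\mathbb{C}[x]:L(p\bar p)=0\}$ is an ideal of $\mathbb{C}[x]$; $\mathcal{D}_L:=\mathbb{C}[x]/\mathcal{N}$ is a pre-Hilbert space with scalar product $\langle p_1+\mathcal{N},p_2+\mathcal{N}\rangle=L(p_1\overline{p_2})$;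 and for $p\in\mathbb{C}[x]$ the linear operator $\pi_L(p):\mathcal{D}_L\to\mathcal{D}_L$ is defined by $\pi_L(p)(q+\mathcal{N})=pq+\mathcal{N}$. *)

theory Defs
  imports "HOL-Analysis.Analysis" "HOL-Library.Poly_Mapping"
begin

text \<open>
  Polynomials in indeterminates \<open>x\<^sub>i\<close> (\<open>i :: 'n\<close>) are finitely supported maps from exponents
  to coefficients, with the convolution product. For \<open>'n :: finite\<close> the number of
  indeterminates is \<open>d = CARD('n)\<close>, and points of \<open>\<real>\<^sup>d\<close> are vectors in \<open>real ^ 'n\<close>.
\<close>

type_synonym ('n, 'a) mpoly = "('n \<Rightarrow>\<^sub>0 nat) \<Rightarrow>\<^sub>0 'a"

definition poly_eval :: "('n::finite, 'a::real_algebra_1) mpoly \<Rightarrow> real ^ 'n \<Rightarrow> 'a" where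
  "poly_eval p x =
     (\<Sum>m \<in> Poly_Mapping.keys p. (\<Prod>i\<in>UNIV. (x $ i) ^ Poly_Mapping.lookup m i) *\<^sub>R Poly_Mapping.lookup p m)"

definition poly_scale :: "complex \<Rightarrow> ('n, complex) mpoly \<Rightarrow> ('n, complex) mpoly" where
  "poly_scale c = Poly_Mapping.map ((*) c)"

definition poly_cnj :: "('n, complex) mpoly \<Rightarrow> ('n, complex) mpoly" where
  "poly_cnj = Poly_Mapping.map cnj"

definition poly_of_real :: "('n, real) mpoly \<Rightarrow> ('n, complex) mpoly" where
  "poly_of_real = Poly_Mapping.map complex_of_real"

abbreviation linear_functional :: "(('n, complex) mpoly \<Rightarrow> complex) \<Rightarrow> bool" where
  "linear_functional L \<equiv> Vector_Spaces.linear poly_scale (*) L"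

definition semialg_set :: "('n::finite, real) mpoly list \<Rightarrow> (real ^ 'n) set" where
  "semialg_set f = {x. \<forall>j < length f. 0 \<le> poly_eval (f ! j) x}"

definition preordering :: "('n, real) mpoly list \<Rightarrow> ('n, real) mpoly set" where
  "preordering f =
     {\<Sum>i<n. (\<Prod>j<length f. (f ! j) ^ \<epsilon> i j) * (q i)\<^sup>2 | (n :: nat) (\<epsilon> :: nat \<Rightarrow> nat \<Rightarrow> nat) q.
        \<forall>i j. \<epsilon> i j \<in> {0, 1}}"

text \<open>Nonnegativity of a complex value includes that it is real.\<close>

definition nonneg_on_preordering ::
    "(('n, complex) mpoly \<Rightarrow> complex) \<Rightarrow> ('n, real) mpoly list \<Rightarrow> bool" where
  "nonneg_on_preordering L f \<longleftrightarrow> (\<forall>t \<in> preordering f. L (poly_of_real t) \<in> \<real>\<^sub>\<ge>\<^sub>0)"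

text \<open>
  The supremum is taken in \<open>[0, \<infinity>]\<close>, so it is \<open>0\<close> over the empty set; the real-valued
  \<open>Sup\<close> is meaningful here only for \<open>p\<close> bounded on \<open>K\<close>.
\<close>

definition sup_norm_on :: "(real ^ 'n) set \<Rightarrow> ('n::finite, complex) mpoly \<Rightarrow> real" where
  "sup_norm_on K p = (if K = {} then 0 else (SUP x\<in>K. cmod (poly_eval p x)))"

definition gns_null :: "(('n, complex) mpoly \<Rightarrow> complex) \<Rightarrow> ('n, complex) mpoly set" where
  "gns_null L = {p. L (p * poly_cnj p) = 0}"

definition gns_rel ::
    "(('n, complex) mpoly \<Rightarrow> complex) \<Rightarrow> (('n, complex) mpoly \<times> ('n, complex) mpoly) set" where
  "gns_rel L = {(p, q). p - q \<in> gns_null L}"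

abbreviation gns_class ::
    "(('n, complex) mpoly \<Rightarrow> complex) \<Rightarrow> ('n, complex) mpoly \<Rightarrow> ('n, complex) mpoly set" where
  "gns_class L p \<equiv> gns_rel L `` {p}"

definition gns_space ::
    "(('n, complex) mpoly \<Rightarrow> complex) \<Rightarrow> ('n, complex) mpoly set set" where
  "gns_space L = UNIV // gns_rel L"

text \<open>
  The scalar product and the operators \<open>\<pi>\<^sub>L(p)\<close> are defined on classes through arbitrary
  representatives; \<open>gns_inner_class\<close> and \<open>gns_op_class\<close> below show that the choice
  does not matter.
\<close>

definition gns_inner ::
    "(('n, complex) mpoly \<Rightarrow> complex) \<Rightarrow>
     ('n, complex) mpoly set \<Rightarrow> ('n, complex) mpoly set \<Rightarrow> complex" where
  "gns_inner L u v = the_elem (\<Union>p\<in>u. \<Union>q\<in>v. {L (p * poly_cnj q)})"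

definition gns_op ::
    "(('n, complex) mpoly \<Rightarrow> complex) \<Rightarrow> ('n, complex) mpoly \<Rightarrow>
     ('n, complex) mpoly set \<Rightarrow> ('n, complex) mpoly set" where
  "gns_op L p u = (\<Union>q\<in>u. gns_class L (p * q))"

definition gns_norm ::
    "(('n, complex) mpoly \<Rightarrow> complex) \<Rightarrow> ('n, complex) mpoly set \<Rightarrow> real" where
  "gns_norm L u = sqrt (Re (gns_inner L u u))"

definition gns_bounded ::
    "(('n, complex) mpoly \<Rightarrow> complex) \<Rightarrow>
     (('n, complex) mpoly set \<Rightarrow> ('n, complex) mpoly set) \<Rightarrow> bool" where
  "gns_bounded L T \<longleftrightarrow> (\<exists>C. \<forall>u \<in> gns_space L. gns_norm L (T u) \<le> C * gns_norm L u)"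

definition gns_opnorm ::
    "(('n, complex) mpoly \<Rightarrow> complex) \<Rightarrow>
     (('n, complex) mpoly set \<Rightarrow> ('n, complex) mpoly set) \<Rightarrow> real" where
  "gns_opnorm L T = (SUP u \<in> {u \<in> gns_space L. gns_norm L u \<le> 1}. gns_norm L (T u))"

lemma lookup_map_zero: "f 0 = 0 \<Longrightarrow> Poly_Mapping.lookup (Poly_Mapping.map f p) m = f (Poly_Mapping.lookup p m)"
  by (simp add: Poly_Mapping.map.rep_eq when_def)

lemma map_plus:
  assumes "f 0 = 0" "\<And>a b. f (a + b) = f a + f b"
  shows "Poly_Mapping.map f (p + q) = Poly_Mapping.map f p + Poly_Mapping.map f q"
  using assms by (intro poly_mapping_eqI) (simp add: lookup_map_zero lookup_add)

lemma update_eq_plus_single: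
  fixes p :: "'k \<Rightarrow>\<^sub>0 'b::comm_monoid_add"
  assumes "a \<notin> Poly_Mapping.keys p"
  shows "Poly_Mapping.update a b p = p + Poly_Mapping.single a b"
  using assms
  by (intro poly_mapping_eqI) (auto simp: lookup_update lookup_add lookup_single when_def in_keys_iff)

lemma map_single_mult:
  fixes f :: "'b::comm_semiring_1 \<Rightarrow> 'c::comm_semiring_1"
    and q :: "('n, 'b) mpoly"
  assumes "f 0 = 0" "\<And>a b. f (a + b) = f a + f b" "\<And>a b. f (a * b) = f a * f b"
  shows "Poly_Mapping.map f (Poly_Mapping.single m c * q) = Poly_Mapping.single m (f c) * Poly_Mapping.map f q"
proof (induction q rule: update_induct)
  case const
  have "Poly_Mapping.map f (0 :: ('n, 'b) mpoly) = 0"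
    by (intro poly_mapping_eqI) (simp add: lookup_map_zero assms(1))
  then show ?case by simp
next
  case (update q a b)
  have "Poly_Mapping.map f (Poly_Mapping.single m c * (q + Poly_Mapping.single a b))
      = Poly_Mapping.map f (Poly_Mapping.single m c * q) + Poly_Mapping.map f (Poly_Mapping.single (m + a) (c * b))"
    by (simp add: distrib_left mult_single map_plus assms)
  also have "\<dots> = Poly_Mapping.single m (f c) * Poly_Mapping.map f (q + Poly_Mapping.single a b)"
    by (simp add: update.IH map_single assms map_plus mult_single distrib_left)
  finally show ?case using update.hyps by (simp add: update_eq_plus_single)
qed

lemma map_times:
  fixes f :: "'b::comm_semiring_1 \<Rightarrow> 'c::comm_semiring_1"
    and p q :: "('n, 'b) mpoly"
  assumes "f 0 = 0" "\<And>a b. f (a + b) = f a + f b" "\<And>a b. f (a * b) = f a * f b"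
  shows "Poly_Mapping.map f (p * q) = Poly_Mapping.map f p * Poly_Mapping.map f q"
proof (induction p rule: update_induct)
  case const
  have "Poly_Mapping.map f (0 :: ('n, 'b) mpoly) = 0"
    by (intro poly_mapping_eqI) (simp add: lookup_map_zero assms(1))
  then show ?case by simp
next
  case (update p a b)
  have "Poly_Mapping.map f ((p + Poly_Mapping.single a b) * q)
      = Poly_Mapping.map f (p + Poly_Mapping.single a b) * Poly_Mapping.map f q"
    by (simp add: distrib_right map_plus map_single_mult map_single update.IH assms)
  then show ?case using update.hyps by (simp add: update_eq_plus_single)
qed

lemma lookup_poly_cnj [simp]: "Poly_Mapping.lookup (poly_cnj p) m = cnj (Poly_Mapping.lookup p m)"
  by (simp add: poly_cnj_def lookup_map_zero)

lemma lookup_poly_scale [simp]: "Poly_Mapping.lookup (poly_scale c p) m = c * Poly_Mapping.lookup p m"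
  by (simp add: poly_scale_def lookup_map_zero)

lemma lookup_poly_of_real [simp]: "Poly_Mapping.lookup (poly_of_real p) m = complex_of_real (Poly_Mapping.lookup p m)"
  by (simp add: poly_of_real_def lookup_map_zero)

lemma poly_cnj_plus [simp]: "poly_cnj (p + q) = poly_cnj p + poly_cnj q"
  by (intro poly_mapping_eqI) (simp add: lookup_add)

lemma poly_cnj_minus [simp]: "poly_cnj (p - q) = poly_cnj p - poly_cnj q"
  by (intro poly_mapping_eqI) (simp add: lookup_minus)

lemma poly_cnj_times [simp]: "poly_cnj (p * q) = poly_cnj p * poly_cnj q"
  unfolding poly_cnj_def by (rule map_times) auto

lemma poly_cnj_cnj [simp]: "poly_cnj (poly_cnj p) = p"
  by (intro poly_mapping_eqI) simp

lemma poly_cnj_scale [simp]: "poly_cnj (poly_scale c p) = poly_scale (cnj c) (poly_cnj p)"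
  by (intro poly_mapping_eqI) simp

lemma poly_of_real_plus: "poly_of_real (p + q) = poly_of_real p + poly_of_real q"
  by (intro poly_mapping_eqI) (simp add: lookup_add)

lemma poly_of_real_times: "poly_of_real (p * q) = poly_of_real p * poly_of_real q"
  unfolding poly_of_real_def by (rule map_times) auto

lemma poly_cnj_of_real [simp]: "poly_cnj (poly_of_real p) = poly_of_real p"
  by (intro poly_mapping_eqI) simp

lemma poly_scale_eq: "poly_scale c p = Poly_Mapping.single 0 c * p"
  by (simp add: poly_scale_def mult_map_scale_conv_mult)

lemma poly_scale_mult: "poly_scale c p * q = poly_scale c (p * q)" "p * poly_scale c q = poly_scale c (p * q)"
  by (simp_all add: poly_scale_eq ac_simps)

lemma poly_scale_add: "poly_scale c (p + q) = poly_scale c p + poly_scale c q"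
  by (intro poly_mapping_eqI) (simp add: lookup_add distrib_left)

lemma vector_space_poly_scale: "vector_space poly_scale"
  by unfold_locales
    (auto intro!: poly_mapping_eqI simp: lookup_add algebra_simps)

lemma poly_decompose:
  fixes p :: "('n, complex) mpoly"
  shows "p = poly_of_real (Poly_Mapping.map Re p)
           + poly_scale \<i> (poly_of_real (Poly_Mapping.map Im p))"
  by (intro poly_mapping_eqI)
    (simp add: lookup_add lookup_map_zero complex_eq)

lemma square_in_preordering:
  "a\<^sup>2 \<in> preordering f" "a\<^sup>2 + b\<^sup>2 \<in> preordering f"
proof -
  have *: "(\<Sum>i<n. (\<Prod>j<length f. (f ! j) ^ 0) * (q i)\<^sup>2) \<in> preordering f" for n :: nat and q
    unfolding preordering_def by (rule CollectI) (rule exI[of _ n], rule exI[of _ "\<lambda>_ _. 0"], auto)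
  show "a\<^sup>2 \<in> preordering f" using *[where n = 1 and q = "\<lambda>_. a"] by simp
  show "a\<^sup>2 + b\<^sup>2 \<in> preordering f"
    using *[where n = 2 and q = "\<lambda>i. if i = 0 then a else b"]
    by (simp add: numeral_2_eq_2 add.commute)
qed

lemma nonneg_mult_poly_cnj:
  assumes "nonneg_on_preordering L f"
  shows "L (p * poly_cnj p) \<in> \<real>\<^sub>\<ge>\<^sub>0"
proof -
  let ?a = "Poly_Mapping.map Re p" and ?b = "Poly_Mapping.map Im p"
  let ?A = "poly_of_real ?a" and ?B = "poly_of_real ?b"
  have ss: "poly_scale \<i> (poly_scale (- \<i>) q) = q" "poly_scale (- \<i>) (poly_scale \<i> q) = q"
    for q :: "('a, complex) mpoly"
    by (intro poly_mapping_eqI, simp)+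
  have sm: "poly_scale (- \<i>) q = - poly_scale \<i> q" for q :: "('a, complex) mpoly"
    by (intro poly_mapping_eqI) simp
  have "p * poly_cnj p = (?A + poly_scale \<i> ?B) * (?A + poly_scale (- \<i>) ?B)"
    by (subst (1 2) poly_decompose[of p]) simp
  also have "\<dots> = ?A * ?A + poly_scale \<i> (?B * ?A) + poly_scale (- \<i>) (?A * ?B)
                   + poly_scale \<i> (poly_scale (- \<i>) (?B * ?B))"
    by (simp add: distrib_left distrib_right poly_scale_mult poly_scale_add add.assoc ss)
  also have "\<dots> = poly_of_real (?a\<^sup>2 + ?b\<^sup>2)"
    by (simp only: ss) (simp add: sm poly_of_real_plus poly_of_real_times power2_eq_square mult.commute)
  finally show ?thesis
    using assms square_in_preordering(2) unfolding nonneg_on_preordering_def by metis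
qed

locale positive_functional =
  fixes L :: "('n, complex) mpoly \<Rightarrow> complex"
  assumes lin: "linear_functional L"
    and pos: "L (p * poly_cnj p) \<in> \<real>\<^sub>\<ge>\<^sub>0"
begin

lemma L_add: "L (p + q) = L p + L q"
  using lin by (simp add: Vector_Spaces.linear_iff)

lemma L_scale: "L (poly_scale c p) = c * L p"
  using lin by (simp add: Vector_Spaces.linear_iff)

lemma L_diff: "L (p - q) = L p - L q"
  using L_add[of "p - q" q] by simp

lemma null_orthogonal:
  assumes "p \<in> gns_null L"
  shows "L (p * poly_cnj q) = 0" "L (q * poly_cnj p) = 0"
proof -
  define a b c where "a = L (p * poly_cnj q)" and "b = L (q * poly_cnj p)"
    and "c = L (q * poly_cnj q)"
  have key: "t * a + cnj t * b + c \<in> \<real>\<^sub>\<ge>\<^sub>0" for t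
  proof -
    have "L ((poly_scale t p + q) * poly_cnj (poly_scale t p + q)) = t * a + cnj t * b + c"
      using assms
      by (simp add: a_def b_def c_def distrib_left distrib_right poly_scale_mult L_add L_scale gns_null_def)
    then show ?thesis using pos by metis
  qed
  have c: "Im c = 0" "Re c \<ge> 0" using key[of 0] by (auto simp: complex_nonneg_Reals_iff)
  have im: "Im (t * a + cnj t * b) = 0" for t
    using key[of t] c by (simp add: complex_nonneg_Reals_iff)
  have "Im a + Im b = 0" "Re a - Re b = 0"
    using im[of 1] im[of \<i>] by simp_all
  moreover have "Re a = 0" if "Re a = Re b"
  proof (rule ccontr)
    assume "Re a \<noteq> 0"
    then show False
      using key[of "of_real (- (Re c + 1) / (2 * Re a))"] that
      by (simp add: complex_nonneg_Reals_iff field_simps)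
  qed
  moreover have "Im a = 0" if "Im b = - Im a"
  proof (rule ccontr)
    assume "Im a \<noteq> 0"
    then show False
      using key[of "\<i> * of_real ((Re c + 1) / (2 * Im a))"] that
      by (simp add: complex_nonneg_Reals_iff field_simps)
  qed
  ultimately have "a = 0" "b = 0" by (auto simp: complex_eq_iff)
  then show "L (p * poly_cnj q) = 0" "L (q * poly_cnj p) = 0" by (simp_all add: a_def b_def)
qed

lemma null_ideal:
  "0 \<in> gns_null L"
  "p \<in> gns_null L \<Longrightarrow> q \<in> gns_null L \<Longrightarrow> p + q \<in> gns_null L"
  "p \<in> gns_null L \<Longrightarrow> q \<in> gns_null L \<Longrightarrow> p - q \<in> gns_null L"
  "p \<in> gns_null L \<Longrightarrow> r * p \<in> gns_null L"
proof -
  show "0 \<in> gns_null L" using L_diff[of 0 0] by (simp add: gns_null_def)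
next
  assume pq: "p \<in> gns_null L" "q \<in> gns_null L"
  note o = null_orthogonal[OF pq(1)] null_orthogonal[OF pq(2)]
  show "p + q \<in> gns_null L" "p - q \<in> gns_null L"
    by (simp_all add: gns_null_def distrib_left distrib_right left_diff_distrib
        right_diff_distrib L_add L_diff o)
next
  assume "p \<in> gns_null L"
  then have "L (p * poly_cnj (p * r * poly_cnj r)) = 0"
    by (rule null_orthogonal(1))
  moreover have "(r * p) * poly_cnj (r * p) = p * poly_cnj (p * r * poly_cnj r)"
    by (simp add: ac_simps)
  ultimately show "r * p \<in> gns_null L"
    by (simp only: gns_null_def mem_Collect_eq)
qed

lemma equiv_gns_rel: "equiv UNIV (gns_rel L)"
proof (rule equivI)
  show "gns_rel L \<subseteq> UNIV \<times> UNIV" by simp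
  show "refl (gns_rel L)" by (auto simp: refl_on_def gns_rel_def null_ideal)
  show "sym (gns_rel L)"
    using null_ideal(3)[OF null_ideal(1)] by (fastforce simp: sym_def gns_rel_def)
  show "trans (gns_rel L)"
    using null_ideal(2) by (fastforce simp: trans_def gns_rel_def)
qed

lemma gns_inner_class: "gns_inner L (gns_class L p) (gns_class L q) = L (p * poly_cnj q)"
proof -
  have *: "L (p' * poly_cnj q') = L (p * poly_cnj q)"
    if "p - p' \<in> gns_null L" "q - q' \<in> gns_null L" for p' q'
    using null_orthogonal(1)[OF that(1), of q] null_orthogonal(2)[OF that(2), of p']
    by (simp add: left_diff_distrib right_diff_distrib L_diff)
  have "p \<in> gns_class L p" "q \<in> gns_class L q" by (simp_all add: gns_rel_def null_ideal(1))
  moreover have "L (p' * poly_cnj q') = L (p * poly_cnj q)"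
    if "p' \<in> gns_class L p" "q' \<in> gns_class L q" for p' q'
    using that by (intro *) (simp_all add: gns_rel_def)
  ultimately have "(\<Union>p'\<in>gns_class L p. \<Union>q'\<in>gns_class L q. {L (p' * poly_cnj q')})
      = {L (p * poly_cnj q)}"
    by blast
  then show ?thesis by (simp add: gns_inner_def)
qed

lemma gns_op_class: "gns_op L p (gns_class L q) = gns_class L (p * q)"
proof -
  have "gns_class L (p * q') = gns_class L (p * q)" if "q' \<in> gns_class L q" for q'
  proof -
    have "(p * q, p * q') \<in> gns_rel L"
      using that null_ideal(4)[of "q - q'" p] by (simp add: gns_rel_def right_diff_distrib)
    then show ?thesis using equiv_class_eq[OF equiv_gns_rel] by metis
  qed
  moreover have "q \<in> gns_class L q" using null_ideal(1) by (simp add: gns_rel_def)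
  ultimately show ?thesis unfolding gns_op_def by blast
qed

end

lemma positive_functionalI:
  "linear_functional L \<Longrightarrow> nonneg_on_preordering L f \<Longrightarrow> positive_functional L"
  by (simp add: positive_functional_def nonneg_mult_poly_cnj)

end

theory Submission
  imports Defs "HOL-Algebra.Algebraic_Closure_Type" "HOL-Library.Multiset_Order"
begin

text \<open>
  Put \<open>G = |p|\<^sup>2\<close>, a real polynomial, and let \<open>\<mu> > \<parallel>p\<parallel>\<^sub>K\<close>, so that \<open>\<mu>\<^sup>2 - G > 0\<close> on \<open>K\<^sub>f\<close>. The set
  \<open>K\<^sub>f\<close> may be unbounded and \<open>L\<close> need not come from a measure, so positivity on \<open>K\<^sub>f\<close> has to be
  turned into algebra: the Positivstellensatz of Krivine and Stengle (theorem \<open>positivstellensatz\<close>)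
  provides \<open>g, h \<in> T\<^sub>f\<close> with \<open>g (\<mu>\<^sup>2 - G) = 1 + h\<close>. Multiplying by \<open>G\<^sup>n |q|\<^sup>2 \<in> T\<^sub>f\<close> and applying
  \<open>L\<close> shows that the moments \<open>s\<^sub>n = L(G\<^sup>n |q|\<^sup>2)\<close> grow at most like \<open>\<mu>\<^bsup>2n\<^esup>\<close>. By the Cauchy-Schwarz
  inequality they are log-convex, so already the first ratio satisfies \<open>s\<^sub>1 \<le> \<mu>\<^sup>2 s\<^sub>0\<close>
  (\<open>log_convex_growth_bound\<close>), and that is \<open>\<parallel>\<pi>\<^sub>L(p) q\<parallel>\<^sup>2 \<le> \<mu>\<^sup>2 \<parallel>q\<parallel>\<^sup>2\<close>. Let \<open>\<mu>\<close> tend to \<open>\<parallel>p\<parallel>\<^sub>K\<close>.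

  Most of the text proves the Positivstellensatz. If there is no such identity for \<open>F\<close>, then
  \<open>T\<^sub>f - F T\<^sub>f\<close> is a preordering without \<open>- 1\<close>. By Zorn's lemma it lies in a prime cone \<open>P\<close>; the residue
  ring of \<open>P\<close> is an ordered domain, and its fraction field has a real closure \<open>R\<close>. The residues
  \<open>\<xi>\<^sub>i \<in> R\<close> of the indeterminates form a point at which all \<open>f\<^sub>j\<close> and \<open>- F\<close> are nonnegative. It
  remains to find a real point with the same finitely many signs
  (\<open>prime_cone_realizable\<close>, the theorem of Artin and Lang).

  The transfer from \<open>R\<close> to the reals replaces one coordinate \<open>\<xi>\<^sub>i\<close> after the other
  (\<open>adjoin_coordinate\<close>). For one variable it rests on the elimination procedure of Cohen and
  Hoermander: the sign table of finitely many polynomials over a real closed field is determined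
  by the table of polynomials of smaller degree, namely the derivative and the remainders of the one of
  largest degree (\<open>sign_match_extend\<close>, \<open>tracked_sign_match\<close>). The real closure is a maximal
  ordered subfield of the algebraic closure; a polynomial of least degree that changes sign without a
  root would allow a larger one (\<open>maximal_cone_root\<close>).
\<close>

(* The short names are to denote the notions on types, not those for structures with carriers. *)
hide_const (open) up_ring.coeff up_ring.monom Polynomials.degree Polynomials.lead_coeff
  module.smult Coset.order Order.top

section \<open>Polynomials over real closed fields\<close>

text \<open>
  Sums of powers stand for polynomials: inside the class specification the carrier does not yet have the type class
  that the polynomial type requires. A root anywhere suffices, because splitting off the roots that
  lie outside an interval leads to one inside (\<open>poly_ivt_mult\<close> below).
\<close>

class real_closed_field = linordered_field +
  assumes sign_change_root_sum:
    "(\<Sum>i\<le>n. c i * a ^ i) * (\<Sum>i\<le>n. c i * b ^ i) < 0 \<Longrightarrow> \<exists>x. (\<Sum>i\<le>n. c i * x ^ i) = 0"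

lemma sign_change_root:
  fixes p :: "'a::real_closed_field poly"
  shows "poly p a * poly p b < 0 \<Longrightarrow> \<exists>x. poly p x = 0"
  using sign_change_root_sum[of "coeff p" a "degree p" b] by (simp only: poly_altdef)

lemma real_closed_field_classI:
  assumes "\<And>(p :: 'a::linordered_field poly) a b. poly p a * poly p b < 0 \<Longrightarrow> \<exists>x. poly p x = 0"
  shows "OFCLASS('a, real_closed_field_class)"
proof
  fix n :: nat and c :: "nat \<Rightarrow> 'a" and a b
  have "poly (\<Sum>i\<le>n. monom (c i) i) x = (\<Sum>i\<le>n. c i * x ^ i)" for x
    by (simp add: poly_sum poly_monom)
  then show "(\<Sum>i\<le>n. c i * a ^ i) * (\<Sum>i\<le>n. c i * b ^ i) < 0 \<Longrightarrow> \<exists>x. (\<Sum>i\<le>n. c i * x ^ i) = 0"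
    using assms[of "\<Sum>i\<le>n. monom (c i) i" a b] by simp
qed

instance real :: real_closed_field
proof (rule real_closed_field_classI)
  fix p :: "real poly" and a b :: real
  assume ab: "poly p a * poly p b < 0"
  consider "a < b" | "b < a" | "a = b" by linarith
  then show "\<exists>x. poly p x = 0"
    using poly_IVT[of a b p] poly_IVT[of b a p] ab
    by cases (auto simp: mult.commute mult_less_0_iff)
qed

text \<open>
  Signs of elements of two different ordered fields are compared, so the value has to lie in a type
  common to both.
\<close>

definition sg :: "'a::linordered_idom \<Rightarrow> int" where
  "sg x = (if x > 0 then 1 else if x < 0 then - 1 else 0)"

lemma sg_simps [simp]: "sg 0 = 0" "sg x = 0 \<longleftrightarrow> x = 0" "sg x = 1 \<longleftrightarrow> x > 0" "sg x = - 1 \<longleftrightarrow> x < 0"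
  "sg (- x) = - sg x"
  by (auto simp: sg_def)

lemma sg_mult: "sg (x * y) = sg x * sg y"
  by (auto simp: sg_def mult_less_0_iff zero_less_mult_iff)

lemma sg_eq_iff: "sg x = sg y \<longleftrightarrow> (x > 0 \<longleftrightarrow> y > 0) \<and> (x < 0 \<longleftrightarrow> y < 0)"
  by (auto simp: sg_def)

text \<open>
  A root \<open>r\<close> outside the interval contributes a factor \<open>x - r\<close> of constant sign there, so the
  quotient still changes sign and has smaller degree.
\<close>

lemma poly_ivt_mult:
  fixes p :: "'a::real_closed_field poly"
  shows "a < b \<Longrightarrow> poly p a * poly p b < 0 \<Longrightarrow> \<exists>x. a < x \<and> x < b \<and> poly p x = 0"
proof (induction "degree p" arbitrary: p rule: less_induct)
  case less
  obtain r where r: "poly p r = 0" using sign_change_root[OF less.prems(2)] by blast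
  show ?case
  proof (cases "a < r \<and> r < b")
    case False
    from r obtain q where q: "p = [:- r, 1:] * q" by (metis poly_eq_0_iff_dvd dvd_def)
    have ne: "r \<noteq> a" "r \<noteq> b" using r less.prems(2) by auto
    have "q \<noteq> 0" using less.prems(2) q by auto
    then have deg: "degree q < degree p" by (simp add: q degree_mult_eq del: mult_pCons_left)
    have "(a - r) * (b - r) > 0"
      using False ne less.prems(1) by (auto simp: zero_less_mult_iff not_less)
    moreover have "(a - r) * (b - r) * (poly q a * poly q b) < 0"
      using less.prems(2) by (simp add: q algebra_simps)
    ultimately have "poly q a * poly q b < 0"
      by (metis mult_nonneg_nonneg not_less less_imp_le)
    from less.hyps[OF deg less.prems(1) this] show ?thesis by (auto simp: q)
  qed (use r in blast)
qed

lemma sg_eq_of_no_root: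
  fixes p :: "'a::real_closed_field poly"
  assumes "a \<le> b" and "\<And>x. a \<le> x \<Longrightarrow> x \<le> b \<Longrightarrow> poly p x \<noteq> 0"
  shows "sg (poly p a) = sg (poly p b)"
proof (rule ccontr)
  assume ne: "sg (poly p a) \<noteq> sg (poly p b)"
  then have "a < b" using assms(1) by (cases "a = b") auto
  moreover have "poly p a * poly p b < 0"
    using ne assms(2)[of a] assms(2)[of b] assms(1) by (auto simp: mult_less_0_iff sg_eq_iff)
  ultimately show False using poly_ivt_mult[of a b p] assms(2) by auto
qed

text \<open>
  Between adjacent roots write \<open>p = (x - a)\<^sup>m (x - b)\<^sup>n q\<close> with \<open>q\<close> of constant sign. The cofactor of
  \<open>(x - a)\<^bsup>m-1\<^esup> (x - b)\<^bsup>n-1\<^esup>\<close> in \<open>p'\<close> has opposite signs at \<open>a\<close> and \<open>b\<close>, so the intermediate value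
  property applies to it.
\<close>

lemma rolle_adjacent:
  fixes p :: "'a::real_closed_field poly"
  assumes "a < b" "poly p a = 0" "poly p b = 0" "\<And>x. a < x \<Longrightarrow> x < b \<Longrightarrow> poly p x \<noteq> 0"
  shows "\<exists>c. a < c \<and> c < b \<and> poly (pderiv p) c = 0"
proof -
  have p0: "p \<noteq> 0" using assms(4)[of "(a + b) / 2"] assms(1) by (auto simp: field_simps)
  from order_decomp[OF p0, of a] obtain p1
    where p1: "p = [:- a, 1:] ^ order a p * p1" "\<not> [:- a, 1:] dvd p1" by blast
  have p10: "p1 \<noteq> 0" using p1 p0 by auto
  from order_decomp[OF p10, of b] obtain q
    where q: "p1 = [:- b, 1:] ^ order b p1 * q" "\<not> [:- b, 1:] dvd q" by blast
  have "order a p \<noteq> 0" using assms(2) p0 by (simp add: order_root)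
  then obtain m where m: "order a p = Suc m" by (cases "order a p") auto
  have "poly p b = (b - a) ^ order a p * poly p1 b"
    by (subst p1(1)) (simp add: poly_power)
  then have "poly p1 b = 0" using assms(1,3) by simp
  then have "order b p1 \<noteq> 0" using p10 by (simp add: order_root)
  then obtain n where n: "order b p1 = Suc n" by (cases "order b p1") auto
  define A B where "A = [:- a, 1:]" and "B = [:- b, 1:]"
  have pq: "p = A ^ Suc m * B ^ Suc n * q" using p1(1) q(1) m n by (simp add: A_def B_def ac_simps)
  have pA: "poly A x = x - a" "poly B x = x - b" for x by (simp_all add: A_def B_def)
  have dA: "pderiv A = 1" "pderiv B = 1" by (simp_all add: A_def B_def pderiv_pCons)
  have qa: "poly q a \<noteq> 0" using p1(2) q(1) by (metis dvd_mult poly_eq_0_iff_dvd)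
  have qb: "poly q b \<noteq> 0" using q(2) by (simp add: poly_eq_0_iff_dvd)
  have q_no_root: "poly q x \<noteq> 0" if "a \<le> x" "x \<le> b" for x
    using assms(4)[of x] qa qb that by (cases "x = a \<or> x = b") (auto simp: pq)
  have "sg (poly q a) = sg (poly q b)" using assms(1) q_no_root by (intro sg_eq_of_no_root) auto
  then have qq: "poly q a * poly q b > 0" using qa qb by (auto simp: sg_eq_iff zero_less_mult_iff)
  \<comment> \<open>the cofactor of p', with values of opposite signs at a and b\<close>
  define r where "r = of_nat (Suc m) * (B * q) + of_nat (Suc n) * (A * q) + A * B * pderiv q"
  have der: "pderiv p = A ^ m * B ^ n * r"
    unfolding pq r_def
    by (simp only: pderiv_mult pderiv_power_Suc dA of_nat_mult_conv_smult[symmetric]) (simp add: algebra_simps of_nat_poly)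
  have ra: "poly r a = of_nat (Suc m) * (a - b) * poly q a"
    and rb: "poly r b = of_nat (Suc n) * (b - a) * poly q b"
    by (simp_all add: r_def pA)
  have "(of_nat (Suc m) * of_nat (Suc n)) * ((b - a) * (b - a)) * (poly q a * poly q b) > (0::'a)"
    using assms(1) qq by (intro mult_pos_pos[of _ "poly q a * poly q b"] mult_pos_pos[of "of_nat (Suc m) * _"]
        mult_pos_pos[of "b - a"] mult_pos_pos[of "of_nat _"]) (simp_all del: of_nat_Suc)
  then have "poly r a * poly r b < 0" unfolding ra rb by (simp add: algebra_simps del: of_nat_Suc)
  with poly_ivt_mult[OF assms(1)] obtain c where "a < c" "c < b" "poly r c = 0" by blast
  then show ?thesis by (auto simp: der)
qed

lemma poly_rolle:
  fixes p :: "'a::real_closed_field poly"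
  assumes "a < b" "poly p a = 0" "poly p b = 0"
  shows "\<exists>c. a < c \<and> c < b \<and> poly (pderiv p) c = 0"
proof (cases "p = 0")
  case True
  then show ?thesis using dense[OF assms(1)] by auto
next
  case False
  define R where "R = {x. a < x \<and> x \<le> b \<and> poly p x = 0}"
  have R: "finite R" "R \<noteq> {}"
    using poly_roots_finite[OF False] assms by (auto simp: R_def intro: finite_subset)
  have M: "Min R \<in> R" using R by simp
  have "\<exists>c. a < c \<and> c < Min R \<and> poly (pderiv p) c = 0"
  proof (rule rolle_adjacent)
    fix x assume x: "a < x" "x < Min R"
    then have "x \<notin> R" using R Min_le by fastforce
    then show "poly p x \<noteq> 0" using x M by (auto simp: R_def)
  qed (use M assms in \<open>auto simp: R_def\<close>)
  then show ?thesis using M by (auto simp: R_def intro: order_less_le_trans)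
qed

lemma poly_strict_mono_of_pderiv_pos:
  fixes p :: "'a::real_closed_field poly"
  assumes "a < b" "\<And>x. a < x \<Longrightarrow> x < b \<Longrightarrow> poly (pderiv p) x > 0"
  shows "poly p a < poly p b"
proof -
  define k where "k = (poly p b - poly p a) / (b - a)"
  define h where "h = p - [:poly p a - k * a, k:]"
  have "k * (b - a) = poly p b - poly p a" using assms(1) by (simp add: k_def)
  moreover have "poly h a = 0" "poly h b = poly p b - poly p a - k * (b - a)"
    by (simp_all add: h_def algebra_simps)
  ultimately have "poly h a = 0" "poly h b = 0" by simp_all
  from poly_rolle[OF assms(1) this] obtain c where "a < c" "c < b" "poly (pderiv h) c = 0" by blast
  then have "k > 0" using assms(2)[of c] by (simp add: h_def pderiv_diff pderiv_pCons)
  then show ?thesis using assms(1) by (simp add: k_def zero_less_divide_iff)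
qed

lemma poly_ge_lead_coeff_at_top:
  fixes p :: "'a::linordered_field poly"
  shows "lead_coeff p > 0 \<Longrightarrow> \<exists>n. \<forall>x\<ge>n. poly p x \<ge> lead_coeff p"
proof (induction p)
  case 0
  then show ?case by simp
next
  case (pCons a p)
  show ?case
  proof (cases "p = 0")
    case True
    then show ?thesis by auto
  next
    case False
    then obtain n where n: "\<And>x. x \<ge> n \<Longrightarrow> lead_coeff p \<le> poly p x" and gt0: "lead_coeff p > 0"
      using pCons by auto
    \<comment> \<open>beyond N the value of p is at least its leading coefficient, and x times that outweighs a\<close>
    define N where "N = max n (1 + \<bar>a\<bar> / lead_coeff p)"
    show ?thesis
    proof (intro exI allI impI)
      fix x assume x: "N \<le> x"
      have "lead_coeff p \<le> poly p x" using x n by (simp add: N_def)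
      moreover have "x \<ge> 1 + \<bar>a\<bar> / lead_coeff p" "x \<ge> 1"
        using x gt0 by (auto simp: N_def intro: order_trans[rotated])
      ultimately have "lead_coeff p * (1 + \<bar>a\<bar> / lead_coeff p) \<le> poly p x * x"
        using gt0 by (intro mult_mono) auto
      moreover have "lead_coeff p * (1 + \<bar>a\<bar> / lead_coeff p) = lead_coeff p + \<bar>a\<bar>"
        using gt0 False by (simp add: distrib_left)
      ultimately have "lead_coeff p + \<bar>a\<bar> \<le> x * poly p x" by (simp only: mult.commute)
      then have "lead_coeff p \<le> a + x * poly p x" by linarith
      then show "lead_coeff (pCons a p) \<le> poly (pCons a p) x" using False by simp
    qed
  qed
qed

lemma poly_nonconst_unbounded_at_top:
  fixes p :: "'a::linordered_field poly"
  assumes "degree p > 0"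
  shows "(\<forall>c. \<exists>n. \<forall>x\<ge>n. poly p x > c) \<or> (\<forall>c. \<exists>n. \<forall>x\<ge>n. poly p x < c)"
proof -
  have key: "\<exists>n. \<forall>x\<ge>n. poly q x > d" if "degree q > 0" "lead_coeff q > 0" for q :: "'a poly" and d
  proof -
    have "degree (q - [:d:]) = degree q"
      using degree_add_eq_left[of "- [:d:]" q] that(1) by (simp only: diff_conv_add_uminus degree_minus degree_pCons_0)
    moreover have "coeff (q - [:d:]) (degree q) = lead_coeff q"
      using that(1) by (auto simp: coeff_pCons split: nat.split)
    ultimately have "lead_coeff (q - [:d:]) = lead_coeff q" by simp
    with poly_ge_lead_coeff_at_top[of "q - [:d:]"] that(2) obtain n
      where "\<And>x. x \<ge> n \<Longrightarrow> poly (q - [:d:]) x \<ge> lead_coeff q" by auto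
    then have "poly q x > d" if "x \<ge> n" for x
      using \<open>lead_coeff q > 0\<close> that by (metis diff_gt_0_iff_gt order_less_le_trans poly_const_conv poly_diff)
    then show ?thesis by blast
  qed
  have "p \<noteq> 0" using assms by auto
  then consider "lead_coeff p > 0" | "lead_coeff (- p) > 0"
    using linorder_cases[of "lead_coeff p" 0] by auto
  then show ?thesis
  proof cases
    case 1 then show ?thesis using key[OF assms] by blast
  next
    case 2
    then have "\<exists>n. \<forall>x\<ge>n. poly p x < c" for c
      using key[of "- p" "- c"] assms by (simp only: degree_minus poly_minus neg_less_iff_less)
    then show ?thesis by blast
  qed
qed

section \<open>Matching sign tables of two fields\<close>

text \<open>
  A finite set \<open>Z\<close> of pairs cuts both lines into corresponding cells: points and open intervals.
  Aligned elements lie in corresponding cells.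
\<close>

definition aligned :: "('a::linordered_idom \<times> 'b::linordered_idom) set \<Rightarrow> 'a \<Rightarrow> 'b \<Rightarrow> bool" where
  "aligned Z t t' \<longleftrightarrow> (\<forall>a b. (a, b) \<in> Z \<longrightarrow> sg (t - a) = sg (t' - b))"

text \<open>
  The sign table of the left polynomials over the first field and that of the right ones over the
  second are the same; \<open>Z\<close> pairs the points at which the columns change. Points of \<open>Z\<close> that
  are no roots are allowed, so that subfamilies inherit the table.
\<close>

definition sign_match ::
    "('a::linordered_idom poly \<times> 'b::linordered_idom poly) set \<Rightarrow> ('a \<times> 'b) set \<Rightarrow> bool" where
  "sign_match Q Z \<longleftrightarrow> finite Z \<and> (\<forall>a b. (a, b) \<in> Z \<longrightarrow> aligned Z a b) \<and>
     (\<forall>t t' p q. aligned Z t t' \<longrightarrow> (p, q) \<in> Q \<longrightarrow> sg (poly p t) = sg (poly q t'))"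

lemma sg_minus_commute: "sg (a - b) = - sg (b - a)"
  by (auto simp: sg_def)

lemma alignedD: "aligned Z t t' \<Longrightarrow> (a, b) \<in> Z \<Longrightarrow> sg (t - a) = sg (t' - b)"
  by (auto simp: aligned_def)

lemma aligned_less:
  assumes "aligned Z t t'" "(a, b) \<in> Z"
  shows "a < t \<longleftrightarrow> b < t'" "t < a \<longleftrightarrow> t' < b" "t = a \<longleftrightarrow> t' = b"
  using alignedD[OF assms] by (auto simp: sg_eq_iff)

lemma aligned_converse: "aligned (Z\<inverse>) t' t \<longleftrightarrow> aligned Z t t'"
  unfolding aligned_def by (metis converse_iff)

lemma sign_matchD:
  assumes "sign_match Q Z"
  shows "finite Z" "(a, b) \<in> Z \<Longrightarrow> aligned Z a b"
    "aligned Z t t' \<Longrightarrow> (p, q) \<in> Q \<Longrightarrow> sg (poly p t) = sg (poly q t')"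
  using assms unfolding sign_match_def by simp_all

lemma sign_match_converse: "sign_match Q Z \<Longrightarrow> sign_match (Q\<inverse>) (Z\<inverse>)"
  by (simp add: sign_match_def aligned_converse)

lemma sign_match_mono: "sign_match Q Z \<Longrightarrow> Q' \<subseteq> Q \<Longrightarrow> sign_match Q' Z"
  by (meson sign_match_def subsetD)

lemma ex_between_finite:
  fixes L U :: "'a::linordered_field set"
  assumes "finite L" "finite U" "\<And>l u. l \<in> L \<Longrightarrow> u \<in> U \<Longrightarrow> l < u"
  shows "\<exists>x. (\<forall>l\<in>L. l < x) \<and> (\<forall>u\<in>U. x < u)"
proof -
  define l where "l = (if L = {} then (if U = {} then 0 else Min U - 1) else Max L)"
  define u where "u = (if U = {} then l + 1 else Min U)"
  have "l < u"
  proof (cases "L = {} \<or> U = {}")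
    case False
    then show ?thesis using assms(3)[of "Max L" "Min U"] assms(1,2) by (simp add: l_def u_def)
  qed (auto simp: l_def u_def)
  then obtain x where x: "l < x" "x < u" using dense by blast
  have "\<forall>a\<in>L. a \<le> l" using assms(1) by (auto simp: l_def)
  moreover have "\<forall>a\<in>U. u \<le> a" using assms(2) by (auto simp: u_def)
  ultimately show ?thesis using x by (meson le_less_trans less_le_trans)
qed

text \<open>
  An ordered field is dense and unbounded, so no cell is empty. Hence matching tables have the same
  columns.
\<close>

lemma ex_aligned:
  fixes Z :: "('a::linordered_field \<times> 'b::linordered_field) set"
  assumes "finite Z" "\<And>a b. (a, b) \<in> Z \<Longrightarrow> aligned Z a b"
  shows "\<exists>t'. aligned Z t t'"
proof (cases "t \<in> fst ` Z")
  case True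
  then obtain b where "(t, b) \<in> Z" by auto
  then show ?thesis using assms(2) by blast
next
  case False
  define L where "L = snd ` {z \<in> Z. fst z < t}"
  define U where "U = snd ` {z \<in> Z. t < fst z}"
  have "l < u" if lu: "l \<in> L" "u \<in> U" for l u
  proof -
    obtain a b where ab: "(a, l) \<in> Z" "a < t" "(b, u) \<in> Z" "t < b"
      using lu by (auto simp: L_def U_def)
    then show ?thesis using aligned_less(1)[OF assms(2)[OF ab(3)] ab(1)] by auto
  qed
  then obtain t' where t': "\<forall>l\<in>L. l < t'" "\<forall>u\<in>U. t' < u"
    using ex_between_finite[of L U] assms(1) by (auto simp: L_def U_def)
  have "sg (t - a) = sg (t' - b)" if ab: "(a, b) \<in> Z" for a b
  proof -
    have "a \<noteq> t" using False ab by (metis fst_conv image_eqI)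
    then consider "a < t" | "t < a" by (auto simp: neq_iff)
    then show ?thesis
    proof cases
      case 1 then have "b \<in> L" unfolding L_def using ab by (intro image_eqI[of _ _ "(a, b)"]) auto
      with t' 1 show ?thesis by (auto simp: sg_eq_iff)
    next
      case 2 then have "b \<in> U" unfolding U_def using ab by (intro image_eqI[of _ _ "(a, b)"]) auto
      with t' 2 show ?thesis by (auto simp: sg_eq_iff)
    qed
  qed
  then show ?thesis by (auto simp: aligned_def)
qed

text \<open>
  A root outside \<open>Z\<close> would lie in an open cell, on which the sign of \<open>p\<close> is constant, and \<open>p\<close>
  would have infinitely many roots.
\<close>

lemma sign_match_root:
  fixes p :: "'a::linordered_field poly" and q :: "'b::linordered_field poly"
  assumes "sign_match Q Z" "(p, q) \<in> Q" "p \<noteq> 0" "poly p s = 0"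
  shows "s \<in> fst ` Z"
proof (rule ccontr)
  assume s: "s \<notin> fst ` Z"
  have fin: "finite Z" and al: "\<And>a b. (a, b) \<in> Z \<Longrightarrow> aligned Z a b"
    and sgn: "\<And>t t'. aligned Z t t' \<Longrightarrow> sg (poly p t) = sg (poly q t')"
    using sign_matchD[OF assms(1)] assms(2) by blast+
  obtain t' where t': "aligned Z s t'" using ex_aligned[OF fin al] by blast
  have "\<exists>u. (\<forall>l\<in>{s}. l < u) \<and> (\<forall>a\<in>{a \<in> fst ` Z. s < a}. u < a)"
    using fin by (intro ex_between_finite) simp_all
  then obtain u where u: "s < u" "\<And>a. a \<in> fst ` Z \<Longrightarrow> s < a \<Longrightarrow> u < a" by blast
  have "poly p x = 0" if x: "s < x" "x < u" for x
  proof -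
    have "sg (x - a) = sg (s - a)" if "(a, b) \<in> Z" for a b
    proof -
      have "a \<in> fst ` Z" using that by (metis fst_conv image_eqI)
      then consider "a < s" | "s < a" "u < a" using s u(2)[of a] by (cases a s rule: linorder_cases) blast+
      then show ?thesis
      proof cases
        case 1
        then have "x - a > 0" "s - a > 0" using x by simp_all
        then show ?thesis by (simp add: sg_def)
      next
        case 2
        then have "x - a < 0" "s - a < 0" using x by simp_all
        then show ?thesis by (simp add: sg_def)
      qed
    qed
    then have "aligned Z x t'" using t' by (simp add: aligned_def)
    then show ?thesis using sgn[OF t'] sgn[of x t'] assms(4) by (metis sg_simps(1,2))
  qed
  then have "{s<..<u} \<subseteq> {x. poly p x = 0}" by auto
  then have "finite {s<..<u}" using poly_roots_finite[OF assms(3)] finite_subset by blast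
  then show False using u(1) infinite_Ioo by blast
qed

lemma sign_match_zero:
  fixes q :: "'b::linordered_field poly"
  assumes "sign_match Q Z" "(0 :: 'a::linordered_field poly, q) \<in> Q"
  shows "q = 0"
proof -
  have "poly q t' = 0" for t'
  proof -
    obtain t where "aligned (Z\<inverse>) t' t"
      using ex_aligned[of "Z\<inverse>" t'] sign_matchD(1,2)[OF sign_match_converse[OF assms(1)]] by blast
    then have "sg (poly (0::'a poly) t) = sg (poly q t')"
      using sign_matchD(3)[OF assms(1) _ assms(2)] by (simp only: aligned_converse)
    then show ?thesis by (metis poly_0 sg_simps(1,2))
  qed
  then show ?thesis using poly_all_0_iff_0 by blast
qed

lemma sign_match_zero_iff:
  fixes p :: "'a::linordered_field poly" and q :: "'b::linordered_field poly"
  assumes "sign_match Q Z" "(p, q) \<in> Q"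
  shows "p = 0 \<longleftrightarrow> q = 0"
  using sign_match_zero[of Q Z q] sign_match_zero[of "Q\<inverse>" "Z\<inverse>" p] sign_match_converse[OF assms(1)] assms
  by auto

text \<open>
  Removing a point that is no root merges three cells into one. The elements \<open>t\<close> and \<open>t'\<close> may then
  lie on different sides of that point, but no root of \<open>p\<close> lies in between.
\<close>

lemma sign_across_removed_point:
  fixes p :: "'a::real_closed_field poly" and q :: "'b::real_closed_field poly"
  assumes m: "sign_match Q Z" "(p, q) \<in> Q" and ab: "(a, b) \<in> Z" "poly p a \<noteq> 0"
    and t: "aligned (Z - {(a, b)}) t t'" "sg (t - a) \<noteq> sg (t' - b)"
  shows "sg (poly p t) = sg (poly p a)"
proof -
  note al = sign_matchD(2)[OF m(1)]
  have p0: "p \<noteq> 0" using ab by auto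
  have noroot: "poly p c \<noteq> 0" if c: "min t a \<le> c" "c \<le> max t a" for c
  proof
    assume "poly p c = 0"
    then obtain d where d: "(c, d) \<in> Z" using sign_match_root[OF m p0] by fastforce
    have "c \<noteq> a" using ab(2) \<open>poly p c = 0\<close> by blast
    then have d': "(c, d) \<in> Z - {(a, b)}" using d by auto
    note l1 = aligned_less[OF t(1) d'] and l2 = aligned_less[OF al[OF ab(1)] d]
    show False
    proof (cases "t < a")
      case True
      then have "d < b" "t' \<le> d" using c l1 l2 \<open>c \<noteq> a\<close> by (auto simp: not_less[symmetric])
      then show False using t(2) True by (auto simp: sg_eq_iff)
    next
      case False
      then have "b < d" "d \<le> t'" "a < t" using c l1 l2 \<open>c \<noteq> a\<close> by (auto simp: not_less[symmetric] min_def max_def split: if_splits)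
      then show False using t(2) by (auto simp: sg_eq_iff)
    qed
  qed
  show ?thesis
  proof (cases "t \<le> a")
    case True
    then show ?thesis using noroot by (intro sg_eq_of_no_root) auto
  next
    case False
    then show ?thesis using noroot by (intro sg_eq_of_no_root[symmetric]) auto
  qed
qed

text \<open>
  When a further polynomial is added, its sign at a point of \<open>Z\<close> is known only through its remainder
  modulo a polynomial that vanishes there. So the points that are not roots have to be dropped first.
\<close>

lemma sign_match_restrict_to_roots:
  fixes Q :: "('a::real_closed_field poly \<times> 'b::real_closed_field poly) set"
  assumes "sign_match Q Z"
  shows "\<exists>Z0\<subseteq>Z. sign_match Q Z0 \<and> (\<forall>(a, b)\<in>Z0. \<exists>(u, v)\<in>Q. u \<noteq> 0 \<and> poly u a = 0)"
proof -
  have "finite Z" using assms by (simp add: sign_match_def)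
  then show ?thesis using assms
  proof (induction Z rule: finite_psubset_induct)
    case (psubset Z)
    show ?case
    proof (cases "\<forall>(a, b)\<in>Z. \<exists>(u, v)\<in>Q. u \<noteq> 0 \<and> poly u a = 0")
      case True
      then show ?thesis using psubset.prems by blast
    next
      case False
      then obtain a b where ab: "(a, b) \<in> Z" "\<And>u v. (u, v) \<in> Q \<Longrightarrow> u \<noteq> 0 \<Longrightarrow> poly u a \<noteq> 0"
        by fast
      define Z1 where "Z1 = Z - {(a, b)}"
      have al: "\<And>a b. (a, b) \<in> Z \<Longrightarrow> aligned Z a b"
        and sgn: "\<And>t t' p q. aligned Z t t' \<Longrightarrow> (p, q) \<in> Q \<Longrightarrow> sg (poly p t) = sg (poly q t')"
        using sign_matchD[OF psubset.prems] by blast+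
      have "sg (poly p t) = sg (poly q t')" if t: "aligned Z1 t t'" and pq: "(p, q) \<in> Q" for t t' p q
      proof (cases "p = 0 \<or> sg (t - a) = sg (t' - b)")
        case True
        then show ?thesis
        proof
          assume "p = 0"
          then show ?thesis using sign_match_zero_iff[OF psubset.prems pq] by simp
        next
          assume "sg (t - a) = sg (t' - b)"
          then have "aligned Z t t'" using t by (auto simp: aligned_def Z1_def)
          then show ?thesis using sgn pq by blast
        qed
      next
        case False
        have pa: "poly p a \<noteq> 0" using ab(2)[OF pq] False by auto
        have pab: "sg (poly p a) = sg (poly q b)" using sgn[OF al[OF ab(1)] pq] .
        have "sg (poly p t) = sg (poly p a)"
          using sign_across_removed_point[OF psubset.prems pq ab(1) pa] t False by (auto simp: Z1_def)
        moreover have "sg (poly q t') = sg (poly q b)"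
        proof (rule sign_across_removed_point[where Q = "Q\<inverse>" and Z = "Z\<inverse>" and q = p and b = a and t' = t])
          have "Z\<inverse> - {(b, a)} = (Z1)\<inverse>" by (auto simp: Z1_def)
          then show "aligned (Z\<inverse> - {(b, a)}) t' t" using t by (simp add: aligned_converse)
          show "poly q b \<noteq> 0" using pa pab by (metis sg_simps(2))
        qed (use sign_match_converse[OF psubset.prems] pq ab False in auto)
        ultimately show ?thesis using pab by simp
      qed
      then have "sign_match Q Z1"
        using psubset.prems unfolding sign_match_def Z1_def by (simp add: aligned_def)
      moreover have "Z1 \<subset> Z" using ab by (auto simp: Z1_def)
      ultimately show ?thesis using psubset.IH[of Z1] by blast
    qed
  qed
qed

text \<open>
  On its cell a polynomial without critical points is monotone. If the product of value and slope at
  \<open>t\<close> is positive, the absolute value decreases to the left. A left end of the cell with the opposite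
  sign then forces a root into the cell; if the cell is unbounded to the left, a root exists because
  nonconstant polynomials are unbounded.
\<close>

lemma cell_root_left:
  fixes p :: "'a::real_closed_field poly"
  assumes fin: "finite A" and deg: "degree p > 0"
    and der: "\<And>x. x \<notin> A \<Longrightarrow> poly (pderiv p) x \<noteq> 0" and t: "t \<notin> A"
    and sign: "poly p t * poly (pderiv p) t > 0"
    and ends: "\<And>a. a \<in> A \<Longrightarrow> a < t \<Longrightarrow> (\<And>x. a < x \<Longrightarrow> x \<le> t \<Longrightarrow> x \<notin> A) \<Longrightarrow> poly p a * poly p t < 0"
  shows "\<exists>s<t. poly p s = 0 \<and> (\<forall>a\<in>A. sg (s - a) = sg (t - a))"
proof -
  have cell: "\<forall>a\<in>A. sg (s - a) = sg (t - a)" if s: "s < t" "\<And>a. a \<in> A \<Longrightarrow> a < t \<Longrightarrow> a < s" for s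
  proof
    fix a assume "a \<in> A"
    then consider "a < s" | "t < a" using t s(2)[of a] by (metis linorder_cases)
    then show "sg (s - a) = sg (t - a)" using s(1) by cases (auto simp: sg_def)
  qed
  show ?thesis
  proof (cases "A \<inter> {..<t} = {}")
    case False
    define a where "a = Max (A \<inter> {..<t})"
    have "a \<in> A \<inter> {..<t}" unfolding a_def using fin False by (intro Max_in) auto
    then have a: "a \<in> A" "a < t" by auto
    have amax: "b \<le> a" if "b \<in> A" "b < t" for b unfolding a_def using fin that by (intro Max_ge) auto
    have "x \<notin> A" if "a < x" "x \<le> t" for x using amax[of x] that t by (cases "x = t") auto
    then have "poly p a * poly p t < 0" using ends a by blast
    from poly_ivt_mult[OF a(2) this] obtain s where s: "a < s" "s < t" "poly p s = 0" by blast
    have "b < s" if "b \<in> A" "b < t" for b using amax[OF that] s(1) by simp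
    then show ?thesis using cell[of s] s by blast
  next
    case True
    have noA: "x \<notin> A" if "x \<le> t" for x using True t that by (cases "x = t") auto
    have sgn: "sg (poly (pderiv p) x) = sg (poly (pderiv p) t)" if "x \<le> t" for x
      using that noA der by (intro sg_eq_of_no_root) auto
    have "\<exists>s<t. poly p s * poly p t < 0"
    proof (rule ccontr)
      assume no: "\<not> ?thesis"
      \<comment> \<open>p, reflected and normalized to be positive at - t; its values further to the right are smaller\<close>
      define r where "r = smult (poly p t) p \<circ>\<^sub>p [:0, - 1:]"
      have r: "poly r x = poly p t * poly p (- x)" for x by (simp add: r_def poly_pcompose)
      have pt: "poly p t \<noteq> 0" using sign by auto
      have "degree r > 0" using deg pt by (simp add: r_def degree_pcompose)
      define c where "c = poly p t * poly p t"
      have mono: "poly p t * poly p x < c" if "x < t" for x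
      proof -
        have "poly (smult (poly p t) p) x < poly (smult (poly p t) p) t"
        proof (rule poly_strict_mono_of_pderiv_pos[OF that])
          fix y assume "x < y" "y < t"
          then have "sg (poly p t * poly (pderiv p) y) = sg (poly p t * poly (pderiv p) t)"
            using sgn[of y] by (simp add: sg_mult)
          then show "poly (pderiv (smult (poly p t) p)) y > 0"
            using sign by (simp add: pderiv_smult sg_eq_iff)
        qed
        then show ?thesis by (simp add: c_def)
      qed
      have below: "poly r x < c" if "- x < t" for x using mono[OF that] by (simp add: r)
      have "\<not> (\<exists>n. \<forall>x\<ge>n. poly r x > c)"
      proof
        assume "\<exists>n. \<forall>x\<ge>n. poly r x > c"
        then obtain n where "\<And>x. x \<ge> n \<Longrightarrow> poly r x > c" by blast
        moreover have "- max n (1 - t) < t" by (simp add: max_def)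
        ultimately show False using below[of "max n (1 - t)"] by (meson less_asym max.cobounded1)
      qed
      then obtain n where n: "\<And>x. x \<ge> n \<Longrightarrow> poly r x < 0"
        using poly_nonconst_unbounded_at_top[OF \<open>degree r > 0\<close>] by blast
      have "poly p (- max n (1 - t)) * poly p t < 0" using n[of "max n (1 - t)"] by (simp add: r mult.commute)
      moreover have "- max n (1 - t) < t" by (simp add: max_def)
      ultimately show False using no by blast
    qed
    then obtain s0 where s0: "s0 < t" "poly p s0 * poly p t < 0" by blast
    from poly_ivt_mult[OF s0] obtain s where s: "s0 < s" "s < t" "poly p s = 0" by blast
    then show ?thesis using cell[of s] noA by (meson less_imp_le)
  qed
qed

text \<open>
The mirror image under \<open>x \<mapsto> - x\<close>.
\<close>

lemma cell_root_right:
  fixes p :: "'a::real_closed_field poly"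
  assumes fin: "finite A" and deg: "degree p > 0"
    and der: "\<And>x. x \<notin> A \<Longrightarrow> poly (pderiv p) x \<noteq> 0" and t: "t \<notin> A"
    and sign: "poly p t * poly (pderiv p) t < 0"
    and ends: "\<And>a. a \<in> A \<Longrightarrow> t < a \<Longrightarrow> (\<And>x. t \<le> x \<Longrightarrow> x < a \<Longrightarrow> x \<notin> A) \<Longrightarrow> poly p a * poly p t < 0"
  shows "\<exists>s>t. poly p s = 0 \<and> (\<forall>a\<in>A. sg (s - a) = sg (t - a))"
proof -
  define r where "r = p \<circ>\<^sub>p [:0, - 1:]"
  have r: "poly r x = poly p (- x)" "poly (pderiv r) x = - poly (pderiv p) (- x)" for x
    by (simp_all add: r_def poly_pcompose pderiv_pcompose pderiv_pCons)
  have mem: "x \<in> uminus ` A \<longleftrightarrow> - x \<in> A" for x by (metis image_iff minus_minus)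
  have "\<exists>s < (- t). poly r s = 0 \<and> (\<forall>a\<in>uminus ` A. sg (s - a) = sg (- t - a))"
  proof (rule cell_root_left)
    show "degree r > 0" using deg by (simp add: r_def degree_pcompose)
    fix a assume a: "a \<in> uminus ` A" "a < - t" "\<And>x. a < x \<Longrightarrow> x \<le> - t \<Longrightarrow> x \<notin> uminus ` A"
    have "poly p (- a) * poly p t < 0"
    proof (rule ends)
      fix x assume "t \<le> x" "x < - a"
      then have "- x \<notin> uminus ` A" using a(3)[of "- x"] by simp
      then show "x \<notin> A" by (simp add: mem)
    qed (use a in \<open>auto simp: mem\<close>)
    then show "poly r a * poly r (- t) < 0" by (simp add: r)
  next
    fix x assume "x \<notin> uminus ` A"
    then show "poly (pderiv r) x \<noteq> 0" using der[of "- x"] by (simp add: mem r)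
  qed (use fin t sign in \<open>simp_all add: r mem\<close>)
  then obtain s where s: "s < - t" "poly r s = 0" "\<And>a. a \<in> uminus ` A \<Longrightarrow> sg (s - a) = sg (- t - a)"
    by blast
  have "sg (- s - a) = sg (t - a)" if "a \<in> A" for a
    using s(3)[of "- a"] that sg_minus_commute[of "- s" a] sg_minus_commute[of t a]
    by (simp add: algebra_simps)
  moreover have "t < - s" using s(1) by simp
  ultimately show ?thesis using s(2) by (auto simp: r)
qed

lemma strict_mono_on_cell:
  fixes p :: "'a::real_closed_field poly"
  assumes "x < y" "u \<in> {x..y}" "poly (pderiv p) u > 0" "\<And>z. x < z \<Longrightarrow> z < y \<Longrightarrow> poly (pderiv p) z \<noteq> 0"
    "poly (pderiv p) x \<noteq> 0 \<or> u \<noteq> x" "poly (pderiv p) y \<noteq> 0 \<or> u \<noteq> y"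
  shows "poly p x < poly p y"
proof (rule poly_strict_mono_of_pderiv_pos[OF assms(1)])
  fix z assume z: "x < z" "z < y"
  have "poly (pderiv p) w \<noteq> 0" if "min z u \<le> w" "w \<le> max z u" for w
    using assms(2-6) z that by (cases "w = u") (auto simp: min_def max_def split: if_splits)
  then have "sg (poly (pderiv p) (min z u)) = sg (poly (pderiv p) (max z u))"
    by (intro sg_eq_of_no_root) auto
  then show "poly (pderiv p) z > 0"
    using assms(3) by (auto simp: min_def max_def sg_eq_iff split: if_splits)
qed

text \<open>
  Let both polynomials increase along the cell. If \<open>p(t) > 0 \<ge> q(t')\<close>, then the left end of the
  cell, where both have the same sign, must be negative for \<open>q\<close> and hence for \<open>p\<close>; so \<open>p\<close> has a root
  to the left of \<open>t\<close>. In the same way \<open>q\<close> has a root at or to the right of \<open>t'\<close>. The pair of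
  these two roots separates \<open>t\<close> from \<open>t'\<close>. The other case is symmetric.
\<close>

lemma cell_roots_of_sign_mismatch:
  fixes p :: "'a::real_closed_field poly" and q :: "'b::real_closed_field poly"
  assumes fin: "finite Z" and pair: "\<And>a b. (a, b) \<in> Z \<Longrightarrow> aligned Z a b"
    and tt: "aligned Z t t'" "t \<notin> fst ` Z"
    and deg: "degree p > 0" "degree q > 0"
    and dp: "\<And>x. x \<notin> fst ` Z \<Longrightarrow> poly (pderiv p) x \<noteq> 0"
    and dq: "\<And>x. x \<notin> snd ` Z \<Longrightarrow> poly (pderiv q) x \<noteq> 0"
    and pos: "poly (pderiv p) t > 0" "poly (pderiv q) t' > 0"
    and ends: "\<And>a b. (a, b) \<in> Z \<Longrightarrow> sg (poly p a) = sg (poly q b)"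
    and ne: "poly p t \<noteq> 0" "sg (poly p t) \<noteq> sg (poly q t')"
  shows "\<exists>s s'. poly p s = 0 \<and> poly q s' = 0 \<and> aligned Z s s' \<and> sg (t - s) \<noteq> sg (t' - s')"
proof -
  have t'Z: "t' \<notin> snd ` Z"
  proof
    assume "t' \<in> snd ` Z"
    then obtain a where a: "(a, t') \<in> Z" by auto
    then have "t = a" using aligned_less(3)[OF tt(1) a] by simp
    then show False using a tt(2) by (metis fst_conv image_eqI)
  qed
  have fin': "finite (fst ` Z)" "finite (snd ` Z)" using fin by auto
  have aligned_cell: "aligned Z s s'"
    if "\<forall>a\<in>fst ` Z. sg (s - a) = sg (t - a)" "\<forall>b\<in>snd ` Z. sg (s' - b) = sg (t' - b)" for s s'
    unfolding aligned_def
  proof (intro allI impI)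
    fix a b assume ab: "(a, b) \<in> Z"
    then have "a \<in> fst ` Z" "b \<in> snd ` Z" by (metis fst_conv image_eqI, metis snd_conv image_eqI)
    then show "sg (s - a) = sg (s' - b)" using that alignedD[OF tt(1) ab] by (metis (no_types))
  qed
  have memZ: "a \<in> fst ` Z \<Longrightarrow> \<exists>b. (a, b) \<in> Z" "b \<in> snd ` Z \<Longrightarrow> \<exists>a. (a, b) \<in> Z" for a b by auto
  have right_p: "poly p t < poly p a" if "(a, b) \<in> Z" "t < a" "\<And>x. t \<le> x \<Longrightarrow> x < a \<Longrightarrow> x \<notin> fst ` Z" for a b
    using that dp pos(1) by (intro strict_mono_on_cell[where u = t]) auto
  have right_q: "poly q t' < poly q b" if "(a, b) \<in> Z" "t' < b" "\<And>x. t' \<le> x \<Longrightarrow> x < b \<Longrightarrow> x \<notin> snd ` Z" for a b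
    using that dq pos(2) by (intro strict_mono_on_cell[where u = t']) auto
  have left_p: "poly p a < poly p t" if "(a, b) \<in> Z" "a < t" "\<And>x. a < x \<Longrightarrow> x \<le> t \<Longrightarrow> x \<notin> fst ` Z" for a b
    using that dp pos(1) by (intro strict_mono_on_cell[where u = t]) auto
  have left_q: "poly q b < poly q t'" if "(a, b) \<in> Z" "b < t'" "\<And>x. b < x \<Longrightarrow> x \<le> t' \<Longrightarrow> x \<notin> snd ` Z" for a b
    using that dq pos(2) by (intro strict_mono_on_cell[where u = t']) auto
  have gap_right: "(\<forall>x. t \<le> x \<longrightarrow> x < a \<longrightarrow> x \<notin> fst ` Z) \<longleftrightarrow> (\<forall>x. t' \<le> x \<longrightarrow> x < b \<longrightarrow> x \<notin> snd ` Z)"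
    if ab: "(a, b) \<in> Z" for a b
  proof -
    have "(t \<le> c \<and> c < a) \<longleftrightarrow> (t' \<le> d \<and> d < b)" if "(c, d) \<in> Z" for c d
      using aligned_less[OF tt(1) that] aligned_less[OF pair[OF ab] that] by (simp add: not_less[symmetric])
    then show ?thesis by (metis memZ fst_conv snd_conv image_eqI)
  qed
  have gap_left: "(\<forall>x. a < x \<longrightarrow> x \<le> t \<longrightarrow> x \<notin> fst ` Z) \<longleftrightarrow> (\<forall>x. b < x \<longrightarrow> x \<le> t' \<longrightarrow> x \<notin> snd ` Z)"
    if ab: "(a, b) \<in> Z" for a b
  proof -
    have "(a < c \<and> c \<le> t) \<longleftrightarrow> (b < d \<and> d \<le> t')" if "(c, d) \<in> Z" for c d
      using aligned_less[OF tt(1) that] aligned_less[OF pair[OF ab] that] by (simp add: not_less[symmetric])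
    then show ?thesis by (metis memZ fst_conv snd_conv image_eqI)
  qed
  show ?thesis
  proof (cases "poly p t > 0")
    case True
    then have q: "poly q t' \<le> 0" using ne by (auto simp: sg_eq_iff not_less[symmetric])
    have "\<exists>s<t. poly p s = 0 \<and> (\<forall>a\<in>fst ` Z. sg (s - a) = sg (t - a))"
    proof (rule cell_root_left[OF fin'(1) deg(1) dp tt(2)])
      show "0 < poly p t * poly (pderiv p) t" using True pos by simp
      fix a assume a: "a \<in> fst ` Z" "a < t" "\<And>x. a < x \<Longrightarrow> x \<le> t \<Longrightarrow> x \<notin> fst ` Z"
      then obtain b where ab: "(a, b) \<in> Z" by auto
      have "b < t'" using aligned_less(1)[OF tt(1) ab] a(2) by simp
      then have "poly q b < poly q t'" using left_q[OF ab] gap_left[OF ab] a(3) by blast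
      then have "poly p a < 0" using ends[OF ab] q by (simp add: sg_eq_iff)
      then show "poly p a * poly p t < 0" using True by (simp add: mult_neg_pos)
    qed
    then obtain s where s: "s < t" "poly p s = 0" "\<forall>a\<in>fst ` Z. sg (s - a) = sg (t - a)" by blast
    have "\<exists>s'\<ge>t'. poly q s' = 0 \<and> (\<forall>b\<in>snd ` Z. sg (s' - b) = sg (t' - b))"
    proof (cases "poly q t' = 0")
      case False
      then have q': "poly q t' < 0" using q by simp
      have "\<exists>s'>t'. poly q s' = 0 \<and> (\<forall>b\<in>snd ` Z. sg (s' - b) = sg (t' - b))"
      proof (rule cell_root_right[OF fin'(2) deg(2) dq t'Z])
        show "poly q t' * poly (pderiv q) t' < 0" using q' pos by (simp add: mult_neg_pos)
        fix b assume b: "b \<in> snd ` Z" "t' < b" "\<And>x. t' \<le> x \<Longrightarrow> x < b \<Longrightarrow> x \<notin> snd ` Z"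
        then obtain a where ab: "(a, b) \<in> Z" by auto
        have "t < a" using aligned_less(2)[OF tt(1) ab] b(2) by simp
        then have "poly p t < poly p a" using right_p[OF ab] gap_right[OF ab] b(3) by blast
        then have "poly q b > 0" using ends[OF ab] True by (simp add: sg_eq_iff)
        then show "poly q b * poly q t' < 0" using q' by (simp add: mult_pos_neg)
      qed
      then show ?thesis by (meson less_imp_le)
    qed auto
    then obtain s' where s': "t' \<le> s'" "poly q s' = 0" "\<forall>b\<in>snd ` Z. sg (s' - b) = sg (t' - b)" by blast
    have "sg (t - s) \<noteq> sg (t' - s')" using s(1) s'(1) by (auto simp: sg_eq_iff)
    then show ?thesis using aligned_cell[OF s(3) s'(3)] s(2) s'(2) by blast
  next
    case False
    then have p: "poly p t < 0" using ne by simp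
    then have q: "poly q t' \<ge> 0" using ne by (auto simp: sg_eq_iff not_less[symmetric])
    have "\<exists>s>t. poly p s = 0 \<and> (\<forall>a\<in>fst ` Z. sg (s - a) = sg (t - a))"
    proof (rule cell_root_right[OF fin'(1) deg(1) dp tt(2)])
      show "poly p t * poly (pderiv p) t < 0" using p pos by (simp add: mult_neg_pos)
      fix a assume a: "a \<in> fst ` Z" "t < a" "\<And>x. t \<le> x \<Longrightarrow> x < a \<Longrightarrow> x \<notin> fst ` Z"
      then obtain b where ab: "(a, b) \<in> Z" by auto
      have "t' < b" using aligned_less(2)[OF tt(1) ab] a(2) by simp
      then have "poly q t' < poly q b" using right_q[OF ab] gap_right[OF ab] a(3) by blast
      then have "poly p a > 0" using ends[OF ab] q by (simp add: sg_eq_iff)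
      then show "poly p a * poly p t < 0" using p by (simp add: mult_pos_neg)
    qed
    then obtain s where s: "t < s" "poly p s = 0" "\<forall>a\<in>fst ` Z. sg (s - a) = sg (t - a)" by blast
    have "\<exists>s'\<le>t'. poly q s' = 0 \<and> (\<forall>b\<in>snd ` Z. sg (s' - b) = sg (t' - b))"
    proof (cases "poly q t' = 0")
      case False
      then have q': "poly q t' > 0" using q by simp
      have "\<exists>s'<t'. poly q s' = 0 \<and> (\<forall>b\<in>snd ` Z. sg (s' - b) = sg (t' - b))"
      proof (rule cell_root_left[OF fin'(2) deg(2) dq t'Z])
        show "poly q t' * poly (pderiv q) t' > 0" using q' pos by simp
        fix b assume b: "b \<in> snd ` Z" "b < t'" "\<And>x. b < x \<Longrightarrow> x \<le> t' \<Longrightarrow> x \<notin> snd ` Z"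
        then obtain a where ab: "(a, b) \<in> Z" by auto
        have "a < t" using aligned_less(1)[OF tt(1) ab] b(2) by simp
        then have "poly p a < poly p t" using left_p[OF ab] gap_left[OF ab] b(3) by blast
        then have "poly q b < 0" using ends[OF ab] p by (simp add: sg_eq_iff)
        then show "poly q b * poly q t' < 0" using q' by (simp add: mult_neg_pos)
      qed
      then show ?thesis by (meson less_imp_le)
    qed auto
    then obtain s' where s': "s' \<le> t'" "poly q s' = 0" "\<forall>b\<in>snd ` Z. sg (s' - b) = sg (t' - b)" by blast
    have "sg (t - s) \<noteq> sg (t' - s')" using s(1) s'(1) by (auto simp: sg_eq_iff)
    then show ?thesis using aligned_cell[OF s(3) s'(3)] s(2) s'(2) by blast
  qed
qed

lemma at_most_one_root_in_cell:
  fixes p :: "'a::real_closed_field poly" and q :: "'b::real_closed_field poly"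
  assumes Z: "\<And>x. x \<notin> fst ` Z \<Longrightarrow> poly (pderiv p) x \<noteq> 0"
    and rs: "poly p r = 0" "poly p s = 0" "r < s"
    and al: "aligned Z r r'" "aligned Z s s'"
  shows "r' < s'"
proof -
  obtain c where c: "r < c" "c < s" "poly (pderiv p) c = 0" using poly_rolle[OF rs(3,1,2)] by blast
  then obtain d where "(c, d) \<in> Z" using Z by force
  then show ?thesis
    using aligned_less(2)[OF al(1)] aligned_less(1)[OF al(2)] c by (meson less_trans)
qed

text \<open>
  One more pair is added to a table that contains its derivatives and knows its signs at the points of
  \<open>Z\<close>. On each cell the polynomial is monotone, so it has at most one root there, and the new roots
  are paired cell by cell.
\<close>

lemma sign_match_extend:
  fixes p :: "'a::real_closed_field poly" and q :: "'b::real_closed_field poly"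
  assumes m: "sign_match Q Z" and der: "(pderiv p, pderiv q) \<in> Q"
    and deg: "degree p > 0" "degree q > 0"
    and ends: "\<And>a b. (a, b) \<in> Z \<Longrightarrow> sg (poly p a) = sg (poly q b)"
  shows "\<exists>Z'. sign_match (insert (p, q) Q) Z'"
proof -
  note fin = sign_matchD(1)[OF m] and pair = sign_matchD(2)[OF m] and sgn = sign_matchD(3)[OF m]
  have d0: "pderiv p \<noteq> 0" "pderiv q \<noteq> 0" using deg by (simp_all add: pderiv_eq_0_iff)
  have dp: "poly (pderiv p) x \<noteq> 0" if "x \<notin> fst ` Z" for x
    using sign_match_root[OF m der d0(1)] that by blast
  have m': "sign_match (Q\<inverse>) (Z\<inverse>)" using sign_match_converse[OF m] .
  have der': "(pderiv q, pderiv p) \<in> Q\<inverse>" using der by simp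
  have fstZ: "fst ` (Z\<inverse>) = snd ` Z" "snd ` (Z\<inverse>) = fst ` Z" by force+
  have dq: "poly (pderiv q) x \<noteq> 0" if "x \<notin> snd ` Z" for x
    using sign_match_root[OF m' der' d0(2)] that unfolding fstZ by blast
  define W where "W = {(s, s'). poly p s = 0 \<and> poly q s' = 0 \<and> aligned Z s s'}"
  have "W \<subseteq> {x. poly p x = 0} \<times> {x. poly q x = 0}" by (auto simp: W_def)
  moreover have "finite {x. poly p x = 0}" "finite {x. poly q x = 0}"
    using deg by (auto intro!: poly_roots_finite)
  ultimately have finW: "finite W" by (meson finite_SigmaI finite_subset)
  have W_less: "r < s \<longleftrightarrow> r' < s'" if "(r, r') \<in> W" "(s, s') \<in> W" for r r' s s'
  proof
    assume "r < s"
    then show "r' < s'" using that at_most_one_root_in_cell[of Z p r s r' s'] dp by (simp add: W_def)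
  next
    assume "r' < s'"
    then show "r < s" using that at_most_one_root_in_cell[of "Z\<inverse>" q r' s' r s] dq
      by (simp add: W_def aligned_converse fstZ)
  qed
  have "aligned (Z \<union> W) a b" if ab: "(a, b) \<in> Z \<union> W" for a b
    unfolding aligned_def
  proof (intro allI impI)
    fix c d assume cd: "(c, d) \<in> Z \<union> W"
    consider "(c, d) \<in> Z" | "(a, b) \<in> Z" "(c, d) \<in> W" | "(a, b) \<in> W" "(c, d) \<in> W"
      using ab cd by blast
    then show "sg (a - c) = sg (b - d)"
    proof cases
      case 1
      moreover have "aligned Z a b" using ab pair by (auto simp: W_def)
      ultimately show ?thesis by (rule alignedD[rotated])
    next
      case 2
      then have "sg (c - a) = sg (d - b)" using alignedD[of Z c d a b] by (simp add: W_def)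
      then show ?thesis using sg_minus_commute[of a c] sg_minus_commute[of b d] by simp
    next
      case 3
      then show ?thesis using W_less[of a b c d] W_less[of c d a b] by (simp add: sg_eq_iff)
    qed
  qed
  moreover have "sg (poly p t) = sg (poly q t')" if al: "aligned (Z \<union> W) t t'" for t t'
  proof (rule ccontr)
    assume ne: "sg (poly p t) \<noteq> sg (poly q t')"
    have tt: "aligned Z t t'" and ttW: "aligned W t t'" using al by (simp_all add: aligned_def)
    have tt': "aligned (Z\<inverse>) t' t" using tt by (simp add: aligned_converse)
    have tZ: "t \<notin> fst ` Z"
    proof
      assume "t \<in> fst ` Z"
      then obtain b where b: "(t, b) \<in> Z" by auto
      then have "t' = b" using aligned_less(3)[OF tt b] by simp
      then show False using ends[OF b] ne by simp
    qed
    have t'Z: "t' \<notin> snd ` Z"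
    proof
      assume "t' \<in> snd ` Z"
      then obtain a where a: "(a, t') \<in> Z" by auto
      then have "t = a" using aligned_less(3)[OF tt a] by simp
      then show False using a tZ by (metis fst_conv image_eqI)
    qed
    have sd: "sg (poly (pderiv p) t) = sg (poly (pderiv q) t')" using sgn[OF tt der] .
    \<comment> \<open>multiplying both polynomials by the common sign of the derivatives makes them increase\<close>
    have "\<exists>s s'. poly p s = 0 \<and> poly q s' = 0 \<and> aligned Z s s' \<and> sg (t - s) \<noteq> sg (t' - s')"
      if "poly (pderiv p) t > 0 \<or> poly (pderiv p) t < 0"
    proof -
      define e :: int where "e = (if poly (pderiv p) t > 0 then 1 else - 1)"
      define P where "P = of_int e * p"
      define R where "R = of_int e * q"
      have e: "e = 1 \<or> e = - 1" by (simp add: e_def)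
      have dP: "degree P > 0" "degree R > 0" using e deg by (auto simp: P_def R_def)
      have Pp: "poly P x = 0 \<longleftrightarrow> poly p x = 0" "poly R y = 0 \<longleftrightarrow> poly q y = 0"
        "poly (pderiv P) x = 0 \<longleftrightarrow> poly (pderiv p) x = 0" "poly (pderiv R) y = 0 \<longleftrightarrow> poly (pderiv q) y = 0"
        "sg (poly P x) = e * sg (poly p x)" "sg (poly R y) = e * sg (poly q y)" for x y
        using e by (auto simp: P_def R_def pderiv_minus)
      have pos: "poly (pderiv P) t > 0" "poly (pderiv R) t' > 0"
        using sd that by (auto simp: P_def R_def e_def pderiv_minus sg_eq_iff)
      have ne': "sg (poly P t) \<noteq> sg (poly R t')" using ne e by (auto simp: Pp)
      show ?thesis
      proof (cases "poly p t = 0")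
        case False
        have "\<exists>s s'. poly P s = 0 \<and> poly R s' = 0 \<and> aligned Z s s' \<and> sg (t - s) \<noteq> sg (t' - s')"
          by (rule cell_roots_of_sign_mismatch[OF fin pair tt tZ dP])
            (use dp dq pos ne' False ends in \<open>simp_all add: Pp\<close>)
        then show ?thesis by (simp add: Pp)
      next
        case True
        have "\<exists>s' s. poly R s' = 0 \<and> poly P s = 0 \<and> aligned (Z\<inverse>) s' s \<and> sg (t' - s') \<noteq> sg (t - s)"
        proof (rule cell_roots_of_sign_mismatch[OF _ _ tt' _ dP(2,1)])
          show "finite (Z\<inverse>)" using fin by simp
          show "poly R t' \<noteq> 0" using True ne by (auto simp: Pp)
        qed (use pair dp dq pos ne' ends t'Z in \<open>simp_all add: Pp fstZ aligned_converse\<close>)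
        then show ?thesis unfolding Pp aligned_converse by metis
      qed
    qed
    moreover have "poly (pderiv p) t \<noteq> 0" using dp tZ by blast
    ultimately obtain s s' where s: "(s, s') \<in> W" "sg (t - s) \<noteq> sg (t' - s')"
      by (auto simp: W_def neq_iff)
    then show False using alignedD[OF ttW s(1)] by blast
  qed
  ultimately have "sign_match (insert (p, q) Q) (Z \<union> W)"
    using fin finW sgn by (simp add: sign_match_def aligned_def)
  then show ?thesis by blast
qed

section \<open>Preorderings and prime cones\<close>

definition ring_set :: "'a::comm_ring_1 set \<Rightarrow> bool" where
  "ring_set B \<longleftrightarrow> 1 \<in> B \<and> (\<forall>x\<in>B. \<forall>y\<in>B. x - y \<in> B \<and> x * y \<in> B)"

lemma ring_setD:
  assumes "ring_set B"
  shows "1 \<in> B" "0 \<in> B" "x \<in> B \<Longrightarrow> y \<in> B \<Longrightarrow> x - y \<in> B" "x \<in> B \<Longrightarrow> y \<in> B \<Longrightarrow> x * y \<in> B"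
    "x \<in> B \<Longrightarrow> - x \<in> B" "x \<in> B \<Longrightarrow> y \<in> B \<Longrightarrow> x + y \<in> B"
proof -
  show *: "1 \<in> B" "x \<in> B \<Longrightarrow> y \<in> B \<Longrightarrow> x - y \<in> B" "x \<in> B \<Longrightarrow> y \<in> B \<Longrightarrow> x * y \<in> B" for x y
    using assms by (auto simp: ring_set_def)
  show 0: "0 \<in> B" using *(2)[OF *(1,1)] by simp
  show neg: "x \<in> B \<Longrightarrow> - x \<in> B" for x using *(2)[OF 0, of x] by simp
  show "x \<in> B \<Longrightarrow> y \<in> B \<Longrightarrow> x + y \<in> B" using *(2)[of x "- y"] neg by simp
qed

definition proper_preordering :: "'a::comm_ring_1 set \<Rightarrow> 'a set \<Rightarrow> bool" where
  "proper_preordering B T \<longleftrightarrow> T \<subseteq> B \<and> (\<forall>x\<in>B. x * x \<in> T) \<and>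
     (\<forall>x\<in>T. \<forall>y\<in>T. x + y \<in> T \<and> x * y \<in> T) \<and> - 1 \<notin> T"

lemma proper_preorderingD:
  assumes "proper_preordering B T"
  shows "x \<in> T \<Longrightarrow> x \<in> B" "x \<in> B \<Longrightarrow> x * x \<in> T" "x \<in> T \<Longrightarrow> y \<in> T \<Longrightarrow> x + y \<in> T"
    "x \<in> T \<Longrightarrow> y \<in> T \<Longrightarrow> x * y \<in> T" "- 1 \<notin> T"
  using assms by (auto simp: proper_preordering_def)

text \<open>
  The positive cone of an ordering of the residue domain of \<open>B\<close> modulo the prime ideal
  \<open>P \<inter> - P\<close>.
\<close>

definition prime_cone :: "'a::comm_ring_1 set \<Rightarrow> 'a set \<Rightarrow> bool" where
  "prime_cone B P \<longleftrightarrow> proper_preordering B P \<and> (\<forall>x\<in>B. x \<in> P \<or> - x \<in> P) \<and>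
     (\<forall>x\<in>B. \<forall>y\<in>B. x * y \<in> P \<longrightarrow> - (x * y) \<in> P \<longrightarrow> (x \<in> P \<and> - x \<in> P) \<or> (y \<in> P \<and> - y \<in> P))"

lemma one_plus_eq_minus:
  fixes z :: "'a::comm_ring_1"
  assumes "- 1 = t + z"
  shows "1 + t = - z"
proof -
  have "1 + t + z = 1 + (t + z)" by (simp add: add.assoc)
  also have "\<dots> = 0" by (simp add: assms[symmetric])
  finally show ?thesis by (simp add: eq_neg_iff_add_eq_0)
qed

text \<open>
  If \<open>x \<notin> P\<close>, then by maximality \<open>P + x P\<close> contains \<open>- 1\<close>. Two such identities, for \<open>x\<close> and \<open>- x\<close>
  or for two elements whose product lies in the support, multiply to one that puts \<open>- 1\<close> into \<open>P\<close>.
\<close>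

lemma maximal_preordering_is_prime_cone:
  assumes B: "ring_set B" and P: "proper_preordering B P"
    and max: "\<And>P'. proper_preordering B P' \<Longrightarrow> P \<subseteq> P' \<Longrightarrow> P' = P"
  shows "prime_cone B P"
proof -
  note Bs = ring_setD[OF B] and Ps = proper_preorderingD[OF P]
  have P01: "0 \<in> P" "1 \<in> P" using Ps(2)[OF Bs(2)] Ps(2)[OF Bs(1)] by simp_all
  have adjoin: "\<exists>t\<in>P. \<exists>s\<in>P. - 1 = t + x * s" if x: "x \<in> B" "x \<notin> P" for x
  proof (rule ccontr)
    assume no: "\<not> ?thesis"
    \<comment> \<open>the preordering generated by P and x\<close>
    define P' where "P' = {t + x * s | t s. t \<in> P \<and> s \<in> P}"
    have sub: "P \<subseteq> P'"
    proof
      fix t assume "t \<in> P"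
      then show "t \<in> P'" unfolding P'_def using P01 by (intro CollectI exI[of _ t] exI[of _ 0]) simp
    qed
    have "x \<in> P'" unfolding P'_def using P01 by (intro CollectI exI[of _ 0] exI[of _ 1]) simp
    moreover have "proper_preordering B P'"
      unfolding proper_preordering_def
    proof (intro conjI ballI)
      show "P' \<subseteq> B" using x Bs Ps(1) by (auto simp: P'_def)
      show "y * y \<in> P'" if "y \<in> B" for y using sub Ps(2)[OF that] by blast
      show "- 1 \<notin> P'" using no by (auto simp: P'_def)
      fix y z assume "y \<in> P'" "z \<in> P'"
      then obtain t s t' s' where ts: "y = t + x * s" "z = t' + x * s'" "t \<in> P" "s \<in> P" "t' \<in> P" "s' \<in> P"
        by (auto simp: P'_def)
      have "y + z = (t + t') + x * (s + s')" by (simp add: ts algebra_simps)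
      moreover have "t + t' \<in> P" "s + s' \<in> P" using ts Ps(3) by simp_all
      ultimately show "y + z \<in> P'" unfolding P'_def by blast
      have "y * z = (t * t' + (x * x) * (s * s')) + x * (t * s' + s * t')" by (simp add: ts algebra_simps)
      moreover have "t * t' + (x * x) * (s * s') \<in> P" "t * s' + s * t' \<in> P"
        using ts Ps(3,4) Ps(2)[OF x(1)] by simp_all
      ultimately show "y * z \<in> P'" unfolding P'_def by blast
    qed
    ultimately show False using max sub x(2) by blast
  qed
  have total: "x \<in> P \<or> - x \<in> P" if x: "x \<in> B" for x
  proof (rule ccontr)
    assume "\<not> ?thesis"
    then obtain t s t' s' where ts: "- 1 = t + x * s" "- 1 = t' + (- x) * s'" "t \<in> P" "s \<in> P" "t' \<in> P" "s' \<in> P"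
      using adjoin x Bs(5) by metis
    have "(1 + t) * (1 + t') = (- (x * s)) * (x * s')"
      using one_plus_eq_minus[OF ts(1)] one_plus_eq_minus[OF ts(2)] by simp
    then have "(1 + t) * (1 + t') + (x * x) * (s * s') = 0" by (simp add: algebra_simps)
    moreover have "(1 + t) * (1 + t') + (x * x) * (s * s') = t + t' + t * t' + (x * x) * (s * s') + 1"
      by (simp add: distrib_left distrib_right)
    ultimately have "t + t' + t * t' + (x * x) * (s * s') = - 1" by (metis add_eq_0_iff2)
    moreover have "t + t' + t * t' + (x * x) * (s * s') \<in> P" using ts Ps(2)[OF x] Ps(3,4) by simp
    ultimately show False using Ps(5) by simp
  qed
  have ideal: "z * b \<in> P" if z: "z \<in> P" "- z \<in> P" "b \<in> B" for z b
    using total[OF z(3)] Ps(4)[OF z(1), of b] Ps(4)[OF z(2), of "- b"] by auto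
  have "(x \<in> P \<and> - x \<in> P) \<or> (y \<in> P \<and> - y \<in> P)"
    if xy: "x \<in> B" "y \<in> B" "x * y \<in> P" "- (x * y) \<in> P" for x y
  proof (rule ccontr)
    assume "\<not> ?thesis"
    then obtain x' y' where x': "x' = x \<or> x' = - x" "x' \<notin> P" and y': "y' = y \<or> y' = - y" "y' \<notin> P" by blast
    have "x' \<in> B" "y' \<in> B" using x' y' xy Bs(5) by auto
    then obtain t s t' s' where ts: "- 1 = t + x' * s" "- 1 = t' + y' * s'" "t \<in> P" "s \<in> P" "t' \<in> P" "s' \<in> P"
      using adjoin x' y' by metis
    have xs: "x' * s = - (1 + t)" "y' * s' = - (1 + t')"
      unfolding one_plus_eq_minus[OF ts(1)] one_plus_eq_minus[OF ts(2)] by simp_all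
    have "(x' * y') * (s * s') = (x' * s) * (y' * s')" by (simp add: algebra_simps)
    also have "\<dots> = (1 + t) * (1 + t')" by (simp only: xs minus_mult_minus)
    also have "\<dots> = 1 + (t + t' + t * t')" by (simp add: distrib_left distrib_right)
    finally have eq: "- 1 = t + t' + t * t' + (- (x' * y')) * (s * s')" by simp
    have n: "- (x' * y') \<in> P" "- (- (x' * y')) \<in> P" using x' y' xy(3,4) by auto
    have "s * s' \<in> P" using ts(4,6) by (rule Ps(4))
    then have "(- (x' * y')) * (s * s') \<in> P" using ideal[OF n] Ps(1) by blast
    moreover have "t + t' + t * t' \<in> P" using ts(3,5) by (intro Ps(3,4))
    ultimately have "- 1 \<in> P" by (subst eq) (rule Ps(3))
    then show False using Ps(5) by simp
  qed
  then show ?thesis using P total by (auto simp: prime_cone_def)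
qed

lemma subset_chain_Union2:
  assumes "subset.chain A C" "x \<in> \<Union>C" "y \<in> \<Union>C"
  shows "\<exists>U\<in>C. x \<in> U \<and> y \<in> U"
proof -
  obtain U V where UV: "U \<in> C" "x \<in> U" "V \<in> C" "y \<in> V" using assms(2,3) by blast
  then have "U \<subseteq> V \<or> V \<subseteq> U" using assms(1) by (auto simp: subset_chain_def)
  then show ?thesis using UV by blast
qed

lemma ex_prime_cone_above:
  assumes B: "ring_set B" and T: "proper_preordering B T"
  shows "\<exists>P. T \<subseteq> P \<and> prime_cone B P"
proof -
  define A where "A = {P. proper_preordering B P \<and> T \<subseteq> P}"
  have "\<exists>M\<in>A. \<forall>U\<in>A. M \<subseteq> U \<longrightarrow> U = M"
  proof (rule subset_Zorn_nonempty)
    show "A \<noteq> {}" using T by (auto simp: A_def)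
    fix C assume C: "C \<noteq> {}" "subset.chain A C"
    then have CA: "\<And>U. U \<in> C \<Longrightarrow> proper_preordering B U \<and> T \<subseteq> U"
      by (auto simp: subset.chain_def A_def)
    obtain U0 where U0: "U0 \<in> C" using C by blast
    have "proper_preordering B (\<Union>C)"
      unfolding proper_preordering_def
    proof (intro conjI ballI)
      show "\<Union>C \<subseteq> B" using CA proper_preorderingD(1) by blast
      show "x * x \<in> \<Union>C" if "x \<in> B" for x using CA[OF U0] proper_preorderingD(2) that U0 by blast
      show "- 1 \<notin> \<Union>C" using CA proper_preorderingD(5) by blast
      fix x y assume "x \<in> \<Union>C" "y \<in> \<Union>C"
      then obtain U where U: "U \<in> C" "x \<in> U" "y \<in> U" using subset_chain_Union2[OF C(2)] by blast
      then show "x + y \<in> \<Union>C" "x * y \<in> \<Union>C" using CA[OF U(1)] proper_preorderingD(3,4) by blast+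
    qed
    then show "\<Union>C \<in> A" using CA[OF U0] U0 by (auto simp: A_def)
  qed
  then obtain M where M: "proper_preordering B M" "T \<subseteq> M" "\<And>U. U \<in> A \<Longrightarrow> M \<subseteq> U \<Longrightarrow> U = M"
    by (auto simp: A_def)
  have "prime_cone B M"
  proof (rule maximal_preordering_is_prime_cone[OF B M(1)])
    fix P' assume "proper_preordering B P'" "M \<subseteq> P'"
    then show "P' = M" using M by (intro M(3)) (auto simp: A_def)
  qed
  then show ?thesis using M(2) by blast
qed

section \<open>The real closure of an ordered field\<close>

definition field_set :: "'a::field set \<Rightarrow> bool" where
  "field_set F \<longleftrightarrow> ring_set F \<and> (\<forall>x\<in>F. inverse x \<in> F)"

definition poly_over :: "'a::comm_ring_1 set \<Rightarrow> 'a poly \<Rightarrow> bool" where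
  "poly_over F p \<longleftrightarrow> (\<forall>i. coeff p i \<in> F)"

lemma ring_set_sum: "ring_set B \<Longrightarrow> (\<And>i. i \<in> A \<Longrightarrow> f i \<in> B) \<Longrightarrow> sum f A \<in> B"
  by (induction A rule: infinite_finite_induct) (simp_all add: ring_setD)

lemma ring_set_power: "ring_set B \<Longrightarrow> x \<in> B \<Longrightarrow> x ^ n \<in> B"
  by (induction n) (simp_all add: ring_setD)

lemma poly_in_ring_set: "ring_set B \<Longrightarrow> poly_over B p \<Longrightarrow> x \<in> B \<Longrightarrow> poly p x \<in> B"
  unfolding poly_altdef poly_over_def by (intro ring_set_sum ring_setD ring_set_power) auto

lemma poly_over_closed:
  assumes "ring_set F"
  shows "poly_over F p \<Longrightarrow> poly_over F q \<Longrightarrow> poly_over F (p + q)"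
    "poly_over F p \<Longrightarrow> poly_over F q \<Longrightarrow> poly_over F (p - q)"
    "poly_over F p \<Longrightarrow> poly_over F q \<Longrightarrow> poly_over F (p * q)"
    "c \<in> F \<Longrightarrow> poly_over F p \<Longrightarrow> poly_over F (smult c p)"
    "c \<in> F \<Longrightarrow> poly_over F (monom c n)" "poly_over F 0" "poly_over F 1"
    "c \<in> F \<Longrightarrow> poly_over F p \<Longrightarrow> poly_over F (pCons c p)"
  using ring_setD[OF assms]
  by (auto simp: poly_over_def coeff_mult coeff_pCons intro!: ring_set_sum[OF assms] split: nat.split)

text \<open>
  Division with remainder does not leave the subfield; it is needed for polynomials over the ordered
  subfield whose roots lie in the algebraic closure.
\<close>

lemma poly_over_division:
  assumes F: "field_set F" and g: "poly_over F g" "g \<noteq> 0"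
  shows "poly_over F p \<Longrightarrow> \<exists>s r. poly_over F s \<and> poly_over F r \<and> p = g * s + r \<and> (r = 0 \<or> degree r < degree g)"
proof (induction "degree p" arbitrary: p rule: less_induct)
  case less
  have R: "ring_set F" using F by (simp add: field_set_def)
  note cl = poly_over_closed[OF R]
  show ?case
  proof (cases "p = 0 \<or> degree p < degree g")
    case True
    then show ?thesis using less.prems cl(6) by (intro exI[of _ 0] exI[of _ p]) auto
  next
    case False
    define c where "c = lead_coeff p * inverse (lead_coeff g)"
    define k where "k = monom c (degree p - degree g)"
    have "c \<in> F" using less.prems g F ring_setD(4)[OF R] by (simp add: c_def field_set_def poly_over_def)
    then have k: "poly_over F k" unfolding k_def by (rule cl(5))
    define p' where "p' = p - g * k"
    have p': "poly_over F p'" unfolding p'_def using less.prems g k cl by blast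
    have "c \<noteq> 0" using False g by (simp add: c_def)
    then have "k \<noteq> 0" "degree k = degree p - degree g" by (simp_all add: k_def degree_monom_eq)
    then have deg: "degree (g * k) = degree p" using False g by (simp add: degree_mult_eq)
    have "lead_coeff (g * k) = lead_coeff p"
      using g \<open>c \<noteq> 0\<close> by (simp add: lead_coeff_mult k_def degree_monom_eq c_def)
    then have "coeff p' (degree p) = 0" by (simp add: p'_def deg)
    moreover have "degree p' \<le> degree p" unfolding p'_def using deg by (intro degree_diff_le) auto
    ultimately have small: "p' = 0 \<or> degree p' < degree p"
      by (metis eq_zero_or_degree_less)
    have "\<exists>s r. poly_over F s \<and> poly_over F r \<and> p' = g * s + r \<and> (r = 0 \<or> degree r < degree g)"
    proof (cases "p' = 0")
      case True
      then show ?thesis using cl(6) by (intro exI[of _ 0]) auto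
    next
      case False
      then show ?thesis using less.hyps p' small by blast
    qed
    then obtain s r where sr: "poly_over F s" "poly_over F r" "p' = g * s + r" "r = 0 \<or> degree r < degree g" by blast
    have "p = g * (s + k) + r" using sr(3) by (simp add: p'_def algebra_simps)
    then show ?thesis using sr k cl(1) by blast
  qed
qed

text \<open>
  An ordered subfield is encoded by its positive cone alone. Inclusion of cones then means inclusion
  of subfields with compatible orders, which makes Zorn's lemma directly applicable.
\<close>

definition ordered_cone :: "'a::field set \<Rightarrow> bool" where
  "ordered_cone P \<longleftrightarrow> 1 \<in> P \<and> (\<forall>x\<in>P. inverse x \<in> P \<and> (- x \<in> P \<longrightarrow> x = 0)) \<and>
     (\<forall>x\<in>P. \<forall>y\<in>P. x + y \<in> P \<and> x * y \<in> P \<and> (x - y \<in> P \<or> y - x \<in> P))"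

definition cone_field :: "'a::field set \<Rightarrow> 'a set" where
  "cone_field P = {x. x \<in> P \<or> - x \<in> P}"

lemma ordered_coneD:
  assumes "ordered_cone P"
  shows "1 \<in> P" "x \<in> P \<Longrightarrow> inverse x \<in> P" "x \<in> P \<Longrightarrow> - x \<in> P \<Longrightarrow> x = 0"
    "x \<in> P \<Longrightarrow> y \<in> P \<Longrightarrow> x + y \<in> P" "x \<in> P \<Longrightarrow> y \<in> P \<Longrightarrow> x * y \<in> P"
    "x \<in> P \<Longrightarrow> y \<in> P \<Longrightarrow> x - y \<in> P \<or> y - x \<in> P" "0 \<in> P" "- 1 \<notin> P"
proof -
  show *: "1 \<in> P" "x \<in> P \<Longrightarrow> - x \<in> P \<Longrightarrow> x = 0" "x \<in> P \<Longrightarrow> y \<in> P \<Longrightarrow> x - y \<in> P \<or> y - x \<in> P" for x y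
    using assms unfolding ordered_cone_def by blast+
  show "x \<in> P \<Longrightarrow> inverse x \<in> P" "x \<in> P \<Longrightarrow> y \<in> P \<Longrightarrow> x + y \<in> P" "x \<in> P \<Longrightarrow> y \<in> P \<Longrightarrow> x * y \<in> P"
    using assms unfolding ordered_cone_def by blast+
  show "0 \<in> P" using *(3)[OF *(1,1)] by simp
  show "- 1 \<notin> P" using *(1) *(2)[of 1] by auto
qed

lemma cone_field_is_field:
  assumes "ordered_cone P"
  shows "field_set (cone_field P)"
proof -
  note cl = ordered_coneD[OF assms]
  have diff: "x - y \<in> cone_field P" if "x \<in> cone_field P" "y \<in> cone_field P" for x y
    using that cl(4)[of x "- y"] cl(4)[of "- x" y] cl(6)[of x y] cl(6)[of "- x" "- y"]
    by (auto simp: cone_field_def algebra_simps)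
  have mult: "x * y \<in> cone_field P" if "x \<in> cone_field P" "y \<in> cone_field P" for x y
    using that cl(5)[of x y] cl(5)[of "- x" y] cl(5)[of x "- y"] cl(5)[of "- x" "- y"]
    by (auto simp: cone_field_def)
  have "inverse x \<in> cone_field P" if "x \<in> cone_field P" for x
    using that cl(2)[of x] cl(2)[of "- x"] by (auto simp: cone_field_def)
  then show ?thesis using diff mult cl(1) by (auto simp: field_set_def ring_set_def cone_field_def)
qed

lemma square_in_cone: "ordered_cone P \<Longrightarrow> x \<in> cone_field P \<Longrightarrow> x * x \<in> P"
  using ordered_coneD(5)[of P x x] ordered_coneD(5)[of P "- x" "- x"] by (auto simp: cone_field_def)

definition cone_neg :: "'a::field set \<Rightarrow> 'a \<Rightarrow> bool" where
  "cone_neg P x \<longleftrightarrow> - x \<in> P \<and> x \<noteq> 0"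

lemma cone_neg_iff:
  assumes "ordered_cone P" "x \<in> cone_field P"
  shows "cone_neg P x \<longleftrightarrow> x \<notin> P"
  using assms ordered_coneD(3,7)[OF assms(1)] by (auto simp: cone_neg_def cone_field_def)

lemma cone_neg_mult:
  assumes "ordered_cone P" "x \<in> cone_field P" "y \<in> cone_field P" "cone_neg P (x * y)"
  shows "cone_neg P x \<or> cone_neg P y"
proof -
  have "x * y \<in> cone_field P" using assms(4) by (auto simp: cone_neg_def cone_field_def)
  then have "x * y \<notin> P" using cone_neg_iff assms by blast
  then show ?thesis using cone_neg_iff[OF assms(1)] ordered_coneD(5)[OF assms(1)] assms(2,3) by blast
qed

text \<open>
  Their values at \<open>\<alpha>\<close> form the least preordering of \<open>F[\<alpha>]\<close> that contains the nonnegative elements of \<open>F\<close>.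
\<close>

inductive_set weighted_square_sums :: "'a::field set \<Rightarrow> 'a poly set" for P where
  square: "c \<in> P \<Longrightarrow> poly_over (cone_field P) h \<Longrightarrow> smult c (h * h) \<in> weighted_square_sums P"
| add: "u \<in> weighted_square_sums P \<Longrightarrow> v \<in> weighted_square_sums P \<Longrightarrow> u + v \<in> weighted_square_sums P"

lemma weighted_square_sums_mult:
  assumes P: "ordered_cone P"
  assumes "u \<in> weighted_square_sums P" "v \<in> weighted_square_sums P"
  shows "u * v \<in> weighted_square_sums P"
  using assms(2)
proof induction
  case (square c h)
  note uc = square
  from assms(3) show ?case
  proof induction
    case (square d k)
    have "smult c (h * h) * smult d (k * k) = smult (c * d) ((h * k) * (h * k))"
      by (simp add: ac_simps)
    moreover have "poly_over (cone_field P) (h * k)"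
      using uc square cone_field_is_field[OF P] poly_over_closed(3) by (auto simp: field_set_def)
    ultimately show ?case
      using weighted_square_sums.square[of "c * d" P "h * k"] uc square ordered_coneD(5)[OF P] by simp
  next
    case (add u v)
    then show ?case by (simp only: distrib_left weighted_square_sums.add)
  qed
next
  case (add u v)
  then show ?case by (simp only: distrib_right weighted_square_sums.add)
qed

lemma weighted_square_sums_over:
  assumes P: "ordered_cone P" and u: "u \<in> weighted_square_sums P"
  shows "poly_over (cone_field P) u" "x \<in> cone_field P \<Longrightarrow> poly u x \<in> P"
proof -
  have R: "ring_set (cone_field P)" using cone_field_is_field[OF P] by (simp add: field_set_def)
  show "poly_over (cone_field P) u" using u
  proof induction
    case (square c h)
    then have "c \<in> cone_field P" by (simp add: cone_field_def)
    then show ?case using poly_over_closed[OF R] square by simp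
  qed (use poly_over_closed[OF R] in simp)
  show "poly u x \<in> P" if "x \<in> cone_field P" using u
  proof induction
    case (square c h)
    then show ?case
      using ordered_coneD(5)[OF P] square_in_cone[OF P] poly_in_ring_set[OF R _ that] by simp
  qed (use ordered_coneD(4)[OF P] in simp)
qed

text \<open>
  Reducing each \<open>h\<close> modulo \<open>g\<close> keeps the value at the root \<open>\<alpha>\<close> and bounds the degree, while the form
  as a weighted sum of squares survives.
\<close>

lemma weighted_square_sums_reduce:
  assumes P: "ordered_cone P" and g: "poly_over (cone_field P) g" "degree g > 0" "poly g \<alpha> = 0"
    and u: "u \<in> weighted_square_sums P"
  shows "\<exists>v\<in>weighted_square_sums P. poly v \<alpha> = poly u \<alpha> \<and> degree v \<le> 2 * (degree g - 1)"
  using u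
proof induction
  case (square c h)
  have "g \<noteq> 0" using g(2) by auto
  from poly_over_division[OF cone_field_is_field[OF P] g(1) this square(2)]
  obtain s r where sr: "poly_over (cone_field P) r" "h = g * s + r" "r = 0 \<or> degree r < degree g" by blast
  have "poly h \<alpha> = poly r \<alpha>" by (simp add: sr g)
  moreover have "degree (smult c (r * r)) \<le> 2 * (degree g - 1)"
  proof -
    have "degree r \<le> degree g - 1" using sr(3) g(2) by auto
    then show ?thesis
      using degree_smult_le[of c "r * r"] degree_mult_le[of r r] by linarith
  qed
  ultimately show ?case
    using weighted_square_sums.square[OF square(1) sr(1)] by (intro bexI[of _ "smult c (r * r)"]) simp_all
next
  case (add u v)
  then obtain u' v' where uv: "u' \<in> weighted_square_sums P" "v' \<in> weighted_square_sums P"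
    "poly u' \<alpha> = poly u \<alpha>" "poly v' \<alpha> = poly v \<alpha>"
    "degree u' \<le> 2 * (degree g - 1)" "degree v' \<le> 2 * (degree g - 1)" by blast
  then show ?case
    using weighted_square_sums.add[OF uv(1,2)] degree_add_le[OF uv(5,6)] by (intro bexI[of _ "u' + v'"]) auto
qed

text \<open>
  Take a polynomial of least degree over the base field that vanishes at \<open>x\<close>; its constant term is
  not zero. This gives inverses in every subring that contains the base field.
\<close>

lemma alg_closure_divides_constant:
  fixes x :: "'k::field alg_closure"
  assumes "x \<noteq> 0"
  shows "\<exists>c q. c \<noteq> 0 \<and> x * poly (map_poly to_ac q) x = to_ac c"
proof -
  define R where "R p \<longleftrightarrow> p \<noteq> 0 \<and> poly (map_poly to_ac p) x = 0" for p
  obtain p0 where "R p0" using alg_closure_algebraic[of x] by (auto simp: R_def)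
  then obtain p where p: "R p" "\<And>q. R q \<Longrightarrow> degree p \<le> degree q"
    using ex_has_least_nat[of R p0 degree] by blast
  obtain c q where pq: "p = pCons c q" by (cases p)
  have eq: "to_ac c + x * poly (map_poly to_ac q) x = 0"
    using p(1) by (simp add: R_def pq map_poly_pCons)
  have "c \<noteq> 0"
  proof
    assume c: "c = 0"
    then have "q \<noteq> 0" "R q" using p(1) eq assms by (auto simp: R_def pq)
    then show False using p(2)[of q] by (simp add: pq)
  qed
  moreover have "map_poly to_ac (- q) = - map_poly to_ac q"
    by (intro poly_eqI) (simp add: coeff_map_poly)
  then have "x * poly (map_poly to_ac (- q)) x = to_ac c"
    using minus_unique[of "x * poly (map_poly to_ac q) x" "to_ac c"] eq
    by (simp only: add.commute poly_minus mult_minus_right)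
  ultimately show ?thesis by blast
qed

definition maximal_cone :: "'k::linordered_field alg_closure set \<Rightarrow> bool" where
  "maximal_cone P \<longleftrightarrow> ordered_cone P \<and> to_ac ` {0..} \<subseteq> P \<and>
     (\<forall>Q. ordered_cone Q \<longrightarrow> P \<subseteq> Q \<longrightarrow> Q = P)"

lemma ex_maximal_cone: "\<exists>P :: 'k::linordered_field alg_closure set. maximal_cone P"
proof -
  define A where "A = {P :: 'k alg_closure set. ordered_cone P \<and> to_ac ` {0..} \<subseteq> P}"
  have "\<exists>M\<in>A. \<forall>U\<in>A. M \<subseteq> U \<longrightarrow> U = M"
  proof (rule subset_Zorn_nonempty)
    have "ordered_cone (to_ac ` {0 :: 'k..})"
      unfolding ordered_cone_def
    proof (intro conjI ballI impI)
      show "1 \<in> to_ac ` {0 :: 'k..}" by (metis atLeast_iff image_eqI to_ac_1 zero_le_one)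
      fix x :: "'k alg_closure" assume "x \<in> to_ac ` {0..}"
      then obtain a where a: "x = to_ac a" "0 \<le> a" by auto
      show "inverse x \<in> to_ac ` {0..}" using a by (intro image_eqI[of _ _ "inverse a"]) auto
      show "x = 0" if "- x \<in> to_ac ` {0..}"
      proof -
        from that obtain b where "to_ac (- a) = to_ac b" "0 \<le> b" using a by auto
        then show ?thesis using a by (simp only: to_ac_eq_iff) simp
      qed
      fix y :: "'k alg_closure" assume "y \<in> to_ac ` {0..}"
      then obtain b where b: "y = to_ac b" "0 \<le> b" by auto
      show "x + y \<in> to_ac ` {0..}" using a b by (intro image_eqI[of _ _ "a + b"]) auto
      show "x * y \<in> to_ac ` {0..}" using a b by (intro image_eqI[of _ _ "a * b"]) auto
      show "x - y \<in> to_ac ` {0..} \<or> y - x \<in> to_ac ` {0..}"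
      proof (cases "a \<le> b")
        case True
        then have "y - x \<in> to_ac ` {0..}" using a b by (intro image_eqI[of _ _ "b - a"]) auto
        then show ?thesis ..
      next
        case False
        then have "x - y \<in> to_ac ` {0..}" using a b by (intro image_eqI[of _ _ "a - b"]) auto
        then show ?thesis ..
      qed
    qed
    then have "to_ac ` {0 :: 'k..} \<in> A" by (simp only: A_def mem_Collect_eq order_refl simp_thms)
    then show "A \<noteq> {}" by blast
    fix C assume C: "C \<noteq> {}" "subset.chain A C"
    then have CA: "\<And>U. U \<in> C \<Longrightarrow> ordered_cone U \<and> to_ac ` {0..} \<subseteq> U"
      unfolding subset_chain_def A_def by blast
    obtain U0 where U0: "U0 \<in> C" using C by blast
    have two: "\<exists>U\<in>C. x \<in> U \<and> y \<in> U \<and> ordered_cone U" if "x \<in> \<Union>C" "y \<in> \<Union>C" for x y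
      using subset_chain_Union2[OF C(2) that] CA by blast
    have "ordered_cone (\<Union>C)"
      unfolding ordered_cone_def
    proof (intro conjI ballI impI)
      show "1 \<in> \<Union>C" using CA[OF U0] ordered_coneD(1) U0 by blast
      fix x assume x: "x \<in> \<Union>C"
      show "inverse x \<in> \<Union>C" using two[OF x x] ordered_coneD(2) by blast
      show "x = 0" if "- x \<in> \<Union>C" using two[OF x that] ordered_coneD(3) by blast
      fix y assume y: "y \<in> \<Union>C"
      obtain U where U: "U \<in> C" "x \<in> U" "y \<in> U" "ordered_cone U" using two[OF x y] by blast
      show "x + y \<in> \<Union>C" using ordered_coneD(4)[OF U(4,2,3)] U(1) by blast
      show "x * y \<in> \<Union>C" using ordered_coneD(5)[OF U(4,2,3)] U(1) by blast
      show "x - y \<in> \<Union>C \<or> y - x \<in> \<Union>C" using ordered_coneD(6)[OF U(4,2,3)] U(1) by blast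
    qed
    moreover have "to_ac ` {0..} \<subseteq> \<Union>C" using CA[OF U0] U0 by (meson Sup_upper2)
    ultimately show "\<Union>C \<in> A" by (simp only: A_def mem_Collect_eq simp_thms)
  qed
  then obtain M where M: "M \<in> A" "\<And>U. U \<in> A \<Longrightarrow> M \<subseteq> U \<Longrightarrow> U = M" by blast
  have AD: "U \<in> A \<longleftrightarrow> ordered_cone U \<and> to_ac ` {0..} \<subseteq> U" for U by (simp only: A_def mem_Collect_eq)
  have "maximal_cone M"
    unfolding maximal_cone_def
  proof (intro conjI allI impI)
    show "ordered_cone M" "to_ac ` {0..} \<subseteq> M" using M(1) by (simp_all only: AD)
    fix U assume U: "ordered_cone U" "M \<subseteq> U"
    then have "U \<in> A" using M(1) unfolding AD by (meson subset_trans)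
    then show "U = M" using M(2) U(2) by blast
  qed
  then show ?thesis ..
qed

text \<open>
  If \<open>- 1\<close> is not a weighted sum of squares in \<open>F[\<alpha>]\<close>, then \<open>F[\<alpha>]\<close> has an ordering that extends the
  one of \<open>F\<close>, so maximality forces \<open>\<alpha> \<in> F\<close>.
\<close>

lemma maximal_cone_absorbs:
  fixes P :: "'k::linordered_field alg_closure set"
  assumes P: "maximal_cone P" and no: "\<And>u. u \<in> weighted_square_sums P \<Longrightarrow> poly u \<alpha> \<noteq> - 1"
  shows "\<alpha> \<in> cone_field P"
proof -
  define F where "F = cone_field P"
  have oP: "ordered_cone P" and base: "\<And>c. 0 \<le> c \<Longrightarrow> to_ac c \<in> P"
    using P by (auto simp: maximal_cone_def)
  note cP = ordered_coneD[OF oP]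
  have fF: "field_set F" using cone_field_is_field[OF oP] by (simp add: F_def)
  have rF: "ring_set F" using fF by (simp add: field_set_def)
  have acF: "to_ac c \<in> F" for c
    using base[of c] base[of "- c"] by (cases "c \<ge> 0") (auto simp: F_def cone_field_def)
  have PF: "P \<subseteq> F" by (auto simp: F_def cone_field_def)
  define B where "B = {poly h \<alpha> | h. poly_over F h}"
  have BI: "poly h \<alpha> \<in> B" if "poly_over F h" for h using that by (auto simp: B_def)
  have rB: "ring_set B"
    unfolding ring_set_def
  proof (intro conjI ballI)
    show "1 \<in> B" using BI[OF poly_over_closed(7)[OF rF]] by simp
    fix x y assume "x \<in> B" "y \<in> B"
    then obtain h k where hk: "x = poly h \<alpha>" "y = poly k \<alpha>" "poly_over F h" "poly_over F k"
      by (auto simp: B_def)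
    show "x - y \<in> B" using BI[OF poly_over_closed(2)[OF rF hk(3,4)]] hk by simp
    show "x * y \<in> B" using BI[OF poly_over_closed(3)[OF rF hk(3,4)]] hk by simp
  qed
  have FB: "c \<in> B" if "c \<in> F" for c
    using BI[OF poly_over_closed(5)[OF rF that, of 0]] by (simp add: monom_0)
  have "poly_over F (monom 1 1)" using poly_over_closed(5)[OF rF ring_setD(1)[OF rF]] .
  from BI[OF this] have alB: "\<alpha> \<in> B" by (simp add: poly_monom)
  have invB: "inverse x \<in> B" if x: "x \<in> B" for x
  proof (cases "x = 0")
    case False
    from alg_closure_divides_constant[OF this] obtain c q
      where cq: "c \<noteq> 0" "x * poly (map_poly to_ac q) x = to_ac c" by blast
    have "poly_over B (map_poly to_ac q)" using FB acF by (simp add: poly_over_def coeff_map_poly)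
    then have y: "poly (map_poly to_ac q) x \<in> B" using poly_in_ring_set[OF rB _ x] by blast
    have "inverse x = poly (map_poly to_ac q) x * to_ac (inverse c)"
      using cq False by (simp add: field_simps)
    with ring_setD(4)[OF rB y FB[OF acF[of "inverse c"]]] show ?thesis by (simp only:)
  qed (use x in simp)
  define T where "T = {poly u \<alpha> | u. u \<in> weighted_square_sums P}"
  have TI: "poly u \<alpha> \<in> T" if "u \<in> weighted_square_sums P" for u using that by (auto simp: T_def)
  have "proper_preordering B T"
    unfolding proper_preordering_def
  proof (intro conjI ballI)
    show "T \<subseteq> B" using weighted_square_sums_over(1)[OF oP] by (auto simp: T_def F_def intro!: BI)
    show "- 1 \<notin> T" using no by (force simp: T_def)
    show "x * x \<in> T" if "x \<in> B" for x
    proof -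
      obtain h where h: "x = poly h \<alpha>" "poly_over F h" using \<open>x \<in> B\<close> by (auto simp: B_def)
      then have "smult 1 (h * h) \<in> weighted_square_sums P"
        using cP(1) unfolding F_def by (intro weighted_square_sums.square)
      from TI[OF this] show ?thesis by (simp add: h)
    qed
    fix x y assume "x \<in> T" "y \<in> T"
    then obtain u v where uv: "x = poly u \<alpha>" "y = poly v \<alpha>" "u \<in> weighted_square_sums P" "v \<in> weighted_square_sums P"
      by (auto simp: T_def)
    show "x + y \<in> T" using TI[OF weighted_square_sums.add[OF uv(3,4)]] uv by simp
    show "x * y \<in> T" using TI[OF weighted_square_sums_mult[OF oP uv(3,4)]] uv by simp
  qed
  from ex_prime_cone_above[OF rB this] obtain Q where Q: "T \<subseteq> Q" "prime_cone B Q" by blast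
  have pQ: "proper_preordering B Q" and tQ: "\<And>x. x \<in> B \<Longrightarrow> x \<in> Q \<or> - x \<in> Q"
    using Q(2) by (auto simp: prime_cone_def)
  note cQ = proper_preorderingD[OF pQ]
  have "ordered_cone Q"
    unfolding ordered_cone_def
  proof (intro conjI ballI impI)
    show "1 \<in> Q" using cQ(2)[OF ring_setD(1)[OF rB]] by simp
    fix x assume x: "x \<in> Q"
    have sq: "inverse x * inverse x \<in> Q" using cQ(2) invB cQ(1)[OF x] by blast
    have "x * (inverse x * inverse x) = inverse x" by (cases "x = 0") simp_all
    then show "inverse x \<in> Q" using cQ(4)[OF x sq] by (simp only:)
    show "x = 0" if "- x \<in> Q"
    proof (rule ccontr)
      assume "x \<noteq> 0"
      then have "x * inverse x = 1" by simp
      then have "- 1 = - ((x * inverse x) * (x * inverse x))" by simp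
      also have "\<dots> = (x * - x) * (inverse x * inverse x)" by (simp only: mult_minus_left mult_minus_right ac_simps)
      finally have "- 1 = (x * - x) * (inverse x * inverse x)" .
      then show False using cQ(4)[OF cQ(4)[OF x that] sq] cQ(5) by simp
    qed
    fix y assume y: "y \<in> Q"
    show "x + y \<in> Q" "x * y \<in> Q" using cQ(3,4) x y by blast+
    show "x - y \<in> Q \<or> y - x \<in> Q"
      using tQ[of "x - y"] ring_setD(3)[OF rB] cQ(1) x y by auto
  qed
  moreover have "P \<subseteq> Q"
  proof
    fix c assume "c \<in> P"
    then have "smult c (1 * 1) \<in> weighted_square_sums P"
      using poly_over_closed(7)[OF rF] unfolding F_def by (intro weighted_square_sums.square)
    from TI[OF this] show "c \<in> Q" using Q(1) by auto
  qed
  ultimately have "Q = P" using P by (auto simp: maximal_cone_def)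
  then show ?thesis using tQ[OF alB] by (simp add: cone_field_def)
qed

text \<open>
  Let \<open>g\<close> of least degree change sign between \<open>a\<close> and \<open>b\<close> without a root in \<open>F\<close>, and let \<open>\<alpha>\<close> be a
  root in the algebraic closure. By minimality, no polynomial of smaller degree vanishes at \<open>\<alpha>\<close>. If
  \<open>- 1\<close> were a weighted sum of squares \<open>v(\<alpha>)\<close>, then \<open>1 + v = g q\<close> with \<open>deg q < deg g\<close>. The left
  side is positive on \<open>F\<close>, so \<open>q\<close> changes sign together with \<open>g\<close> and has a root in \<open>F\<close> by
  minimality, where the left side cannot vanish. Hence the order extends to \<open>F[\<alpha>]\<close> and
  \<open>\<alpha> \<in> F\<close>.
\<close>

lemma maximal_cone_root:
  fixes P :: "'k::linordered_field alg_closure set"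
  assumes P: "maximal_cone P"
  shows "poly_over (cone_field P) g \<Longrightarrow> a \<in> cone_field P \<Longrightarrow> b \<in> cone_field P \<Longrightarrow>
    cone_neg P (poly g a * poly g b) \<Longrightarrow> \<exists>r\<in>cone_field P. poly g r = 0"
proof (induction "degree g" arbitrary: g rule: less_induct)
  case less
  define F where "F = cone_field P"
  note g = less.prems(1)[folded F_def] and ab = less.prems(2,3)[folded F_def] and neg = less.prems(4)
  have IH: "\<exists>r\<in>F. poly h r = 0"
    if "poly_over F h" "degree h < degree g" "cone_neg P (poly h a * poly h b)" for h
    using less.hyps[of h] that less.prems(2,3) by (simp add: F_def)
  have oP: "ordered_cone P" using P by (auto simp: maximal_cone_def)
  note cP = ordered_coneD[OF oP]
  have fF: "field_set F" using cone_field_is_field[OF oP] by (simp add: F_def)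
  have rF: "ring_set F" using fF by (simp add: field_set_def)
  have valF: "poly h x \<in> F" if "poly_over F h" "x \<in> F" for h x using poly_in_ring_set[OF rF that] .
  have g0: "g \<noteq> 0" using neg by (auto simp: cone_neg_def)
  have neg_mult: "cone_neg P x \<or> cone_neg P y" if "x \<in> F" "y \<in> F" "cone_neg P (x * y)" for x y
    using cone_neg_mult[OF oP] that by (simp add: F_def)
  have deg: "degree g > 0"
  proof (rule ccontr)
    assume "\<not> degree g > 0"
    then obtain c where c: "g = [:c:]" by (metis degree_eq_zeroE gr0I)
    have "poly g a \<in> F" using valF g ab by blast
    then have "c * c \<in> P" using square_in_cone[OF oP, of c] by (simp add: F_def c)
    then show False using neg cP(3)[of "c * c"] by (auto simp: cone_neg_def c)
  qed
  show ?case unfolding F_def[symmetric]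
  proof (rule ccontr)
    assume noroot: "\<not> (\<exists>r\<in>F. poly g r = 0)"
    obtain \<alpha> where al: "poly g \<alpha> = 0" using alg_closed_imp_poly_has_root[OF deg] by blast
    have min: "h = 0" if h: "poly_over F h" "poly h \<alpha> = 0" "degree h < degree g" for h
    proof (rule ccontr)
      assume "h \<noteq> 0"
      define R where "R k \<longleftrightarrow> k \<noteq> 0 \<and> poly_over F k \<and> poly k \<alpha> = 0" for k
      have "R h" using h \<open>h \<noteq> 0\<close> by (simp add: R_def)
      then obtain m where m: "R m" "\<And>k. R k \<Longrightarrow> degree m \<le> degree k"
        using ex_has_least_nat[of R h degree] by blast
      have m': "m \<noteq> 0" "poly_over F m" "poly m \<alpha> = 0" using m(1) by (auto simp: R_def)
      have dm: "degree m < degree g" using m(2)[OF \<open>R h\<close>] h(3) by simp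
      have "degree m > 0" using m' by (metis degree_0_id gr0I mult.right_neutral poly_const_conv pCons_0_0)
      from poly_over_division[OF fF m'(2,1) g] obtain s r
        where sr: "poly_over F s" "poly_over F r" "g = m * s + r" "r = 0 \<or> degree r < degree m" by blast
      have "poly r \<alpha> = 0" using al sr(3) m'(3) by simp
      then have "r = 0" using m(2)[of r] sr(2,4) by (fastforce simp: R_def)
      then have gms: "g = m * s" using sr(3) by simp
      have "s \<noteq> 0" using gms g0 by auto
      then have ds: "degree s < degree g" using gms m'(1) \<open>degree m > 0\<close> by (simp add: degree_mult_eq)
      have "cone_neg P ((poly m a * poly m b) * (poly s a * poly s b))" using neg by (simp add: gms ac_simps)
      then have "cone_neg P (poly m a * poly m b) \<or> cone_neg P (poly s a * poly s b)"
        using valF m'(2) sr(1) ab ring_setD(4)[OF rF] by (intro neg_mult) auto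
      then show False using IH[OF m'(2) dm] IH[OF sr(1) ds] noroot by (auto simp: gms)
    qed
    have "poly u \<alpha> \<noteq> - 1" if u: "u \<in> weighted_square_sums P" for u
    proof
      assume "poly u \<alpha> = - 1"
      then obtain v where v: "v \<in> weighted_square_sums P" "poly v \<alpha> = - 1" "degree v \<le> 2 * (degree g - 1)"
        using weighted_square_sums_reduce[OF oP g[unfolded F_def] deg al u] by metis
      have vF: "poly_over F v" and vP: "\<And>x. x \<in> F \<Longrightarrow> poly v x \<in> P"
        using weighted_square_sums_over[OF oP v(1)] by (auto simp: F_def)
      define w where "w = 1 + v"
      have wP: "poly w x \<in> P" "poly w x \<noteq> 0" if "x \<in> F" for x
      proof -
        show "poly w x \<in> P" using cP(4)[OF cP(1) vP[OF that]] by (simp add: w_def)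
        show "poly w x \<noteq> 0"
        proof
          assume "poly w x = 0"
          then have "poly v x = - 1" by (simp add: w_def add_eq_0_iff)
          then show False using vP[OF that] cP(8) by simp
        qed
      qed
      have wF: "poly_over F w" using poly_over_closed(1,7)[OF rF] vF by (simp add: w_def)
      from poly_over_division[OF fF g g0 wF] obtain q r
        where qr: "poly_over F q" "poly_over F r" "w = g * q + r" "r = 0 \<or> degree r < degree g" by blast
      have "poly w \<alpha> = 0" using v(2) by (simp add: w_def)
      then have "poly r \<alpha> = 0" using qr(3) al by simp
      then have "r = 0" using min[OF qr(2)] qr(4) by blast
      then have w: "w = g * q" using qr(3) by simp
      have "q \<noteq> 0" using wP(2)[OF ab(1)] w by auto
      then have "degree g + degree q = degree w" using w g0 by (simp add: degree_mult_eq)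
      also have "degree w \<le> 2 * (degree g - 1)"
        unfolding w_def using degree_add_le[of 1 "2 * (degree g - 1)" v] v(3) by simp
      finally have dq: "degree q < degree g" using deg by simp
      have vals: "poly g a * poly g b \<in> F" "poly q a * poly q b \<in> F"
        using valF g qr(1) ab ring_setD(4)[OF rF] by auto
      have "(poly g a * poly g b) * (poly q a * poly q b) = poly w a * poly w b"
        by (simp add: w ac_simps)
      then have pos: "(poly g a * poly g b) * (poly q a * poly q b) \<in> P"
        "(poly g a * poly g b) * (poly q a * poly q b) \<noteq> 0"
        using cP(5) wP ab by auto
      have "cone_neg P (poly q a * poly q b)"
      proof (rule ccontr)
        assume "\<not> ?thesis"
        then have "poly q a * poly q b \<in> P" using cone_neg_iff[OF oP] vals(2) by (simp add: F_def)
        moreover have "- (poly g a * poly g b) \<in> P" using neg by (simp add: cone_neg_def)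
        ultimately have "- ((poly g a * poly g b) * (poly q a * poly q b)) \<in> P"
          using cP(5)[of "- (poly g a * poly g b)"] by simp
        then show False using cP(3)[OF pos(1)] pos(2) by simp
      qed
      from IH[OF qr(1) dq this] obtain r where "r \<in> F" "poly q r = 0" by blast
      then show False using wP(2)[of r] w by simp
    qed
    then have "\<alpha> \<in> F" using maximal_cone_absorbs[OF P] by (simp add: F_def)
    then show False using noroot al by blast
  qed
qed

definition closure_cone :: "'k::linordered_field alg_closure set" where
  "closure_cone = (SOME P. maximal_cone P)"

lemma closure_cone: "maximal_cone (closure_cone :: 'k::linordered_field alg_closure set)"
  unfolding closure_cone_def using ex_maximal_cone by (rule someI_ex)

lemma ordered_closure_cone: "ordered_cone (closure_cone :: 'k::linordered_field alg_closure set)"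
  by (rule closure_cone[unfolded maximal_cone_def, THEN conjunct1])

lemmas closure_cone_simps = ordered_coneD[OF ordered_closure_cone]

typedef (overloaded) 'k::linordered_field real_closure =
  "cone_field (closure_cone :: 'k alg_closure set)"
  using closure_cone_simps(1) unfolding cone_field_def by blast

setup_lifting type_definition_real_closure

lemma field_set_closure: "field_set (cone_field (closure_cone :: 'k::linordered_field alg_closure set))"
  using cone_field_is_field[OF ordered_closure_cone] .

lemma ring_set_closure: "ring_set (cone_field (closure_cone :: 'k::linordered_field alg_closure set))"
  by (rule field_set_closure[unfolded field_set_def, THEN conjunct1])

instantiation real_closure :: (linordered_field) linordered_field
begin

lift_definition zero_real_closure :: "'a real_closure" is 0 by (rule ring_setD(2)[OF ring_set_closure])
lift_definition one_real_closure :: "'a real_closure" is 1 by (rule ring_setD(1)[OF ring_set_closure])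
lift_definition plus_real_closure :: "'a real_closure \<Rightarrow> 'a real_closure \<Rightarrow> 'a real_closure"
  is "(+)" by (rule ring_setD(6)[OF ring_set_closure])
lift_definition minus_real_closure :: "'a real_closure \<Rightarrow> 'a real_closure \<Rightarrow> 'a real_closure"
  is "(-)" by (rule ring_setD(3)[OF ring_set_closure])
lift_definition uminus_real_closure :: "'a real_closure \<Rightarrow> 'a real_closure"
  is uminus by (rule ring_setD(5)[OF ring_set_closure])
lift_definition times_real_closure :: "'a real_closure \<Rightarrow> 'a real_closure \<Rightarrow> 'a real_closure"
  is "(*)" by (rule ring_setD(4)[OF ring_set_closure])
lift_definition inverse_real_closure :: "'a real_closure \<Rightarrow> 'a real_closure"
  is inverse using field_set_closure[where 'k = 'a] by (auto simp: field_set_def)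
definition divide_real_closure :: "'a real_closure \<Rightarrow> 'a real_closure \<Rightarrow> 'a real_closure" where
  "divide_real_closure x y = x * inverse y"
lift_definition less_eq_real_closure :: "'a real_closure \<Rightarrow> 'a real_closure \<Rightarrow> bool"
  is "\<lambda>x y. y - x \<in> closure_cone" .
definition less_real_closure :: "'a real_closure \<Rightarrow> 'a real_closure \<Rightarrow> bool" where
  "less_real_closure x y \<longleftrightarrow> x \<le> y \<and> \<not> y \<le> x"
definition abs_real_closure :: "'a real_closure \<Rightarrow> 'a real_closure" where
  "abs_real_closure x = (if x < 0 then - x else x)"
definition sgn_real_closure :: "'a real_closure \<Rightarrow> 'a real_closure" where
  "sgn_real_closure x = (if x = 0 then 0 else if 0 < x then 1 else - 1)"

instance
proof
  fix a b c :: "'a real_closure"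
  show "a + b + c = a + (b + c)" "a + b = b + a" "0 + a = a" "- a + a = 0" "a - b = a + - b"
    "a + b - a = b" "a - b - c = a - (b + c)" "0 * a = 0" "a * 0 = 0"
    "a * b * c = a * (b * c)" "a * b = b * a" "1 * a = a" "(a + b) * c = a * c + b * c"
    "(0 :: 'a real_closure) \<noteq> 1" "inverse (0 :: 'a real_closure) = 0"
    by (transfer; simp add: algebra_simps)+
  show "a \<noteq> 0 \<Longrightarrow> inverse a * a = 1" by transfer simp
  show "a div b = a * inverse b" by (simp add: divide_real_closure_def)
  show "a < b \<longleftrightarrow> a \<le> b \<and> \<not> b \<le> a" by (simp add: less_real_closure_def)
  show "a \<le> a" by transfer (simp add: closure_cone_simps(7))
  show "a \<le> c" if "a \<le> b" "b \<le> c"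
    using that
  proof transfer
    fix a b c :: "'a alg_closure"
    assume "b - a \<in> closure_cone" "c - b \<in> closure_cone"
    from closure_cone_simps(4)[OF this] show "c - a \<in> closure_cone" by simp
  qed
  have antisym: "a = b" if "a \<le> b" "b \<le> a" for a b :: "'a real_closure"
    using that
  proof transfer
    fix a b :: "'a alg_closure"
    assume "b - a \<in> closure_cone" "a - b \<in> closure_cone"
    then show "a = b" using closure_cone_simps(3)[of "b - a"] by simp
  qed
  show "a \<le> b \<Longrightarrow> b \<le> a \<Longrightarrow> a = b" by (rule antisym)
  show "a \<le> b \<or> b \<le> a"
  proof transfer
    fix a b :: "'a alg_closure"
    assume "a \<in> cone_field closure_cone" "b \<in> cone_field closure_cone"
    from ring_setD(3)[OF ring_set_closure this(2,1)]
    show "b - a \<in> closure_cone \<or> a - b \<in> closure_cone" by (simp add: cone_field_def)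
  qed
  show "c + a \<le> c + b" if "a \<le> b" using that by transfer simp
  show "c * a < c * b" if "a < b" "0 < c"
  proof -
    have "c * a \<le> c * b" using that unfolding less_real_closure_def
    proof (elim conjE, transfer)
      fix a b c :: "'a alg_closure"
      assume "b - a \<in> closure_cone" "c - 0 \<in> closure_cone"
      then show "c * b - c * a \<in> closure_cone"
        using closure_cone_simps(5)[of c "b - a"] by (simp add: right_diff_distrib)
    qed
    moreover have "c * a \<noteq> c * b"
    proof
      assume eq: "c * a = c * b"
      have "c \<noteq> 0" "a \<noteq> b" using that by (auto simp: less_real_closure_def)
      then show False using eq by (transfer) simp
    qed
    ultimately show ?thesis
      using antisym unfolding less_real_closure_def by blast
  qed
  show "\<bar>a\<bar> = (if a < 0 then - a else a)" by (simp add: abs_real_closure_def)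
  show "sgn a = (if a = 0 then 0 else if 0 < a then 1 else - 1)" by (simp add: sgn_real_closure_def)
qed

end

lemma Rep_real_closure_poly:
  "Rep_real_closure (poly p x) = poly (map_poly Rep_real_closure p) (Rep_real_closure x)"
  by (induction p) (simp_all add: map_poly_pCons zero_real_closure.rep_eq
      plus_real_closure.rep_eq times_real_closure.rep_eq)

instance real_closure :: (linordered_field) real_closed_field
proof (rule real_closed_field_classI)
  fix p :: "'a real_closure poly" and a b
  assume neg: "poly p a * poly p b < 0"
  let ?P = "closure_cone :: 'a alg_closure set" and ?R = Rep_real_closure
  have "\<exists>r\<in>cone_field ?P. poly (map_poly ?R p) r = 0"
  proof (rule maximal_cone_root[OF closure_cone])
    show "poly_over (cone_field ?P) (map_poly ?R p)"
      by (simp add: poly_over_def coeff_map_poly zero_real_closure.rep_eq Rep_real_closure)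
    show "?R a \<in> cone_field ?P" "?R b \<in> cone_field ?P" by (rule Rep_real_closure)+
    have "?R (poly p a * poly p b) = poly (map_poly ?R p) (?R a) * poly (map_poly ?R p) (?R b)"
      by (simp add: times_real_closure.rep_eq Rep_real_closure_poly)
    moreover have "?R (poly p a * poly p b) \<noteq> ?R 0"
      using neg by (metis Rep_real_closure_inject less_irrefl)
    then have "cone_neg ?P (?R (poly p a * poly p b))"
      using less_imp_le[OF neg]
      by (simp add: cone_neg_def less_eq_real_closure.rep_eq zero_real_closure.rep_eq)
    ultimately show "cone_neg ?P (poly (map_poly ?R p) (?R a) * poly (map_poly ?R p) (?R b))" by simp
  qed
  then obtain r where r: "r \<in> cone_field ?P" "poly (map_poly ?R p) r = 0" by blast
  then have "?R (poly p (Abs_real_closure r)) = ?R 0"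
    by (simp add: Rep_real_closure_poly Abs_real_closure_inverse zero_real_closure.rep_eq)
  then show "\<exists>x. poly p x = 0" by (auto simp: Rep_real_closure_inject)
qed

lift_definition to_rc :: "'k::linordered_field \<Rightarrow> 'k real_closure" is to_ac
proof -
  fix c :: 'k
  have "to_ac d \<in> closure_cone" if "0 \<le> d" for d :: 'k
    using closure_cone[where 'k = 'k] that by (auto simp: maximal_cone_def)
  from this[of c] this[of "- c"] show "to_ac c \<in> cone_field closure_cone"
    by (cases "0 \<le> c") (auto simp: cone_field_def)
qed

lemma to_rc_hom:
  "to_rc (x + y) = to_rc x + to_rc y" "to_rc (x * y) = to_rc x * to_rc y" "to_rc 0 = 0" "to_rc 1 = 1"
  by (transfer; simp)+

lemma to_rc_nonneg: "0 \<le> x \<Longrightarrow> 0 \<le> to_rc x"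
proof transfer
  fix x :: 'a
  assume "0 \<le> x"
  then show "to_ac x - 0 \<in> closure_cone"
    using closure_cone[where 'k = 'a] by (auto simp: maximal_cone_def)
qed

section \<open>Evaluation of polynomials in several variables\<close>

definition mono_eval :: "('n::finite \<Rightarrow>\<^sub>0 nat) \<Rightarrow> real ^ 'n \<Rightarrow> real" where
  "mono_eval m x = (\<Prod>i\<in>UNIV. (x $ i) ^ Poly_Mapping.lookup m i)"

lemma mono_eval_add: "mono_eval (m + n) x = mono_eval m x * mono_eval n x"
  by (simp add: mono_eval_def lookup_add power_add prod.distrib)

lemma poly_eval_superset:
  assumes "finite A" "Poly_Mapping.keys p \<subseteq> A"
  shows "poly_eval p x = (\<Sum>m\<in>A. mono_eval m x *\<^sub>R Poly_Mapping.lookup p m)"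
  unfolding poly_eval_def mono_eval_def[symmetric]
  by (rule sum.mono_neutral_left) (use assms in \<open>auto simp: in_keys_iff\<close>)

lemma poly_eval_single: "poly_eval (Poly_Mapping.single m c) x = mono_eval m x *\<^sub>R c"
  by (subst poly_eval_superset[of "{m}"]) (auto simp: lookup_single split: if_splits)

lemma poly_eval_add: "poly_eval (p + q) x = poly_eval p x + poly_eval q x"
proof -
  let ?A = "Poly_Mapping.keys p \<union> Poly_Mapping.keys q"
  have "Poly_Mapping.keys (p + q) \<subseteq> ?A" by (rule Poly_Mapping.keys_add)
  then show ?thesis
    by (simp add: poly_eval_superset[of ?A] lookup_add scaleR_add_right sum.distrib)
qed

lemma poly_eval_0: "poly_eval 0 x = 0" by (simp add: poly_eval_def)

lemma poly_eval_1: "poly_eval 1 x = 1"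
  using poly_eval_single[of 0 1 x] by (simp add: mono_eval_def)

lemma mpoly_additive_induct [case_names zero single add]:
  assumes "Q 0" "\<And>m c. Q (Poly_Mapping.single m c)" "\<And>p q. Q p \<Longrightarrow> Q q \<Longrightarrow> Q (p + q)"
  shows "Q (p :: ('n, 'a::comm_monoid_add) mpoly)"
proof (induction p rule: update_induct)
  case const
  show ?case by (rule assms(1))
next
  case (update p a b)
  then show ?case using assms(2,3) by (simp add: update_eq_plus_single)
qed

lemma poly_eval_mult:
  fixes p q :: "('n::finite, real) mpoly"
  shows "poly_eval (p * q) x = poly_eval p x * poly_eval q x"
proof (induction p rule: mpoly_additive_induct)
  case (single m c)
  show ?case
  proof (induction q rule: mpoly_additive_induct)
    case (single n d)
    then show ?case by (simp add: mult_single poly_eval_single mono_eval_add)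
  qed (simp_all add: poly_eval_0 poly_eval_add distrib_left)
qed (simp_all add: poly_eval_0 poly_eval_add distrib_right)

lemma poly_eval_minus: "poly_eval (- p) x = - poly_eval p x"
  using poly_eval_add[of p "- p" x] by (simp add: poly_eval_0 eq_neg_iff_add_eq_0 add.commute)

lemma poly_eval_diff: "poly_eval (p - q) x = poly_eval p x - poly_eval q x"
  using poly_eval_add[of p "- q" x] by (simp add: poly_eval_minus)

definition mvar :: "'n \<Rightarrow> ('n, real) mpoly" where
  "mvar i = Poly_Mapping.single (Poly_Mapping.single i 1) 1"

definition mconst :: "real \<Rightarrow> ('n, real) mpoly" where
  "mconst c = Poly_Mapping.single 0 c"

lemma poly_eval_mvar: "poly_eval (mvar i) x = x $ i"
proof -
  have "(x $ j) ^ Poly_Mapping.lookup (Poly_Mapping.single i 1) j = (if j = i then x $ i else 1)" for j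
    by (simp add: lookup_single when_def)
  then show ?thesis by (simp add: mvar_def poly_eval_single mono_eval_def)
qed

lemma poly_eval_mconst: "poly_eval (mconst c) x = c"
  by (simp add: mconst_def poly_eval_single mono_eval_def)

lemma mconst_hom: "mconst (a + b) = mconst a + mconst b" "mconst (a * b) = mconst a * mconst b"
    "mconst 0 = 0" "mconst 1 = 1"
  by (simp_all add: mconst_def single_add mult_single)

lemma mpoly_ring_induct [case_names const var add mult]:
  fixes p :: "('n, real) mpoly"
  assumes "\<And>c. Q (mconst c)" "\<And>i. Q (mvar i)" "\<And>p q. Q p \<Longrightarrow> Q q \<Longrightarrow> Q (p + q)" "\<And>p q. Q p \<Longrightarrow> Q q \<Longrightarrow> Q (p * q)"
  shows "Q p"
proof (induction p rule: mpoly_additive_induct)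
  case zero
  show ?case using assms(1)[of 0] by (simp add: mconst_hom)
next
  case (single m c)
  show ?case
  proof (induction m rule: update_induct)
    case const
    show ?case using assms(1) by (simp add: mconst_def)
  next
    case (update m i k)
    have "Q (Poly_Mapping.single (m + Poly_Mapping.single i k) c)"
    proof (induction k)
      case 0
      then show ?case using update by simp
    next
      case (Suc k)
      have "Poly_Mapping.single (m + Poly_Mapping.single i (Suc k)) c
          = Poly_Mapping.single (m + Poly_Mapping.single i k) c * mvar i"
        by (simp add: mvar_def mult_single add.assoc flip: single_add)
      then show ?case using assms(2,4) Suc by simp
    qed
    then show ?case using update by (simp add: update_eq_plus_single)
  qed
qed (rule assms(3))

section \<open>The residue field of a prime cone\<close>

definition realizable :: "('n::finite, real) mpoly set \<Rightarrow> bool" where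
  "realizable P \<longleftrightarrow> (\<forall>S\<subseteq>P. finite S \<longrightarrow> (\<exists>x. \<forall>s\<in>S. 0 \<le> poly_eval s x))"

text \<open>
  A type cannot depend on a cone that is fixed inside a proof. Hence one cone is chosen once and for all: a
  prime cone that is not realizable, if there is any. Realizing this one settles all of them.
\<close>

definition test_cone :: "('n::finite, real) mpoly set" where
  "test_cone = (SOME P. prime_cone UNIV P \<and> ((\<exists>P'. prime_cone UNIV P' \<and> \<not> realizable (P' :: ('n, real) mpoly set)) \<longrightarrow> \<not> realizable P))"

lemma prime_cone_at_point: "prime_cone UNIV {p :: ('n::finite, real) mpoly. 0 \<le> poly_eval p x}"
  by (auto simp: prime_cone_def proper_preordering_def poly_eval_add poly_eval_mult poly_eval_minus
      poly_eval_1)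

lemma test_cone:
  "prime_cone UNIV (test_cone :: ('n::finite, real) mpoly set)"
  "realizable (test_cone :: ('n::finite, real) mpoly set) \<Longrightarrow> prime_cone UNIV P \<Longrightarrow> realizable (P :: ('n, real) mpoly set)"
proof -
  let ?E = "\<exists>P'. prime_cone UNIV P' \<and> \<not> realizable (P' :: ('n, real) mpoly set)"
  have "\<exists>P. prime_cone UNIV P \<and> (?E \<longrightarrow> \<not> realizable (P :: ('n, real) mpoly set))"
    using prime_cone_at_point by (cases ?E) blast+
  then have *: "prime_cone UNIV (test_cone :: ('n, real) mpoly set) \<and> (?E \<longrightarrow> \<not> realizable (test_cone :: ('n, real) mpoly set))"
    unfolding test_cone_def by (rule someI_ex)
  then show "prime_cone UNIV (test_cone :: ('n::finite, real) mpoly set)" ..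
  from * show "realizable (test_cone :: ('n::finite, real) mpoly set) \<Longrightarrow> prime_cone UNIV P \<Longrightarrow> realizable (P :: ('n, real) mpoly set)"
    by blast
qed

lemma prime_coneD:
  assumes "prime_cone UNIV P"
  shows "x \<in> P \<Longrightarrow> y \<in> P \<Longrightarrow> x + y \<in> P" "x \<in> P \<Longrightarrow> y \<in> P \<Longrightarrow> x * y \<in> P" "x * x \<in> P"
    "x \<in> P \<or> - x \<in> P" "- 1 \<notin> P" "0 \<in> P" "1 \<in> P"
    "x * y \<in> P \<Longrightarrow> - (x * y) \<in> P \<Longrightarrow> (x \<in> P \<and> - x \<in> P) \<or> (y \<in> P \<and> - y \<in> P)"
proof -
  have P: "proper_preordering UNIV P" using assms by (simp add: prime_cone_def)
  note c = proper_preorderingD[OF P]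
  show "x \<in> P \<Longrightarrow> y \<in> P \<Longrightarrow> x + y \<in> P" "x \<in> P \<Longrightarrow> y \<in> P \<Longrightarrow> x * y \<in> P" "x * x \<in> P" "- 1 \<notin> P"
    using c by blast+
  show "0 \<in> P" "1 \<in> P" using c(2)[of 0] c(2)[of 1] by simp_all
  show "x \<in> P \<or> - x \<in> P" using assms by (simp add: prime_cone_def)
  show "x * y \<in> P \<Longrightarrow> - (x * y) \<in> P \<Longrightarrow> (x \<in> P \<and> - x \<in> P) \<or> (y \<in> P \<and> - y \<in> P)"
    using assms unfolding prime_cone_def by blast
qed

definition cone_support :: "'a::comm_ring_1 set \<Rightarrow> 'a set" where
  "cone_support P = {x. x \<in> P \<and> - x \<in> P}"

lemma cone_support_ideal:
  assumes P: "prime_cone UNIV P"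
  shows "0 \<in> cone_support P" "x \<in> cone_support P \<Longrightarrow> - x \<in> cone_support P"
    "x \<in> cone_support P \<Longrightarrow> y \<in> cone_support P \<Longrightarrow> x + y \<in> cone_support P"
    "x \<in> cone_support P \<Longrightarrow> x * y \<in> cone_support P"
proof -
  note c = prime_coneD[OF P]
  show "0 \<in> cone_support P" using c(6) by (simp add: cone_support_def)
  show "x \<in> cone_support P \<Longrightarrow> - x \<in> cone_support P" by (simp add: cone_support_def)
  show "x \<in> cone_support P \<Longrightarrow> y \<in> cone_support P \<Longrightarrow> x + y \<in> cone_support P"
    using c(1)[of x y] c(1)[of "- x" "- y"] by (simp add: cone_support_def)
  assume "x \<in> cone_support P"
  then have x: "x \<in> P" "- x \<in> P" by (simp_all add: cone_support_def)
  show "x * y \<in> cone_support P"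
    using c(4)[of y] c(2)[OF x(1), of y] c(2)[OF x(2), of y] c(2)[OF x(1), of "- y"] c(2)[OF x(2), of "- y"]
    by (auto simp: cone_support_def)
qed

lemma add_support_in_cone:
  assumes "prime_cone UNIV P" "x - y \<in> cone_support P"
  shows "x \<in> P \<longleftrightarrow> y \<in> P"
  using prime_coneD(1)[OF assms(1), of "x - y" y] prime_coneD(1)[OF assms(1), of "- (x - y)" x] assms(2)
  by (auto simp: cone_support_def)

abbreviation test_support :: "('n::finite, real) mpoly set" where
  "test_support \<equiv> cone_support test_cone"

lemmas test_ideal = cone_support_ideal[OF test_cone(1)]
lemmas test_coneD = prime_coneD[OF test_cone(1)]

quotient_type (overloaded) 'n residue_ring =
  "('n::finite, real) mpoly" / "\<lambda>p q. p - q \<in> test_support"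
  morphisms rep_residue residue_class
proof (rule equivpI)
  show "reflp (\<lambda>p q :: ('n, real) mpoly. p - q \<in> test_support)"
    by (simp add: reflp_def test_ideal(1))
  show "symp (\<lambda>p q :: ('n, real) mpoly. p - q \<in> test_support)"
    using test_ideal(2) by (metis (no_types, lifting) minus_diff_eq sympI)
  show "transp (\<lambda>p q :: ('n, real) mpoly. p - q \<in> test_support)"
  proof (rule transpI)
    fix p q r :: "('n, real) mpoly"
    assume "p - q \<in> test_support" "q - r \<in> test_support"
    from test_ideal(3)[OF this] show "p - r \<in> test_support" by simp
  qed
qed

instantiation residue_ring :: (finite) linordered_idom
begin

lift_definition zero_residue_ring :: "'a residue_ring" is 0 .
lift_definition one_residue_ring :: "'a residue_ring" is 1 .
lift_definition plus_residue_ring :: "'a residue_ring \<Rightarrow> 'a residue_ring \<Rightarrow> 'a residue_ring" is "(+)"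
proof -
  fix p q r s :: "('a, real) mpoly"
  assume "p - q \<in> test_support" "r - s \<in> test_support"
  from test_ideal(3)[OF this] show "p + r - (q + s) \<in> test_support" by (simp add: algebra_simps)
qed
lift_definition minus_residue_ring :: "'a residue_ring \<Rightarrow> 'a residue_ring \<Rightarrow> 'a residue_ring" is "(-)"
proof -
  fix p q r s :: "('a, real) mpoly"
  assume "p - q \<in> test_support" "r - s \<in> test_support"
  from test_ideal(3)[OF this(1) test_ideal(2)[OF this(2)]]
  show "p - r - (q - s) \<in> test_support" by (simp add: algebra_simps)
qed
lift_definition uminus_residue_ring :: "'a residue_ring \<Rightarrow> 'a residue_ring" is uminus
proof -
  fix p q :: "('a, real) mpoly"
  assume "p - q \<in> test_support"
  from test_ideal(2)[OF this] show "- p - (- q) \<in> test_support" by simp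
qed
lift_definition times_residue_ring :: "'a residue_ring \<Rightarrow> 'a residue_ring \<Rightarrow> 'a residue_ring" is "(*)"
proof -
  fix p q r s :: "('a, real) mpoly"
  assume pq: "p - q \<in> test_support" and rs: "r - s \<in> test_support"
  have "(p - q) * r + (r - s) * q = p * r - q * s" by (simp add: algebra_simps)
  then show "p * r - q * s \<in> test_support"
    using test_ideal(3)[OF test_ideal(4)[OF pq, of r] test_ideal(4)[OF rs, of q]] by simp
qed
lift_definition less_eq_residue_ring :: "'a residue_ring \<Rightarrow> 'a residue_ring \<Rightarrow> bool"
  is "\<lambda>p q. q - p \<in> test_cone"
proof -
  fix p q r s :: "('a, real) mpoly"
  assume pq: "p - q \<in> test_support" and rs: "r - s \<in> test_support"
  have "(r - p) - (s - q) \<in> test_support"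
    using test_ideal(3)[OF rs test_ideal(2)[OF pq]] by (simp add: algebra_simps)
  from add_support_in_cone[OF test_cone(1) this]
  show "(r - p \<in> test_cone) = (s - q \<in> test_cone)" .
qed
definition less_residue_ring :: "'a residue_ring \<Rightarrow> 'a residue_ring \<Rightarrow> bool" where
  "less_residue_ring x y \<longleftrightarrow> x \<le> y \<and> \<not> y \<le> x"
definition abs_residue_ring :: "'a residue_ring \<Rightarrow> 'a residue_ring" where
  "abs_residue_ring x = (if x < 0 then - x else x)"
definition sgn_residue_ring :: "'a residue_ring \<Rightarrow> 'a residue_ring" where
  "sgn_residue_ring x = (if x = 0 then 0 else if 0 < x then 1 else - 1)"

instance
proof
  fix a b c :: "'a residue_ring"
  show "a + b + c = a + (b + c)" "a + b = b + a" "0 + a = a" "- a + a = 0" "a - b = a + - b"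
    "a + b - a = b" "a - b - c = a - (b + c)" "0 * a = 0" "a * 0 = 0"
    "a * b * c = a * (b * c)" "a * b = b * a" "1 * a = a" "(a + b) * c = a * c + b * c"
    by (transfer; simp add: algebra_simps test_ideal(1))+
  show "(0 :: 'a residue_ring) \<noteq> 1"
  proof transfer
    show "\<not> (0 - (1 :: ('a, real) mpoly) \<in> test_support)"
      by (simp add: cone_support_def test_coneD(5))
  qed
  have no_zero_div: "a = 0 \<or> b = 0" if "a * b = 0" for a b :: "'a residue_ring"
    using that
  proof transfer
    fix a b :: "('a, real) mpoly"
    assume "a * b - 0 \<in> test_support"
    then show "a - 0 \<in> test_support \<or> b - 0 \<in> test_support"
      using test_coneD(8)[of a b] by (simp add: cone_support_def)
  qed
  show "a < b \<longleftrightarrow> a \<le> b \<and> \<not> b \<le> a" by (simp add: less_residue_ring_def)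
  show "a \<le> a" by transfer (simp add: test_coneD(6))
  show "a \<le> c" if "a \<le> b" "b \<le> c"
    using that
  proof transfer
    fix a b c :: "('a, real) mpoly"
    assume "b - a \<in> test_cone" "c - b \<in> test_cone"
    from test_coneD(1)[OF this] show "c - a \<in> test_cone" by simp
  qed
  have antisym: "a = b" if "a \<le> b" "b \<le> a" for a b :: "'a residue_ring"
    using that by transfer (simp add: cone_support_def)
  show "a \<le> b \<Longrightarrow> b \<le> a \<Longrightarrow> a = b" by (rule antisym)
  show "a \<le> b \<or> b \<le> a"
  proof transfer
    fix a b :: "('a, real) mpoly"
    show "b - a \<in> test_cone \<or> a - b \<in> test_cone" using test_coneD(4)[of "b - a"] by simp
  qed
  show "c + a \<le> c + b" if "a \<le> b" using that by transfer simp
  show "c * a < c * b" if ab: "a < b" and c: "0 < c"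
  proof -
    have "c * a \<le> c * b" using ab c unfolding less_residue_ring_def
    proof (elim conjE, transfer)
      fix a b c :: "('a, real) mpoly"
      assume "b - a \<in> test_cone" "c - 0 \<in> test_cone"
      then show "c * b - c * a \<in> test_cone"
        using test_coneD(2)[of c "b - a"] by (simp add: right_diff_distrib)
    qed
    moreover have "c * a \<noteq> c * b"
    proof
      assume eq: "c * a = c * b"
      have "c * (a - b) = 0" using eq by (transfer) (simp add: right_diff_distrib)
      then have "c = 0 \<or> a - b = 0" by (rule no_zero_div)
      moreover have "a = b" if "a - b = 0" using that by transfer simp
      ultimately show False using ab c by (auto simp: less_residue_ring_def)
    qed
    ultimately show ?thesis using antisym unfolding less_residue_ring_def by blast
  qed
  show "\<bar>a\<bar> = (if a < 0 then - a else a)" by (simp add: abs_residue_ring_def)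
  show "sgn a = (if a = 0 then 0 else if 0 < a then 1 else - 1)" by (simp add: sgn_residue_ring_def)
qed

end

lemma residue_class_hom:
  "residue_class (p + q) = residue_class p + residue_class q"
  "residue_class (p * q) = residue_class p * residue_class q"
  "residue_class 0 = 0" "residue_class 1 = 1"
  by (simp_all add: plus_residue_ring.abs_eq times_residue_ring.abs_eq zero_residue_ring_def one_residue_ring_def)

lemma residue_class_nonneg: "p \<in> test_cone \<Longrightarrow> 0 \<le> residue_class p"
  by (simp add: less_eq_residue_ring.abs_eq flip: residue_class_hom(3))

definition residue_eval :: "('n::finite, real) mpoly \<Rightarrow> 'n residue_ring fract real_closure" where
  "residue_eval p = to_rc (Fract (residue_class p) 1)"

lemma residue_eval_hom:
  "residue_eval (p + q) = residue_eval p + residue_eval q"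
  "residue_eval (p * q) = residue_eval p * residue_eval q"
  "residue_eval 0 = 0" "residue_eval 1 = 1"
  by (simp_all add: residue_eval_def residue_class_hom flip: to_rc_hom)
    (simp_all add: to_rc_hom flip: Zero_fract_def One_fract_def)

lemma residue_eval_nonneg: "p \<in> test_cone \<Longrightarrow> 0 \<le> residue_eval p"
  unfolding residue_eval_def by (intro to_rc_nonneg) (simp add: zero_le_Fract_iff residue_class_nonneg)

section \<open>Transfer of signs to real points\<close>

text \<open>
  The relation \<open>C\<close> is a ring of pairs of a real function and an element of \<open>'r\<close> whose signs agree
  along the filter. So elements of \<open>'r\<close> are approximated, as far as signs are
  concerned, by families of real numbers. Filters allow any finite number of sign conditions at once.
\<close>

locale sign_tracking =
  fixes \<F> :: "'x filter" and C :: "('x \<Rightarrow> real) \<Rightarrow> 'r::real_closed_field \<Rightarrow> bool"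
  assumes C_one: "C (\<lambda>_. 1) 1"
    and C_add: "C c c' \<Longrightarrow> C d d' \<Longrightarrow> C (\<lambda>a. c a + d a) (c' + d')"
    and C_mult: "C c c' \<Longrightarrow> C d d' \<Longrightarrow> C (\<lambda>a. c a * d a) (c' * d')"
    and C_minus: "C c c' \<Longrightarrow> C (\<lambda>a. - c a) (- c')"
    and C_sign: "C c c' \<Longrightarrow> eventually (\<lambda>a. sg (c a) = sg c') \<F>"
begin

lemma C_zero: "C (\<lambda>_. 0) 0"
  using C_add[OF C_one C_minus[OF C_one]] by simp

lemma C_of_nat: "C (\<lambda>_. of_nat n) (of_nat n)"
  by (induction n) (simp_all add: C_zero C_add[OF C_one])

lemma C_sum: "(\<And>i. i \<in> I \<Longrightarrow> C (c i) (c' i)) \<Longrightarrow> C (\<lambda>a. \<Sum>i\<in>I. c i a) (\<Sum>i\<in>I. c' i)"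
  by (induction I rule: infinite_finite_induct) (simp_all add: C_zero C_add)

text \<open>
  The uniform degree bound makes all but finitely many coefficients vanish for every \<open>a\<close>, so that
  the signs of all coefficients agree simultaneously.
\<close>

definition tracked :: "('x \<Rightarrow> real poly) \<Rightarrow> 'r poly \<Rightarrow> bool" where
  "tracked p p' \<longleftrightarrow> (\<forall>i. C (\<lambda>a. coeff (p a) i) (coeff p' i)) \<and> (\<exists>N. \<forall>a. degree (p a) \<le> N)"

lemma trackedD: "tracked p p' \<Longrightarrow> C (\<lambda>a. coeff (p a) i) (coeff p' i)"
  by (simp add: tracked_def)

lemma trackedE:
  assumes "tracked p p'"
  obtains N where "\<And>a. degree (p a) \<le> N" "degree p' \<le> N"
proof -
  obtain N where "\<And>a. degree (p a) \<le> N" using assms by (auto simp: tracked_def)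
  then have "\<And>a. degree (p a) \<le> max N (degree p')" by (simp add: le_max_iff_disj)
  then show ?thesis using that[of "max N (degree p')"] by simp
qed

lemma tracked_add: "tracked p p' \<Longrightarrow> tracked q q' \<Longrightarrow> tracked (\<lambda>a. p a + q a) (p' + q')"
  unfolding tracked_def
proof (intro conjI allI; elim conjE exE)
  fix N M assume "\<forall>a. degree (p a) \<le> N" "\<forall>a. degree (q a) \<le> M"
  then show "\<exists>N. \<forall>a. degree (p a + q a) \<le> N"
    by (intro exI[of _ "max N M"] allI degree_add_le) (simp_all add: le_max_iff_disj)
qed (simp add: C_add)

lemma tracked_minus: "tracked p p' \<Longrightarrow> tracked (\<lambda>a. - p a) (- p')"
  by (simp add: tracked_def C_minus)

lemma tracked_diff: "tracked p p' \<Longrightarrow> tracked q q' \<Longrightarrow> tracked (\<lambda>a. p a - q a) (p' - q')"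
  using tracked_add[OF _ tracked_minus, of p p' q q'] by simp

lemma tracked_mult: "tracked p p' \<Longrightarrow> tracked q q' \<Longrightarrow> tracked (\<lambda>a. p a * q a) (p' * q')"
  unfolding tracked_def
proof (intro conjI allI; elim conjE exE)
  fix N M assume "\<forall>a. degree (p a) \<le> N" "\<forall>a. degree (q a) \<le> M"
  then show "\<exists>N. \<forall>a. degree (p a * q a) \<le> N"
    by (intro exI[of _ "N + M"] allI order_trans[OF degree_mult_le] add_mono) simp_all
qed (auto simp: coeff_mult intro!: C_sum C_mult)

lemma tracked_monom:
  assumes "C c c'"
  shows "tracked (\<lambda>a. monom (c a) n) (monom c' n)"
  unfolding tracked_def using assms C_zero
  by (auto intro!: exI[of _ n] degree_monom_le)

lemma tracked_pderiv: "tracked p p' \<Longrightarrow> tracked (\<lambda>a. pderiv (p a)) (pderiv p')"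
  unfolding tracked_def
proof (intro conjI allI; elim conjE exE)
  fix N assume "\<forall>a. degree (p a) \<le> N"
  then show "\<exists>N. \<forall>a. degree (pderiv (p a)) \<le> N"
    by (intro exI[of _ N] allI) (simp add: degree_pderiv order_trans[OF diff_le_self])
next
  fix i assume C: "\<forall>i. C (\<lambda>a. coeff (p a) i) (coeff p' i)"
  show "C (\<lambda>a. coeff (pderiv (p a)) i) (coeff (pderiv p') i)"
    unfolding coeff_pderiv by (intro C_mult C_of_nat C[rule_format])
qed

lemma tracked_signs:
  assumes "tracked p p'"
  shows "eventually (\<lambda>a. \<forall>i. sg (coeff (p a) i) = sg (coeff p' i)) \<F>"
proof -
  obtain N where N: "\<And>a. degree (p a) \<le> N" "degree p' \<le> N" by (rule trackedE[OF assms]) blast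
  have "eventually (\<lambda>a. \<forall>i\<in>{..N}. sg (coeff (p a) i) = sg (coeff p' i)) \<F>"
    using C_sign[OF trackedD[OF assms]] by (intro eventually_ball_finite) auto
  then show ?thesis
  proof eventually_elim
    case (elim a)
    show ?case
    proof
      fix i
      show "sg (coeff (p a) i) = sg (coeff p' i)"
      proof (cases "i \<le> N")
        case False
        then have "degree (p a) < i" "degree p' < i" using N(1)[of a] N(2) by auto
        then show ?thesis by (simp add: coeff_eq_0)
      qed (use elim in simp)
    qed
  qed
qed

lemma degree_eq_of_signs:
  assumes "\<forall>i. sg (coeff (p :: real poly) i) = sg (coeff (p' :: 'r poly) i)"
  shows "degree p = degree p'" "p = 0 \<longleftrightarrow> p' = 0"
proof -
  have z: "coeff p i = 0 \<longleftrightarrow> coeff p' i = 0" for i using assms by (metis sg_simps(2))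
  then show "degree p = degree p'" by (simp add: Polynomial.degree_def)
  show "p = 0 \<longleftrightarrow> p' = 0" using z by (simp add: poly_eq_iff)
qed

lemma tracked_degree:
  assumes "tracked p p'"
  shows "eventually (\<lambda>a. degree (p a) = degree p') \<F>"
    "eventually (\<lambda>a. p a = 0 \<longleftrightarrow> p' = 0) \<F>"
  using tracked_signs[OF assms] by (eventually_elim, blast dest: degree_eq_of_signs)+

text \<open>
  At the roots of \<open>q\<close> the remainder agrees with \<open>p\<close> in sign only, as \<open>C\<close> is a ring without inverses
  and division has to be replaced by pseudo-division.
\<close>

definition sign_remainder ::
    "('x \<Rightarrow> real poly) \<Rightarrow> 'r poly \<Rightarrow> ('x \<Rightarrow> real poly) \<Rightarrow> 'r poly \<Rightarrow> ('x \<Rightarrow> real poly) \<Rightarrow> 'r poly \<Rightarrow> bool" where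
  "sign_remainder p p' q q' r r' \<longleftrightarrow> (\<forall>t. poly q' t = 0 \<longrightarrow> sg (poly p' t) = sg (poly r' t)) \<and>
     eventually (\<lambda>a. \<forall>t. poly (q a) t = 0 \<longrightarrow> sg (poly (p a) t) = sg (poly (r a) t)) \<F>"

text \<open>
  Pseudo-division, with the square of the leading coefficient of \<open>q\<close> as multiplier so that signs are
  kept.
\<close>

lemma tracked_remainder:
  assumes q: "tracked q q'" "q' \<noteq> 0"
  shows "tracked p p' \<Longrightarrow> \<exists>r r'. tracked r r' \<and> (r' = 0 \<or> degree r' < degree q') \<and>
      sign_remainder p p' q q' r r'"
proof (induction "degree p'" arbitrary: p p' rule: less_induct)
  case less
  show ?case
  proof (cases "p' = 0 \<or> degree p' < degree q'")
    case True
    then show ?thesis using less.prems by (intro exI[of _ p] exI[of _ p']) (auto simp: sign_remainder_def)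
  next
    case False
    define n m where "n = degree q'" and "m = degree p'"
    define c d where "c = (\<lambda>a. coeff (q a) n)" and "d = (\<lambda>a. coeff (p a) m)"
    define c' d' where "c' = coeff q' n" and "d' = coeff p' m"
    have cc: "C c c'" and dd: "C d d'"
      using trackedD[OF q(1), of n] trackedD[OF less.prems, of m] by (simp_all add: c_def d_def c'_def d'_def)
    have c'0: "c' \<noteq> 0" using q(2) by (simp add: c'_def n_def)
    \<comment> \<open>the leading terms cancel; where q vanishes, p is multiplied by a square\<close>
    define p1 where "p1 a = monom (c a * c a) 0 * p a - monom (c a * d a) (m - n) * q a" for a
    define p1' where "p1' = monom (c' * c') 0 * p' - monom (c' * d') (m - n) * q'"
    have tr1: "tracked p1 p1'"
      unfolding p1_def p1'_def
      by (intro tracked_diff tracked_mult tracked_monom C_mult cc dd less.prems q(1))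
    have nm: "n \<le> m" using False by (auto simp: n_def m_def)
    have "coeff p1' m = c' * c' * d' - c' * d' * coeff q' (m - (m - n))"
      by (simp add: p1'_def monom_0 coeff_monom_mult d'_def del: monom_eq_0_iff)
    then have "coeff p1' m = 0" using nm by (simp add: c'_def)
    moreover have "degree p1' \<le> m"
    proof -
      have "degree (monom (c' * d') (m - n) * q') \<le> (m - n) + n"
        using degree_mult_le[of "monom (c' * d') (m - n)" q'] degree_monom_le[of "c' * d'" "m - n"]
        by (simp add: n_def)
      moreover have "degree (monom (c' * c') 0 * p') \<le> m"
        using degree_mult_le[of "monom (c' * c') 0" p'] degree_monom_le[of "c' * c'" 0] by (simp add: m_def)
      ultimately show ?thesis using nm unfolding p1'_def by (intro degree_diff_le) simp_all
    qed
    ultimately have small: "p1' = 0 \<or> degree p1' < degree p'"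
      unfolding m_def[symmetric] by (metis eq_zero_or_degree_less)
    have "\<exists>r r'. tracked r r' \<and> (r' = 0 \<or> degree r' < degree q') \<and>
      sign_remainder p1 p1' q q' r r'"
    proof (cases "p1' = 0")
      case True
      then show ?thesis using tr1 by (intro exI[of _ p1] exI[of _ p1']) (auto simp: sign_remainder_def)
    next
      case False
      then show ?thesis using small less.hyps tr1 by blast
    qed
    then obtain r r' where r: "tracked r r'" "r' = 0 \<or> degree r' < degree q'"
      "\<And>t. poly q' t = 0 \<Longrightarrow> sg (poly p1' t) = sg (poly r' t)"
      "eventually (\<lambda>a. \<forall>t. poly (q a) t = 0 \<longrightarrow> sg (poly (p1 a) t) = sg (poly (r a) t)) \<F>"
      unfolding sign_remainder_def by blast
    have sq: "sg (x * x * y) = sg y" if "x \<noteq> 0" for x y :: "'z::linordered_field"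
      using that by (simp add: sg_mult) (auto simp: sg_def)
    have "sg (poly p' t) = sg (poly r' t)" if "poly q' t = 0" for t
      using r(3)[OF that] sq[OF c'0, of "poly p' t"] that by (simp add: p1'_def poly_monom)
    moreover have "eventually (\<lambda>a. \<forall>t. poly (q a) t = 0 \<longrightarrow> sg (poly (p a) t) = sg (poly (r a) t)) \<F>"
      using r(4) C_sign[OF cc]
    proof eventually_elim
      case (elim a)
      have "c a \<noteq> 0" using elim(2) c'0 by (metis sg_simps(2))
      show ?case
      proof (intro allI impI)
        fix t assume t: "poly (q a) t = 0"
        have "poly (p1 a) t = c a * c a * poly (p a) t" using t by (simp add: p1_def poly_monom)
        then show "sg (poly (p a) t) = sg (poly (r a) t)"
          using elim(1) t sq[OF \<open>c a \<noteq> 0\<close>, of "poly (p a) t"] by metis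
      qed
    qed
    ultimately have "sign_remainder p p' q q' r r'" unfolding sign_remainder_def by blast
    then show ?thesis using r(1,2) by blast
  qed
qed

definition at_point :: "'x \<Rightarrow> (('x \<Rightarrow> real poly) \<times> 'r poly) list \<Rightarrow> (real poly \<times> 'r poly) set" where
  "at_point a fam = (\<lambda>(p, p'). (p a, p')) ` set fam"

lemma at_point_mono: "set fam \<subseteq> set fam' \<Longrightarrow> at_point a fam \<subseteq> at_point a fam'"
  by (auto simp: at_point_def)

lemma at_pointI: "(p, p') \<in> set fam \<Longrightarrow> (p a, p') \<in> at_point a fam"
  unfolding at_point_def by (rule image_eqI[of _ _ "(p, p')"]) simp_all

lemma at_pointE:
  assumes "\<exists>(v, v')\<in>at_point a fam. Q v v'"
  obtains u u' where "(u, u') \<in> set fam" "Q (u a) u'"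
  using assms unfolding at_point_def by auto

lemma sign_match_constants:
  assumes "\<And>p p'. (p, p') \<in> set fam \<Longrightarrow> tracked p p' \<and> degree p' = 0"
  shows "eventually (\<lambda>a. sign_match (at_point a fam) {}) \<F>"
proof -
  have "eventually (\<lambda>a. \<forall>u\<in>set fam. \<forall>i. sg (coeff (fst u a) i) = sg (coeff (snd u) i)) \<F>"
    using assms by (intro eventually_ball_finite ballI tracked_signs) auto
  then show ?thesis
  proof eventually_elim
    case (elim a)
    have "sg (poly (p a) t) = sg (poly p' t')" if "(p, p') \<in> set fam" for p p' t t'
    proof -
      have s: "\<forall>i. sg (coeff (p a) i) = sg (coeff p' i)" using elim that by fastforce
      have "degree p' = 0" "degree (p a) = 0"
        using degree_eq_of_signs(1)[OF s] assms[OF that] by simp_all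
      then have "poly (p a) t = coeff (p a) 0" "poly p' t' = coeff p' 0"
        by (simp_all add: poly_altdef)
      then show ?thesis using s by simp
    qed
    then show ?case by (auto simp: sign_match_def at_point_def)
  qed
qed

text \<open>
  The list \<open>T\<close> holds remainders of \<open>p\<close> modulo the members of \<open>S\<close>. They give the signs of \<open>p\<close> at the roots
  of the polynomials in \<open>S\<close>; then the table is restricted to these roots and extended by \<open>p\<close>.
\<close>

lemma sign_match_step:
  assumes p: "tracked p p'" "degree p' > 0"
    and S: "\<And>u u'. (u, u') \<in> set S \<Longrightarrow> tracked u u'"
    and D: "((\<lambda>a. pderiv (p a)), pderiv p') \<in> set S"
    and rem: "\<And>u u'. (u, u') \<in> set S \<Longrightarrow> u' \<noteq> 0 \<Longrightarrow> \<exists>(r, r')\<in>set T. sign_remainder p p' u u' r r'"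
    and IH: "eventually (\<lambda>a. \<exists>Z. sign_match (at_point a (S @ T)) Z) \<F>"
  shows "eventually (\<lambda>a. \<exists>Z. sign_match (at_point a ((p, p') # S)) Z) \<F>"
proof -
  have "eventually (\<lambda>a. \<forall>u\<in>set S. snd u \<noteq> 0 \<longrightarrow> (\<exists>(r, r')\<in>set T.
      (\<forall>t. poly (snd u) t = 0 \<longrightarrow> sg (poly p' t) = sg (poly r' t)) \<and>
      (\<forall>t. poly (fst u a) t = 0 \<longrightarrow> sg (poly (p a) t) = sg (poly (r a) t)))) \<F>"
  proof (intro eventually_ball_finite ballI)
    fix u assume "u \<in> set S"
    then have u: "(fst u, snd u) \<in> set S" by simp
    show "eventually (\<lambda>a. snd u \<noteq> 0 \<longrightarrow> (\<exists>(r, r')\<in>set T.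
      (\<forall>t. poly (snd u) t = 0 \<longrightarrow> sg (poly p' t) = sg (poly r' t)) \<and>
      (\<forall>t. poly (fst u a) t = 0 \<longrightarrow> sg (poly (p a) t) = sg (poly (r a) t)))) \<F>"
    proof (cases "snd u = 0")
      case False
      obtain r r' where T: "(r, r') \<in> set T" and rem': "sign_remainder p p' (fst u) (snd u) r r'"
        using rem[OF u False] by blast
      note r = T rem'[unfolded sign_remainder_def, THEN conjunct1] rem'[unfolded sign_remainder_def, THEN conjunct2]
      from r(3) show ?thesis
      proof eventually_elim
        case (elim a)
        show ?case by (rule impI, rule bexI[OF _ r(1)], rule case_prodI, rule conjI[OF r(2) elim])
      qed
    qed simp
  qed simp
  moreover have "eventually (\<lambda>a. \<forall>u\<in>set S. fst u a = 0 \<longleftrightarrow> snd u = 0) \<F>"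
  proof (intro eventually_ball_finite ballI)
    fix u assume "u \<in> set S"
    then have "tracked (fst u) (snd u)" using S[of "fst u" "snd u"] by simp
    from tracked_degree(2)[OF this] show "eventually (\<lambda>a. fst u a = 0 \<longleftrightarrow> snd u = 0) \<F>" .
  qed simp
  ultimately show ?thesis using IH tracked_degree(1)[OF p(1)]
  proof eventually_elim
    case (elim a)
    obtain Z where Z: "sign_match (at_point a (S @ T)) Z" using elim(3) by blast
    have "at_point a S \<subseteq> at_point a (S @ T)" by (rule at_point_mono) simp
    from sign_match_restrict_to_roots[OF sign_match_mono[OF Z this]] obtain Z0
      where sub: "Z0 \<subseteq> Z" and m: "sign_match (at_point a S) Z0"
        and roots: "\<forall>(x, y)\<in>Z0. \<exists>(u, v)\<in>at_point a S. u \<noteq> 0 \<and> poly u x = 0" by (elim exE conjE)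
    have "sg (poly (p a) x) = sg (poly p' y)" if xy: "(x, y) \<in> Z0" for x y
    proof -
      obtain u u' where u: "(u, u') \<in> set S" "u a \<noteq> 0" "poly (u a) x = 0"
        by (rule at_pointE[OF bspec[OF roots xy, unfolded prod.case]]) (elim conjE)
      have uS: "(u a, u') \<in> at_point a S" using u(1) by (rule at_pointI)
      have "sg (poly (u a) x) = sg (poly u' y)"
        using sign_matchD(3)[OF m sign_matchD(2)[OF m xy] uS] .
      then have u'y: "poly u' y = 0" using u(3) by (metis sg_simps(1,2))
      have "u' \<noteq> 0" using bspec[OF elim(2) u(1)] u(2) by simp
      then obtain r r' where r: "(r, r') \<in> set T" "\<forall>t. poly u' t = 0 \<longrightarrow> sg (poly p' t) = sg (poly r' t)"
        "\<forall>t. poly (u a) t = 0 \<longrightarrow> sg (poly (p a) t) = sg (poly (r a) t)"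
        using bspec[OF elim(1) u(1)] unfolding fst_conv snd_conv by blast
      have "(r a, r') \<in> at_point a (S @ T)" using r(1) by (intro at_pointI) simp
      from sign_matchD(3)[OF Z sign_matchD(2)[OF Z subsetD[OF sub xy]] this]
      have "sg (poly (r a) x) = sg (poly r' y)" .
      then show ?thesis using r(2)[rule_format, OF u'y] r(3)[rule_format, OF u(3)] by (simp only:)
    qed
    moreover have "(pderiv (p a), pderiv p') \<in> at_point a S" using at_pointI[OF D] .
    moreover have "degree (p a) > 0" using elim(4) p(2) by simp
    ultimately have "\<exists>Z'. sign_match (insert (p a, p') (at_point a S)) Z'"
      using p(2) by (intro sign_match_extend[OF m])
    moreover have "at_point a ((p, p') # S) = insert (p a, p') (at_point a S)"
      by (simp add: at_point_def)
    ultimately show ?case by (simp only:)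
  qed
qed

text \<open>
  A polynomial of largest degree is replaced by its derivative and its remainders, all of smaller
  degree. This terminates because the multiset of degrees decreases.
\<close>

lemma tracked_sign_match:
  "(\<And>p p'. (p, p') \<in> set fam \<Longrightarrow> tracked p p') \<Longrightarrow>
    eventually (\<lambda>a. \<exists>Z. sign_match (at_point a fam) Z) \<F>"
proof (induction "mset (map (degree \<circ> snd) fam)" arbitrary: fam rule: less_induct)
  case less
  show ?case
  proof (cases "\<forall>u\<in>set fam. degree (snd u) = 0")
    case True
    then have "eventually (\<lambda>a. sign_match (at_point a fam) {}) \<F>"
      using less.prems by (intro sign_match_constants conjI) (fastforce dest: bspec)+
    then show ?thesis by eventually_elim blast
  next
    case False
    define n where "n = Max (degree ` snd ` set fam)"
    have "n \<in> degree ` snd ` set fam" unfolding n_def using False by (intro Max_in) auto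
    then obtain p p' where p: "(p, p') \<in> set fam" "degree p' = n" by auto
    have le_n: "degree u' \<le> n" if "(u, u') \<in> set fam" for u u'
    proof -
      have "degree (snd (u, u')) \<in> degree ` snd ` set fam" by (intro imageI that)
      then show ?thesis unfolding n_def by (intro Max_ge) simp_all
    qed
    obtain u where "u \<in> set fam" "degree (snd u) \<noteq> 0" using False by blast
    then have n0: "n > 0" using le_n[of "fst u" "snd u"] by simp
    define D where "D = ((\<lambda>a. pderiv (p a)), pderiv p')"
    define rest where "rest = remove1 (p, p') fam"
    define S where "S = rest @ [D]"
    have tp: "tracked p p'" using less.prems p(1) .
    have sub: "set rest \<subseteq> set fam" unfolding rest_def by (rule set_remove1_subset)
    have tS: "tracked u u'" if "(u, u') \<in> set S" for u u'
    proof (cases "(u, u') = D")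
      case False
      then have "(u, u') \<in> set fam" using that sub by (auto simp: S_def)
      then show ?thesis by (rule less.prems)
    qed (use tracked_pderiv[OF tp] in \<open>simp add: D_def\<close>)
    have degS: "degree u' \<le> n" if "(u, u') \<in> set S" for u u'
    proof (cases "(u, u') = D")
      case False
      then have "(u, u') \<in> set fam" using that sub by (auto simp: S_def)
      then show ?thesis by (rule le_n)
    qed (use p(2) in \<open>simp add: D_def degree_pderiv\<close>)
    define good :: "('x \<Rightarrow> real poly) \<times> 'r poly \<Rightarrow> ('x \<Rightarrow> real poly) \<times> 'r poly \<Rightarrow> bool"
      where "good = (\<lambda>(u, u') (r, r'). tracked r r' \<and> degree r' < n \<and> (u' \<noteq> 0 \<longrightarrow> sign_remainder p p' u u' r r'))"
    have "\<exists>w. good x w" if "x \<in> set S" for x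
    proof -
      obtain u u' where x: "x = (u, u')" by (cases x)
      have u: "(u, u') \<in> set S" using that x by simp
      show ?thesis
      proof (cases "u' = 0")
        case True
        have "degree (pderiv p') < n" using p(2) n0 by (simp add: degree_pderiv)
        then have "good x D" using tracked_pderiv[OF tp] True by (simp add: good_def D_def x)
        then show ?thesis by blast
      next
        case False
        from tracked_remainder[OF tS[OF u] False tp] obtain r r' where r: "tracked r r'"
          "r' = 0 \<or> degree r' < degree u'" "sign_remainder p p' u u' r r'" by blast
        have "degree r' < n" using r(2) degS[OF u] n0 by auto
        then have "good x (r, r')" using r(1,3) by (simp add: good_def x)
        then show ?thesis by blast
      qed
    qed
    then have "\<forall>x\<in>set S. \<exists>w. good x w" by blast
    from bchoice[OF this] obtain w where w: "\<And>x. x \<in> set S \<Longrightarrow> good x (w x)" by blast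
    define T where "T = map w S"
    have "eventually (\<lambda>a. \<exists>Z. sign_match (at_point a (S @ T)) Z) \<F>"
    proof (rule less.hyps)
      have "mset fam = mset rest + {#(p, p')#}" using p(1) by (simp add: rest_def)
      then have "mset (map (degree \<circ> snd) fam) = mset (map (degree \<circ> snd) rest) + {#n#}"
        using p(2) by (simp only: mset_map image_mset_union image_mset_single o_def snd_conv)
      moreover have "mset (map (degree \<circ> snd) (S @ T)) =
          mset (map (degree \<circ> snd) rest) + mset (map (degree \<circ> snd) (D # T))"
        by (simp add: S_def)
      moreover have "mset (map (degree \<circ> snd) (D # T)) < {#n#}"
      proof -
        have "degree (snd x) < n" if x: "x \<in> set (D # T)" for x
        proof (cases "x = D")
          case True
          then show ?thesis using p(2) n0 by (simp add: D_def degree_pderiv)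
        next
          case False
          then have "x \<in> w ` set S" using x by (simp add: T_def)
          then obtain v where v: "x = w v" "v \<in> set S" by (elim imageE)
          then have "good v x" using w[OF v(2)] by (simp only:)
          then show ?thesis by (simp add: good_def split_beta)
        qed
        then have "y < n" if "y \<in># mset (map (degree \<circ> snd) (D # T))" for y
        proof -
          have "y \<in> (degree \<circ> snd) ` set (D # T)" using that unfolding set_mset_mset set_map .
          then obtain x where "y = (degree \<circ> snd) x" "x \<in> set (D # T)" by (elim imageE)
          then show ?thesis using \<open>\<And>x. x \<in> set (D # T) \<Longrightarrow> degree (snd x) < n\<close> by (simp only: o_def)
        qed
        then show ?thesis by (intro ex_gt_imp_less_multiset exI[of _ n] conjI allI impI) simp_all
      qed
      ultimately show "mset (map (degree \<circ> snd) (S @ T)) < mset (map (degree \<circ> snd) fam)"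
        by (simp only: add_less_cancel_left)
      show "tracked u u'" if uu: "(u, u') \<in> set (S @ T)" for u u'
      proof (cases "(u, u') \<in> set S")
        case False
        then have "(u, u') \<in> w ` set S" using uu by (simp add: T_def)
        then obtain v where v: "(u, u') = w v" "v \<in> set S" by (elim imageE)
        then have "good v (u, u')" using w[OF v(2)] by (simp only:)
        then show ?thesis by (simp add: good_def split_beta)
      qed (rule tS)
    qed
    then have ev: "eventually (\<lambda>a. \<exists>Z. sign_match (at_point a ((p, p') # S)) Z) \<F>"
    proof (rule sign_match_step[OF tp _ tS, rotated -1])
      show "degree p' > 0" using p(2) n0 by simp
      show "((\<lambda>a. pderiv (p a)), pderiv p') \<in> set S" by (simp add: S_def D_def)
      fix u u' assume u: "(u, u') \<in> set S" "u' \<noteq> 0"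
      obtain r r' where r: "w (u, u') = (r, r')" by (cases "w (u, u')")
      have "good (u, u') (r, r')" using w[OF u(1)] by (simp only: r)
      moreover have "(r, r') \<in> set T" unfolding T_def set_map by (rule image_eqI[where f = w, OF r[symmetric] u(1)])
      ultimately show "\<exists>(r, r')\<in>set T. sign_remainder p p' u u' r r'" using u(2) by (auto simp: good_def)
    qed
    have sub': "set fam \<subseteq> set ((p, p') # S)"
    proof
      fix x assume "x \<in> set fam"
      then show "x \<in> set ((p, p') # S)" by (cases "x = (p, p')") (simp_all add: S_def rest_def)
    qed
    from ev show ?thesis
    proof eventually_elim
      case (elim a)
      then obtain Z where "sign_match (at_point a ((p, p') # S)) Z" ..
      from sign_match_mono[OF this at_point_mono[OF sub']] show ?case ..
    qed
  qed
qed

end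

context sign_tracking
begin

lemma tracked_const: "C c c' \<Longrightarrow> tracked (\<lambda>a. [:c a:]) [:c':]"
  using tracked_monom[of c c' 0] by (simp add: monom_0)

lemma tracked_var: "tracked (\<lambda>a. [:0, 1:]) [:0, 1:]"
  using tracked_monom[OF C_one, of 1] by (simp add: monom_altdef)

end

text \<open>
  The new ring consists of the values of tracked polynomials at the \<open>i\<close>-th coordinate, paired with
  their values at \<open>\<xi>\<close>. The new filter is generated by the points \<open>a(i := t)\<close> for which finitely many
  tracked polynomials have at \<open>t\<close> the signs that they have at \<open>\<xi>\<close>; matching sign tables
  provide such \<open>t\<close>, so the filter is proper. The functions in \<open>C\<close> must not depend on the coordinate
  that is overwritten.
\<close>

lemma adjoin_coordinate:
  fixes \<F> :: "('n \<Rightarrow> real) filter" and C :: "(('n \<Rightarrow> real) \<Rightarrow> real) \<Rightarrow> 'r::real_closed_field \<Rightarrow> bool"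
  assumes "sign_tracking \<F> C" and F: "\<F> \<noteq> bot"
    and indep0: "\<forall>c c' a t. C c c' \<longrightarrow> c (a(i := t)) = c a"
  shows "\<exists>\<F>' C'. sign_tracking \<F>' C' \<and> \<F>' \<noteq> bot \<and> C' (\<lambda>a. a i) \<xi> \<and> (\<forall>c c'. C c c' \<longrightarrow> C' c c') \<and>
    (\<forall>e e'. C' e e' \<longrightarrow> (\<forall>j. j \<noteq> i \<longrightarrow> (\<forall>c c' a t. C c c' \<longrightarrow> c (a(j := t)) = c a) \<longrightarrow>
      (\<forall>a t. e (a(j := t)) = e a)))"
proof -
  interpret sign_tracking \<F> C by fact
  have indep: "c (a(i := t)) = c a" if "C c c'" for c c' a t using indep0 that by blast
  define C' where "C' e e' \<longleftrightarrow> (\<exists>p p'. tracked p p' \<and> e = (\<lambda>a. poly (p a) (a i)) \<and> e' = poly p' \<xi>)" for e e'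
  have C'I: "C' (\<lambda>a. poly (p a) (a i)) (poly p' \<xi>)" if "tracked p p'" for p p'
    using that by (auto simp: C'_def)
  have coeff_indep: "p (a(j := t)) = p a"
    if "tracked p p'" "\<And>c c' a t. C c c' \<Longrightarrow> c (a(j := t)) = c a" for p p' j a t
    using that(2)[OF trackedD[OF that(1)]] by (intro poly_eqI)
  define good where "good S a t \<longleftrightarrow> (\<forall>(p, p')\<in>S. sg (poly (p a) t) = sg (poly p' \<xi>))"
    for S :: "((('n \<Rightarrow> real) \<Rightarrow> real poly) \<times> 'r poly) set" and a t
  define E where "E P \<longleftrightarrow> (\<exists>S. finite S \<and> (\<forall>(p, p')\<in>S. tracked p p') \<and>
      eventually (\<lambda>a. \<forall>t. good S a t \<longrightarrow> P (a(i := t))) \<F>)" for P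
  have "is_filter E"
  proof
    show "E (\<lambda>_. True)" unfolding E_def by (intro exI[of _ "{}"]) simp
  next
    fix P Q assume "E P" "E Q"
    then obtain S S' where S: "finite S" "\<forall>(p, p')\<in>S. tracked p p'"
        "eventually (\<lambda>a. \<forall>t. good S a t \<longrightarrow> P (a(i := t))) \<F>"
      and S': "finite S'" "\<forall>(p, p')\<in>S'. tracked p p'"
        "eventually (\<lambda>a. \<forall>t. good S' a t \<longrightarrow> Q (a(i := t))) \<F>"
      unfolding E_def by (elim exE conjE)
    have gd: "good (S \<union> S') a t \<Longrightarrow> good S a t \<and> good S' a t" for a t
      unfolding good_def by (simp add: ball_Un)
    from S(3) S'(3) have "eventually (\<lambda>a. \<forall>t. good (S \<union> S') a t \<longrightarrow> P (a(i := t)) \<and> Q (a(i := t))) \<F>"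
      by eventually_elim (use gd in blast)
    then show "E (\<lambda>x. P x \<and> Q x)"
      unfolding E_def using S(1,2) S'(1,2) by (intro exI[of _ "S \<union> S'"]) (simp add: ball_Un)
  next
    fix P Q :: "('n \<Rightarrow> real) \<Rightarrow> bool" assume PQ: "\<forall>x. P x \<longrightarrow> Q x" and "E P"
    then obtain S where S: "finite S" "\<forall>(p, p')\<in>S. tracked p p'"
        "eventually (\<lambda>a. \<forall>t. good S a t \<longrightarrow> P (a(i := t))) \<F>"
      unfolding E_def by (elim exE conjE)
    from S(3) have "eventually (\<lambda>a. \<forall>t. good S a t \<longrightarrow> Q (a(i := t))) \<F>"
      by eventually_elim (use PQ in blast)
    then show "E Q" unfolding E_def using S(1,2) by blast
  qed
  define \<F>' where "\<F>' = Abs_filter E"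
  have ev: "eventually P \<F>' \<longleftrightarrow> E P" for P
    unfolding \<F>'_def by (rule eventually_Abs_filter) fact
  have "\<not> E (\<lambda>_. False)"
  proof
    assume "E (\<lambda>_. False)"
    then obtain S where S: "finite S" "\<forall>(p, p')\<in>S. tracked p p'"
        "eventually (\<lambda>a. \<forall>t. good S a t \<longrightarrow> False) \<F>"
      unfolding E_def by (elim exE conjE)
    obtain fam where fam: "set fam = S" using finite_list[OF S(1)] by blast
    have "eventually (\<lambda>a. \<exists>Z. sign_match (at_point a fam) Z) \<F>"
      using S(2) fam by (intro tracked_sign_match) blast
    with S(3) have "eventually (\<lambda>a. False) \<F>"
    proof eventually_elim
      case (elim a)
      from elim(2) obtain Z where Z: "sign_match (at_point a fam) Z" by blast
      note Z' = sign_match_converse[OF Z]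
      obtain t where "aligned (Z\<inverse>) \<xi> t"
        using ex_aligned[OF sign_matchD(1)[OF Z'] sign_matchD(2)[OF Z']] by blast
      then have al: "aligned Z t \<xi>" by (simp only: aligned_converse)
      have "good S a t"
        unfolding good_def
      proof (intro ballI case_prodI2)
        fix u p p' assume "u \<in> S" "u = (p, p')"
        then have "(p a, p') \<in> at_point a fam" using fam by (intro at_pointI) simp
        from sign_matchD(3)[OF Z al this] show "sg (poly (p a) t) = sg (poly p' \<xi>)" .
      qed
      then show ?case using elim(1) by blast
    qed
    then show False using F by (simp add: trivial_limit_def)
  qed
  then have F': "\<F>' \<noteq> bot" by (simp add: trivial_limit_def ev)
  have "sign_tracking \<F>' C'"
  proof
    show "C' (\<lambda>_. 1) 1" using C'I[OF tracked_const[OF C_one]] by simp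
    show "C' (\<lambda>a. - c a) (- c')" if "C' c c'" for c c'
      using that tracked_minus unfolding C'_def by fastforce
    show "eventually (\<lambda>a. sg (c a) = sg c') \<F>'" if "C' c c'" for c c'
    proof -
      obtain p p' where p: "tracked p p'" "c = (\<lambda>a. poly (p a) (a i))" "c' = poly p' \<xi>"
        using \<open>C' c c'\<close> by (auto simp: C'_def)
      have "p (a(i := t)) = p a" for a t by (rule coeff_indep[OF p(1) indep])
      then have "E (\<lambda>a. sg (c a) = sg c')"
        unfolding E_def using p(1) by (intro exI[of _ "{(p, p')}"]) (simp add: good_def p(2,3))
      then show ?thesis by (simp add: ev)
    qed
    fix c c' d d' assume "C' c c'" "C' d d'"
    then obtain p p' q q' where pq: "tracked p p'" "c = (\<lambda>a. poly (p a) (a i))" "c' = poly p' \<xi>"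
      "tracked q q'" "d = (\<lambda>a. poly (q a) (a i))" "d' = poly q' \<xi>"
      unfolding C'_def by (elim exE conjE)
    show "C' (\<lambda>a. c a + d a) (c' + d')" using C'I[OF tracked_add[OF pq(1,4)]] by (simp add: pq)
    show "C' (\<lambda>a. c a * d a) (c' * d')" using C'I[OF tracked_mult[OF pq(1,4)]] by (simp add: pq)
  qed
  moreover have "C' (\<lambda>a. a i) \<xi>" using C'I[OF tracked_var] by simp
  moreover have "C' c c'" if "C c c'" for c c' using C'I[OF tracked_const[OF that]] by simp
  moreover have "e (a(j := t)) = e a"
    if e: "C' e e'" and j: "j \<noteq> i" "\<And>c c' a t. C c c' \<Longrightarrow> c (a(j := t)) = c a" for e e' j a t
  proof -
    obtain p p' where p: "tracked p p'" "e = (\<lambda>a. poly (p a) (a i))" "e' = poly p' \<xi>"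
      using e unfolding C'_def by (elim exE conjE)
    have "p (a(j := t)) = p a" by (rule coeff_indep[OF p(1) j(2)])
    then show ?thesis using j(1) by (simp add: p(2))
  qed
  ultimately show ?thesis using F' by (intro exI[of _ \<F>'] exI[of _ C']) blast
qed

lemma ex_sign_tracking_coordinates:
  fixes \<phi> :: "real \<Rightarrow> 'r::real_closed_field" and \<xi> :: "'n \<Rightarrow> 'r"
  assumes hom: "\<phi> 1 = 1" "\<And>a b. \<phi> (a + b) = \<phi> a + \<phi> b" "\<And>a b. \<phi> (a * b) = \<phi> a * \<phi> b"
    and W: "finite W"
  shows "\<exists>\<F> C. sign_tracking \<F> C \<and> \<F> \<noteq> bot \<and> (\<forall>r. C (\<lambda>_. r) (\<phi> r)) \<and> (\<forall>i\<in>W. C (\<lambda>a. a i) (\<xi> i)) \<and>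
    (\<forall>c c' j a t. C c c' \<longrightarrow> j \<notin> W \<longrightarrow> c (a(j := t)) = c a)"
  using W
proof induction
  case empty
  have zero: "\<phi> 0 = 0" using hom(2)[of 0 0] by simp
  have neg: "\<phi> (- r) = - \<phi> r" for r using hom(2)[of r "- r"] zero by (simp add: eq_neg_iff_add_eq_0 add.commute)
  have pos: "\<phi> r > 0" if "r > 0" for r
  proof -
    \<comment> \<open>every ring homomorphism from the reals preserves the order, since squares go to squares\<close>
    have "\<phi> r = \<phi> (sqrt r) * \<phi> (sqrt r)" using that by (simp flip: hom(3))
    then have "\<phi> r \<ge> 0" by simp
    moreover have "\<phi> r * \<phi> (1 / r) = 1" using that by (simp add: hom(1) flip: hom(3))
    ultimately show ?thesis by (metis less_le mult_zero_left zero_neq_one)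
  qed
  have sgn: "sg (\<phi> r) = sg r" for r
  proof (cases r "0 :: real" rule: linorder_cases)
    case less
    then have "\<phi> r < 0" using pos[of "- r"] neg by simp
    then show ?thesis using less by (simp add: sg_def)
  next
    case greater
    then have "\<phi> r > 0" by (rule pos)
    then show ?thesis using greater by (simp add: sg_def)
  qed (simp add: zero)
  define C where "C c c' \<longleftrightarrow> (\<exists>r. c = (\<lambda>_. r) \<and> c' = \<phi> r)" for c :: "('n \<Rightarrow> real) \<Rightarrow> real" and c'
  have "sign_tracking (top :: ('n \<Rightarrow> real) filter) C"
    by unfold_locales (auto simp: C_def sgn hom neg intro: exI[of _ 1] exI[of _ "_ + _"] exI[of _ "_ * _"])
  moreover have "(top :: ('n \<Rightarrow> real) filter) \<noteq> bot" by (simp add: trivial_limit_def eventually_top)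
  moreover have "\<forall>r. C (\<lambda>_. r) (\<phi> r)" "\<forall>c c' j a t. C c c' \<longrightarrow> j \<notin> {} \<longrightarrow> c (a(j := t)) = c a"
    by (auto simp: C_def)
  ultimately show ?case by blast
next
  case (insert i W)
  then obtain \<F> C where FC: "sign_tracking \<F> C" "\<F> \<noteq> bot" "\<And>r. C (\<lambda>_. r) (\<phi> r)"
    "\<And>i. i \<in> W \<Longrightarrow> C (\<lambda>a. a i) (\<xi> i)" "\<And>c c' j a t. C c c' \<Longrightarrow> j \<notin> W \<Longrightarrow> c (a(j := t)) = c a"
    by blast
  have ind: "\<forall>c c' a t. C c c' \<longrightarrow> c (a(i := t)) = c a" using FC(5) insert.hyps(2) by blast
  from adjoin_coordinate[OF FC(1,2) ind, where \<xi> = "\<xi> i"]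
  obtain \<F>' C' where FC': "sign_tracking \<F>' C'" "\<F>' \<noteq> bot" "C' (\<lambda>a. a i) (\<xi> i)"
    and sub: "\<And>c c'. C c c' \<Longrightarrow> C' c c'"
    and indep: "\<forall>e e'. C' e e' \<longrightarrow> (\<forall>j. j \<noteq> i \<longrightarrow> (\<forall>c c' a t. C c c' \<longrightarrow> c (a(j := t)) = c a) \<longrightarrow>
      (\<forall>a t. e (a(j := t)) = e a))"
    by (elim exE conjE) blast
  have "e (a(j := t)) = e a" if e: "C' e e'" "j \<notin> insert i W" for e e' j a t
  proof -
    have "\<forall>c c' a t. C c c' \<longrightarrow> c (a(j := t)) = c a" using FC(5) e(2) by blast
    then show ?thesis using indep e by blast
  qed
  moreover have "\<forall>k\<in>insert i W. C' (\<lambda>a. a k) (\<xi> k)" using FC(4) FC'(3) sub by blast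
  ultimately show ?case using FC'(1,2) FC(3) sub by (intro exI[of _ \<F>'] exI[of _ C'] conjI) blast+
qed

text \<open>
  At the residues of the indeterminates the members of the cone are nonnegative by construction, and
  every polynomial, being built from constants and indeterminates, is tracked there.
\<close>

lemma prime_cone_realizable:
  assumes "prime_cone UNIV P"
  shows "realizable (P :: ('n::finite, real) mpoly set)"
proof -
  let ?r = "residue_eval :: ('n, real) mpoly \<Rightarrow> _"
  define \<phi> where "\<phi> c = ?r (mconst c)" for c
  have hom: "\<phi> 1 = 1" "\<phi> (a + b) = \<phi> a + \<phi> b" "\<phi> (a * b) = \<phi> a * \<phi> b" for a b
    by (simp_all add: \<phi>_def mconst_hom residue_eval_hom)
  from ex_sign_tracking_coordinates[of \<phi> UNIV "\<lambda>i. ?r (mvar i)", OF hom]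
  obtain \<F> C where FC: "sign_tracking \<F> C" "\<F> \<noteq> bot" "\<And>c. C (\<lambda>_. c) (\<phi> c)"
    "\<And>i. C (\<lambda>a. a i) (?r (mvar i))" by auto
  interpret sign_tracking \<F> C by fact
  have C: "C (\<lambda>a. poly_eval p (vec_lambda a)) (?r p)" for p
  proof (induction p rule: mpoly_ring_induct)
    case (const c)
    then show ?case using FC(3) by (simp add: poly_eval_mconst \<phi>_def)
  next
    case (var i)
    then show ?case using FC(4) by (simp add: poly_eval_mvar)
  next
    case (add p q)
    from C_add[OF this] show ?case by (simp only: poly_eval_add residue_eval_hom)
  next
    case (mult p q)
    from C_mult[OF this] show ?case by (simp only: poly_eval_mult residue_eval_hom)
  qed
  have "realizable (test_cone :: ('n, real) mpoly set)"
    unfolding realizable_def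
  proof (intro allI impI)
    fix S :: "('n, real) mpoly set" assume S: "S \<subseteq> test_cone" "finite S"
    have "eventually (\<lambda>a. \<forall>s\<in>S. sg (poly_eval s (vec_lambda a)) = sg (?r s)) \<F>"
      using S(2) C_sign[OF C] by (intro eventually_ball_finite) blast+
    from eventually_happens'[OF FC(2) this] obtain a
      where a: "\<forall>s\<in>S. sg (poly_eval s (vec_lambda a)) = sg (?r s)" by blast
    have "0 \<le> poly_eval s (vec_lambda a)" if "s \<in> S" for s
    proof -
      have "0 \<le> ?r s" using residue_eval_nonneg S(1) that by blast
      then have "\<not> ?r s < 0" by simp
      then show ?thesis using bspec[OF a that] by (simp add: sg_eq_iff not_less)
    qed
    then show "\<exists>x. \<forall>s\<in>S. 0 \<le> poly_eval s x" by blast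
  qed
  from test_cone(2)[OF this assms] show ?thesis .
qed

section \<open>The Positivstellensatz\<close>

lemma ex_point_of_proper_preordering:
  assumes "proper_preordering UNIV T" "S \<subseteq> T" "finite S"
  shows "\<exists>x :: real ^ 'n. \<forall>s\<in>S. 0 \<le> poly_eval (s :: ('n::finite, real) mpoly) x"
proof -
  have "ring_set (UNIV :: ('n, real) mpoly set)" by (simp add: ring_set_def)
  from ex_prime_cone_above[OF this assms(1)] obtain P where "T \<subseteq> P" "prime_cone UNIV P" by blast
  then show ?thesis using prime_cone_realizable assms(2,3) unfolding realizable_def by blast
qed

definition preordering_generators :: "('n, real) mpoly list \<Rightarrow> ('n, real) mpoly set" where
  "preordering_generators f =
     {(\<Prod>j<length f. (f ! j) ^ e j) * q\<^sup>2 | (e :: nat \<Rightarrow> nat) q. \<forall>j. e j \<in> {0, 1}}"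

lemma preordering_0: "0 \<in> preordering f"
  unfolding preordering_def by (rule CollectI, rule exI[of _ 0]) auto

lemma preordering_add_generator:
  assumes "x \<in> preordering f" "g \<in> preordering_generators f"
  shows "x + g \<in> preordering f"
proof -
  obtain n \<epsilon> q where x: "x = (\<Sum>i<(n::nat). (\<Prod>j<length f. (f ! j) ^ \<epsilon> i j) * (q i)\<^sup>2)"
    "\<forall>i j. \<epsilon> i j \<in> {0, 1 :: nat}" using assms(1) unfolding preordering_def by blast
  obtain e r where g: "g = (\<Prod>j<length f. (f ! j) ^ e j) * r\<^sup>2" "\<forall>j. e j \<in> {0, 1 :: nat}"
    using assms(2) unfolding preordering_generators_def by blast
  define \<epsilon>' where "\<epsilon>' = \<epsilon>(n := e)"
  define q' where "q' = q(n := r)"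
  have "x + g = (\<Sum>i<Suc n. (\<Prod>j<length f. (f ! j) ^ \<epsilon>' i j) * (q' i)\<^sup>2)"
    unfolding x(1) g(1) sum.lessThan_Suc by (intro arg_cong2[where f = "(+)"] sum.cong) (auto simp: \<epsilon>'_def q'_def)
  moreover have "\<forall>i j. \<epsilon>' i j \<in> {0, 1}" using x(2) g(2) by (simp add: \<epsilon>'_def)
  ultimately show ?thesis unfolding preordering_def by blast
qed

lemma preordering_induct [consumes 1, case_names zero add]:
  assumes "x \<in> preordering f" "Q 0"
    "\<And>x g. x \<in> preordering f \<Longrightarrow> g \<in> preordering_generators f \<Longrightarrow> Q x \<Longrightarrow> Q (x + g)"
  shows "Q x"
proof -
  obtain n \<epsilon> q where x: "x = (\<Sum>i<(n::nat). (\<Prod>j<length f. (f ! j) ^ \<epsilon> i j) * (q i)\<^sup>2)"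
    "\<forall>i j. \<epsilon> i j \<in> {0, 1 :: nat}" using assms(1) unfolding preordering_def by blast
  define g where "g i = (\<Prod>j<length f. (f ! j) ^ \<epsilon> i j) * (q i)\<^sup>2" for i
  have g: "g i \<in> preordering_generators f" for i
    unfolding preordering_generators_def g_def using x(2) by blast
  have "(\<Sum>i<m. g i) \<in> preordering f \<and> Q (\<Sum>i<m. g i)" for m
  proof (induction m)
    case 0
    then show ?case using assms(2) preordering_0 by simp
  next
    case (Suc m)
    then show ?case using assms(3)[OF _ g] preordering_add_generator[OF _ g] by simp
  qed
  then show ?thesis by (simp add: x(1) g_def)
qed

lemma preordering_add: "y \<in> preordering f \<Longrightarrow> x \<in> preordering f \<Longrightarrow> x + y \<in> preordering f"
proof (induction y rule: preordering_induct)
  case (add y g)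
  then show ?case using preordering_add_generator[of "x + y" f g] by (simp add: add.assoc)
qed simp

text \<open>
  A factor \<open>f\<^sub>j\<close> that occurs in both generators yields \<open>f\<^sub>j\<^sup>2\<close>, which goes into the square.
\<close>

lemma generators_mult:
  assumes "g \<in> preordering_generators f" "g' \<in> preordering_generators f"
  shows "g * g' \<in> preordering_generators f"
proof -
  obtain e r where g: "g = (\<Prod>j<length f. (f ! j) ^ e j) * r\<^sup>2" "\<And>j. e j \<in> {0, 1 :: nat}"
    using assms(1) unfolding preordering_generators_def by blast
  obtain e' r' where g': "g' = (\<Prod>j<length f. (f ! j) ^ e' j) * r'\<^sup>2" "\<And>j. e' j \<in> {0, 1 :: nat}"
    using assms(2) unfolding preordering_generators_def by blast
  \<comment> \<open>d j is the sum of both exponents modulo 2; s collects the factors that occur twice\<close>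
  define d where "d j = (if e j = e' j then 0 else 1 :: nat)" for j
  define s where "s = (\<Prod>j<length f. (f ! j) ^ (e j * e' j))"
  have "(f ! j) ^ e j * (f ! j) ^ e' j = (f ! j) ^ d j * ((f ! j) ^ (e j * e' j))\<^sup>2" for j
    using g(2)[of j] g'(2)[of j] by (auto simp: d_def power2_eq_square)
  then have AB: "(\<Prod>j<length f. (f ! j) ^ e j) * (\<Prod>j<length f. (f ! j) ^ e' j) = (\<Prod>j<length f. (f ! j) ^ d j) * s\<^sup>2"
    (is "?A * ?B = ?D * _")
    by (simp add: s_def prod_power_distrib flip: prod.distrib)
  have "g * g' = (\<Prod>j<length f. (f ! j) ^ d j) * (s * r * r')\<^sup>2"
  proof -
    have "g * g' = (?A * ?B) * (r\<^sup>2 * r'\<^sup>2)" unfolding g(1) g'(1) by (simp only: ac_simps)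
    also have "\<dots> = (?D * s\<^sup>2) * (r\<^sup>2 * r'\<^sup>2)" by (simp only: AB)
    finally show ?thesis by (simp only: power_mult_distrib mult.assoc)
  qed
  moreover have "\<forall>j. d j \<in> {0, 1}" by (simp add: d_def)
  ultimately show ?thesis unfolding preordering_generators_def by blast
qed

lemma generator_in_preordering: "g \<in> preordering_generators f \<Longrightarrow> g \<in> preordering f"
  using preordering_add_generator[OF preordering_0] by fastforce

lemma preordering_mult: "y \<in> preordering f \<Longrightarrow> x \<in> preordering f \<Longrightarrow> x * y \<in> preordering f"
proof (induction y rule: preordering_induct)
  case (add y g)
  have "x * g \<in> preordering f" using add.prems
  proof (induction x rule: preordering_induct)
    case (add x h)
    then show ?case
      using preordering_add generator_in_preordering[OF generators_mult[OF add(2) \<open>g \<in> _\<close>]]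
      by (simp add: distrib_right)
  qed (simp add: preordering_0)
  then show ?case using add preordering_add by (simp add: distrib_left)
qed (simp add: preordering_0)

lemma square_preordering: "x * x \<in> preordering f"
  using square_in_preordering(1)[of x f] by (simp add: power2_eq_square)

lemma member_in_preordering:
  assumes "j < length f"
  shows "f ! j \<in> preordering f"
proof -
  define e :: "nat \<Rightarrow> nat" where "e i = (if i = j then 1 else 0)" for i
  have "(\<Prod>i<length f. (f ! i) ^ e i) = (\<Prod>i<length f. if i = j then f ! i else 1)"
    by (intro prod.cong) (auto simp: e_def)
  then have eq: "f ! j = (\<Prod>i<length f. (f ! i) ^ e i) * 1\<^sup>2" using assms by simp
  have "\<forall>i. e i \<in> {0, 1}" by (simp add: e_def)
  then have "f ! j \<in> preordering_generators f"
    unfolding preordering_generators_def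
    by (intro CollectI exI[of _ e] exI[of _ 1] conjI eq)
  then show ?thesis by (rule generator_in_preordering)
qed

text \<open>
  Otherwise \<open>T\<^sub>f - F T\<^sub>f\<close> would not contain \<open>- 1\<close>, and there would be a point of \<open>K\<^sub>f\<close> with \<open>F \<le> 0\<close>.
\<close>

theorem positivstellensatz:
  fixes f :: "('n::finite, real) mpoly list"
  assumes pos: "\<And>x. x \<in> semialg_set f \<Longrightarrow> poly_eval F x > 0"
  shows "\<exists>g\<in>preordering f. \<exists>h\<in>preordering f. g * F = 1 + h"
proof (rule ccontr)
  assume no: "\<not> ?thesis"
  define T where "T = {t - F * s | t s. t \<in> preordering f \<and> s \<in> preordering f}"
  have TI: "t - F * s \<in> T" if "t \<in> preordering f" "s \<in> preordering f" for t s using that by (auto simp: T_def)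
  have sub: "preordering f \<subseteq> T" using TI[OF _ preordering_0] by auto
  have "proper_preordering UNIV T"
    unfolding proper_preordering_def
  proof (intro conjI ballI)
    show "x * x \<in> T" for x using sub square_preordering by blast
    show "- 1 \<notin> T"
    proof
      assume "- 1 \<in> T"
      then obtain t s where ts': "- 1 = t - F * s" and ts: "t \<in> preordering f" "s \<in> preordering f"
        unfolding T_def by blast
      from ts' have "- 1 = t + - (F * s)" by (simp only: diff_conv_add_uminus)
      from one_plus_eq_minus[OF this] have "s * F = 1 + t" by (simp only: minus_minus mult.commute)
      then show False using no ts by blast
    qed
    fix x y assume "x \<in> T" "y \<in> T"
    then obtain t s t' s' where ts: "x = t - F * s" "y = t' - F * s'" "t \<in> preordering f" "s \<in> preordering f"
      "t' \<in> preordering f" "s' \<in> preordering f" unfolding T_def by blast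
    have "x + y = (t + t') - F * (s + s')" by (simp add: ts algebra_simps)
    with TI[OF preordering_add[OF ts(5,3)] preordering_add[OF ts(6,4)]] show "x + y \<in> T" by (simp only:)
    have "x * y = (t * t' + (F * F) * (s * s')) - F * (t * s' + s * t')" by (simp add: ts algebra_simps)
    moreover have "t * t' + (F * F) * (s * s') \<in> preordering f" "t * s' + s * t' \<in> preordering f"
      by (intro preordering_add preordering_mult square_preordering ts(3-6))+
    ultimately show "x * y \<in> T" using TI by (simp only:)
  qed simp
  moreover have "- F \<in> T"
    using TI[OF preordering_0 square_preordering[of 1]] by simp
  then have "insert (- F) (set f) \<subseteq> T"
    using subsetD[OF sub member_in_preordering] by (auto simp: in_set_conv_nth)
  ultimately obtain x where x: "\<forall>s\<in>insert (- F) (set f). 0 \<le> poly_eval s x"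
    using ex_point_of_proper_preordering[of T "insert (- F) (set f)"] by (meson List.finite_set finite_insert)
  then have "x \<in> semialg_set f" by (simp add: semialg_set_def)
  then show False using pos[of x] x by (simp add: poly_eval_minus)
qed

section \<open>Bounds for positive functionals\<close>

text \<open>
  For a log-convex sequence the ratios of successive terms increase. If the first ratio exceeded \<open>M\<close>,
  the sequence would grow faster than \<open>M\<^sup>n\<close>, but it is bounded by \<open>M c\<^sub>n \<le> M\<^bsup>n+1\<^esup> c\<^sub>0\<close>.
\<close>

lemma log_convex_growth_bound:
  fixes s c :: "nat \<Rightarrow> real"
  assumes "M > 0" and nonneg: "\<And>n. s n \<ge> 0"
    and convex: "\<And>n. (s (Suc n))\<^sup>2 \<le> s n * s (Suc (Suc n))"
    and sc: "\<And>n. s n \<le> M * c n" and cc: "\<And>n. c (Suc n) \<le> M * c n"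
  shows "s 1 \<le> M * s 0"
proof (rule ccontr)
  assume "\<not> s 1 \<le> M * s 0"
  then have gt: "s 1 > M * s 0" by simp
  have s0: "s 0 > 0"
  proof (rule ccontr)
    assume "\<not> s 0 > 0"
    then have "s 0 = 0" using nonneg[of 0] by simp
    then have "s 1 = 0" using convex[of 0] by simp
    then show False using gt \<open>s 0 = 0\<close> by simp
  qed
  define \<rho> where "\<rho> = s 1 / s 0"
  have \<rho>: "\<rho> > M" using gt s0 by (simp add: \<rho>_def field_simps)
  then have "\<rho> > 0" using assms(1) by simp
  have step: "s n > 0 \<and> s (Suc n) \<ge> \<rho> * s n" for n
  proof (induction n)
    case 0
    then show ?case using s0 by (simp add: \<rho>_def)
  next
    case (Suc n)
    then have pos: "s (Suc n) > 0" using mult_pos_pos[OF \<open>\<rho> > 0\<close>, of "s n"] by linarith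
    have "s n * (\<rho> * s (Suc n)) = (\<rho> * s n) * s (Suc n)" by simp
    also have "\<dots> \<le> s (Suc n) * s (Suc n)" using Suc pos by (intro mult_right_mono) auto
    also have "\<dots> \<le> s n * s (Suc (Suc n))" using convex[of n] by (simp add: power2_eq_square)
    finally have "\<rho> * s (Suc n) \<le> s (Suc (Suc n))" using Suc by simp
    then show ?case using pos by simp
  qed
  have low: "\<rho> ^ n * s 0 \<le> s n" for n
  proof (induction n)
    case (Suc n)
    have "\<rho> ^ Suc n * s 0 = \<rho> * (\<rho> ^ n * s 0)" by simp
    also have "\<dots> \<le> \<rho> * s n" using Suc \<open>\<rho> > 0\<close> by (intro mult_left_mono) auto
    finally show ?case using step[of n] by linarith
  qed simp
  have c: "c n \<le> M ^ n * c 0" for n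
  proof (induction n)
    case (Suc n)
    have "c (Suc n) \<le> M * c n" by (rule cc)
    also have "\<dots> \<le> M * (M ^ n * c 0)" using Suc assms(1) by (intro mult_left_mono) auto
    finally show ?case by simp
  qed simp
  have "(\<rho> / M) ^ n \<le> M * c 0 / s 0" for n
  proof -
    have "\<rho> ^ n * s 0 \<le> M * (M ^ n * c 0)"
      using low[of n] sc[of n] mult_left_mono[OF c[of n], of M] assms(1) by linarith
    then show ?thesis using s0 assms(1) by (simp add: power_divide field_simps)
  qed
  moreover have "\<rho> / M > 1" using \<rho> assms(1) by simp
  ultimately show False using real_arch_pow[of "\<rho> / M" "M * c 0 / s 0"] by (meson not_less)
qed

definition sq_modulus :: "('n, complex) mpoly \<Rightarrow> ('n, real) mpoly" where
  "sq_modulus p = Poly_Mapping.map Re p * Poly_Mapping.map Re p + Poly_Mapping.map Im p * Poly_Mapping.map Im p"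

lemma poly_of_real_sq_modulus: "poly_of_real (sq_modulus p) = p * poly_cnj p"
proof -
  let ?A = "poly_of_real (Poly_Mapping.map Re p)" and ?B = "poly_of_real (Poly_Mapping.map Im p)"
  have ss: "poly_scale \<i> (poly_scale (- \<i>) q) = q" "poly_scale (- \<i>) (poly_scale \<i> q) = q"
    for q :: "('a, complex) mpoly"
    by (intro poly_mapping_eqI, simp)+
  have sm: "poly_scale (- \<i>) q = - poly_scale \<i> q" for q :: "('a, complex) mpoly"
    by (intro poly_mapping_eqI) simp
  have "p * poly_cnj p = (?A + poly_scale \<i> ?B) * (?A + poly_scale (- \<i>) ?B)"
    by (subst (1 2) Defs.poly_decompose[of p]) simp
  also have "\<dots> = ?A * ?A + poly_scale \<i> (?B * ?A) + poly_scale (- \<i>) (?A * ?B)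
                   + poly_scale \<i> (poly_scale (- \<i>) (?B * ?B))"
    by (simp add: distrib_left distrib_right poly_scale_mult poly_scale_add add.assoc ss)
  also have "\<dots> = ?A * ?A + ?B * ?B" by (simp only: ss) (simp add: sm mult.commute)
  finally show ?thesis by (simp add: sq_modulus_def poly_of_real_plus poly_of_real_times)
qed

lemma sq_modulus_in_preordering: "sq_modulus p \<in> preordering f"
  unfolding sq_modulus_def by (intro preordering_add square_preordering)

lemma poly_eval_sq_modulus: "poly_eval (sq_modulus p) x = (cmod (poly_eval p x))\<^sup>2"
proof -
  have keys: "Poly_Mapping.keys (Poly_Mapping.map h p) \<subseteq> Poly_Mapping.keys p" if "h 0 = 0" for h :: "complex \<Rightarrow> real"
    using that by (auto simp: in_keys_iff lookup_map_zero)
  have "Re (poly_eval p x) = poly_eval (Poly_Mapping.map Re p) x"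
    using keys[of Re] by (simp add: poly_eval_superset[of "Poly_Mapping.keys p"] lookup_map_zero)
  moreover have "Im (poly_eval p x) = poly_eval (Poly_Mapping.map Im p) x"
    using keys[of Im] by (simp add: poly_eval_superset[of "Poly_Mapping.keys p"] lookup_map_zero)
  ultimately show ?thesis
    unfolding sq_modulus_def poly_eval_add poly_eval_mult cmod_power2 by (simp add: power2_eq_square)
qed

lemma quadratic_nonneg_discriminant:
  fixes a b c :: real
  assumes c: "c \<ge> 0" and nonneg: "\<And>t. a - 2 * t * b + t\<^sup>2 * c \<ge> 0"
  shows "b\<^sup>2 \<le> c * a"
proof (cases "c = 0")
  case True
  have "b = 0"
  proof (rule ccontr)
    assume "b \<noteq> 0"
    then show False using nonneg[of "(a + 1) / (2 * b)"] True by (simp add: field_simps)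
  qed
  then show ?thesis using True by simp
next
  case False
  then have "c > 0" using c by simp
  then show ?thesis using nonneg[of "b / c"] by (simp add: field_simps power2_eq_square)
qed

text \<open>
  With \<open>g (\<mu>\<^sup>2 - G) = 1 + h\<close> the sequences are \<open>s\<^sub>n = L(G\<^sup>n H)\<close> and \<open>c\<^sub>n = L(G\<^sup>n g H)\<close> for
  \<open>G = |p|\<^sup>2\<close>, \<open>H = |q|\<^sup>2\<close>. Applying \<open>L\<close> to the identity multiplied by \<open>G\<^sup>n H\<close> gives
  \<open>\<mu>\<^sup>2 c\<^sub>n = c\<^bsub>n+1\<^esub> + s\<^sub>n + L(G\<^sup>n H h)\<close> with nonnegative terms on the right. Log-convexity of \<open>s\<close>
  is the discriminant of \<open>t \<mapsto> L(G\<^sup>n H (G - t)\<^sup>2) \<ge> 0\<close>.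
\<close>

lemma functional_multiplication_bound:
  fixes f :: "('n::finite, real) mpoly list"
  assumes lin: "linear_functional L" and nn: "nonneg_on_preordering L f"
    and \<mu>: "\<mu> > 0" "\<And>x. x \<in> semialg_set f \<Longrightarrow> cmod (poly_eval p x) < \<mu>"
  shows "Re (L ((p * q) * poly_cnj (p * q))) \<le> \<mu>\<^sup>2 * Re (L (q * poly_cnj q))"
proof -
  interpret positive_functional L using positive_functionalI[OF lin nn] .
  define l where "l t = Re (L (poly_of_real t))" for t :: "('n, real) mpoly"
  have l_add: "l (s + t) = l s + l t" for s t by (simp add: l_def poly_of_real_plus L_add)
  have l_const: "l (mconst r * t) = r * l t" for r t
  proof -
    have "poly_of_real (mconst r * t) = poly_scale (complex_of_real r) (poly_of_real t)"
      unfolding poly_of_real_times poly_scale_eq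
      by (simp add: poly_of_real_def mconst_def map_single)
    then show ?thesis by (simp add: l_def L_scale)
  qed
  have l_nonneg: "l t \<ge> 0" if "t \<in> preordering f" for t
    using nn that by (auto simp: nonneg_on_preordering_def l_def complex_nonneg_Reals_iff)
  define G H where "G = sq_modulus p" and "H = sq_modulus q"
  have GT: "G \<in> preordering f" and HT: "H \<in> preordering f"
    by (simp_all add: G_def H_def sq_modulus_in_preordering)
  have powT: "G ^ n \<in> preordering f" for n
  proof (induction n)
    case 0
    show ?case using square_preordering[of 1 f] by simp
  qed (use GT preordering_mult in simp)
  have "poly_eval (mconst (\<mu>\<^sup>2) - G) x > 0" if "x \<in> semialg_set f" for x
  proof -
    have "(cmod (poly_eval p x))\<^sup>2 < \<mu>\<^sup>2" using \<mu>(2)[OF that] \<mu>(1) by (intro power_strict_mono) auto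
    then show ?thesis by (simp add: poly_eval_diff poly_eval_mconst G_def poly_eval_sq_modulus)
  qed
  from positivstellensatz[OF this] obtain g h where gh: "g \<in> preordering f" "h \<in> preordering f"
    "g * (mconst (\<mu>\<^sup>2) - G) = 1 + h" by blast
  define s where "s n = l (G ^ n * H)" for n
  define c where "c n = l (G ^ n * g * H)" for n
  have key: "\<mu>\<^sup>2 * c n = c (Suc n) + s n + l (G ^ n * H * h)" for n
  proof -
    have "mconst (\<mu>\<^sup>2) * (G ^ n * g * H) = G ^ n * H * (g * (mconst (\<mu>\<^sup>2) - G)) + G ^ Suc n * g * H"
      by (simp add: algebra_simps)
    also have "\<dots> = G ^ Suc n * g * H + G ^ n * H + G ^ n * H * h"
      unfolding gh(3) by (simp add: algebra_simps)
    finally show ?thesis unfolding c_def s_def by (metis l_add l_const)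
  qed
  have s_nonneg: "s n \<ge> 0" for n
    unfolding s_def using powT HT by (intro l_nonneg preordering_mult)
  have c_nonneg: "c n \<ge> 0" for n
    unfolding c_def using powT HT gh by (intro l_nonneg preordering_mult)
  have h_nonneg: "l (G ^ n * H * h) \<ge> 0" for n
    using powT HT gh by (intro l_nonneg preordering_mult)
  have "(s (Suc n))\<^sup>2 \<le> s n * s (Suc (Suc n))" for n
  proof (rule quadratic_nonneg_discriminant[OF s_nonneg])
    fix t :: real
    have two: "mconst (2 * t) = mconst t + mconst t" by (simp flip: mconst_hom(1))
    have sq: "mconst (t\<^sup>2) = mconst t * mconst t" by (simp add: mconst_hom power2_eq_square)
    have "G ^ n * H * ((G - mconst t) * (G - mconst t)) + mconst (2 * t) * (G ^ Suc n * H)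
      = G ^ Suc (Suc n) * H + mconst (t\<^sup>2) * (G ^ n * H)"
      unfolding two sq by (simp add: algebra_simps)
    then have "l (G ^ n * H * ((G - mconst t) * (G - mconst t))) + 2 * t * s (Suc n)
      = s (Suc (Suc n)) + t\<^sup>2 * s n"
      unfolding s_def by (metis l_add l_const)
    moreover have "l (G ^ n * H * ((G - mconst t) * (G - mconst t))) \<ge> 0"
      using powT HT by (intro l_nonneg preordering_mult square_preordering)
    ultimately show "0 \<le> s (Suc (Suc n)) - 2 * t * s (Suc n) + t\<^sup>2 * s n" by linarith
  qed
  moreover have "s n \<le> \<mu>\<^sup>2 * c n" "c (Suc n) \<le> \<mu>\<^sup>2 * c n" for n
    using key[of n] s_nonneg[of n] c_nonneg[of "Suc n"] h_nonneg[of n] by linarith+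
  moreover have "\<mu>\<^sup>2 > 0" using \<mu>(1) by simp
  ultimately have "s 1 \<le> \<mu>\<^sup>2 * s 0" using log_convex_growth_bound[of "\<mu>\<^sup>2" s c] s_nonneg by blast
  moreover have "poly_of_real (G * H) = (p * q) * poly_cnj (p * q)"
    by (simp add: poly_of_real_times G_def H_def poly_of_real_sq_modulus ac_simps)
  ultimately show ?thesis
    by (simp add: s_def l_def H_def poly_of_real_sq_modulus del: poly_cnj_times)
qed

theorem proposition2:
  fixes f :: "('n::finite, real) mpoly list"
    and L :: "('n, complex) mpoly \<Rightarrow> complex"
    and p :: "('n, complex) mpoly"
  assumes "linear_functional L"
    and "nonneg_on_preordering L f"
    and "bounded (poly_eval p ` semialg_set f)"
  shows "gns_bounded L (gns_op L p)
       \<and> gns_opnorm L (gns_op L p) \<le> sup_norm_on (semialg_set f) p"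
proof -
  interpret positive_functional L using positive_functionalI[OF assms(1,2)] .
  define M where "M = sup_norm_on (semialg_set f) p"
  have le_M: "cmod (poly_eval p x) \<le> M" if "x \<in> semialg_set f" for x
  proof -
    obtain B where "\<forall>y\<in>poly_eval p ` semialg_set f. cmod y \<le> B" using assms(3) by (auto simp: bounded_iff)
    then have "bdd_above ((\<lambda>x. cmod (poly_eval p x)) ` semialg_set f)" by (auto intro!: bdd_aboveI[of _ B])
    then show ?thesis using that by (auto simp: M_def sup_norm_on_def intro: cSUP_upper)
  qed
  have M0: "M \<ge> 0"
  proof (cases "semialg_set f = {}")
    case False
    then obtain x where "x \<in> semialg_set f" by blast
    from order_trans[OF norm_ge_zero le_M[OF this]] show ?thesis .
  qed (simp add: M_def sup_norm_on_def)
  have norm_class: "gns_norm L (gns_class L q) = sqrt (Re (L (q * poly_cnj q)))" for q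
    by (simp add: gns_norm_def gns_inner_class)
  have bound: "gns_norm L (gns_op L p u) \<le> M * gns_norm L u" if "u \<in> gns_space L" for u
  proof -
    from that have "u \<in> UNIV // gns_rel L" by (simp add: gns_space_def)
    then obtain q where u: "u = gns_class L q" by (rule quotientE)
    define N where "N = gns_norm L u"
    have N0: "N \<ge> 0" using pos[of q] by (simp add: N_def u norm_class complex_nonneg_Reals_iff)
    have approx: "gns_norm L (gns_op L p u) \<le> (M + e) * N" if "e > 0" for e
    proof -
      have lt: "cmod (poly_eval p x) < M + e" if "x \<in> semialg_set f" for x
        using le_M[OF that] \<open>e > 0\<close> by linarith
      have "M + e > 0" using M0 that by simp
      from functional_multiplication_bound[OF assms(1,2) this lt]
      have "Re (L ((p * q) * poly_cnj (p * q))) \<le> (M + e)\<^sup>2 * Re (L (q * poly_cnj q))" .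
      then have "sqrt (Re (L ((p * q) * poly_cnj (p * q)))) \<le> sqrt ((M + e)\<^sup>2 * Re (L (q * poly_cnj q)))"
        by (rule real_sqrt_le_mono)
      also have "\<dots> = (M + e) * N" using M0 that by (simp add: N_def u norm_class real_sqrt_mult)
      finally show ?thesis by (simp only: u gns_op_class norm_class)
    qed
    have "gns_norm L (gns_op L p u) \<le> M * N + \<delta>" if "\<delta> > 0" for \<delta>
    proof -
      \<comment> \<open>N + 1 because N may be 0\<close>
      have "\<delta> / (N + 1) * N \<le> \<delta>" using N0 that by (simp add: field_simps)
      moreover have "\<delta> / (N + 1) > 0" using N0 that by simp
      moreover from approx[OF this]
      have "gns_norm L (gns_op L p u) \<le> M * N + \<delta> / (N + 1) * N" by (simp only: distrib_right)
      ultimately show ?thesis by linarith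
    qed
    then show ?thesis unfolding N_def[symmetric] by (rule field_le_epsilon)
  qed
  have "gns_opnorm L (gns_op L p) \<le> M"
    unfolding gns_opnorm_def
  proof (rule cSUP_least)
    have "gns_class L 0 \<in> gns_space L" by (auto simp: gns_space_def intro: quotientI)
    moreover have "gns_norm L (gns_class L 0) = 0" using L_diff[of 0 0] by (simp add: norm_class)
    ultimately show "{u \<in> gns_space L. gns_norm L u \<le> 1} \<noteq> {}" by (metis (mono_tags, lifting) empty_iff mem_Collect_eq zero_le_one)
    fix u assume u: "u \<in> {u \<in> gns_space L. gns_norm L u \<le> 1}"
    then have "gns_norm L (gns_op L p u) \<le> M * gns_norm L u" using bound by blast
    also have "\<dots> \<le> M * 1" using u M0 by (intro mult_left_mono) auto
    finally show "gns_norm L (gns_op L p u) \<le> M" by simp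
  qed
  then show ?thesis using bound unfolding gns_bounded_def M_def by blast
qed

end
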